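(* Let $n\ge 1$ and let $S$ be either the Motzkin monoid $\mathscr M_n$ or the Jones monoid $\mathscr J_n$. For $\delta\in D(S)$ let $F_\delta=\{\alpha\in E(S):\widehat{\alpha}=\delta\}$. Then $E(S)$ is the disjoint union of the sets $F_\delta$ as $\delta$ ranges over $D(S)$, and consequently $$|E(S)|=\sum_{\delta\in D(S)} f_\delta,\qquad f_\delta=\prod_{\theta}\bigl(1+u_\theta l_\theta\bigr),$$ where the product is over the cycle components $\theta$ of the interface graph $\Gamma(\delta)$ (as explained in the context, only cycles containing both an upper and a lower return edge contribute a factor different from $1$).
   Context: Upper vertices $[n]=\{1,\dots,n\}$, lower vertices $[n]'=\{1',\dots,n'\}$. The partition monoid $\mathscr P_n$ consists of set partitions of $[n]\cup[n]'$; to multiply $\alpha,\beta$, identify each lower vertex $i'$ of $\alpha$ with the upper vertex $i$ of $\beta$ (a middle row), take connected components of the union of the blocks, and let $\alpha\beta$ be the induced partition on the upper vertices of $\alpha$ and lower vertices of $\beta$ (components lying entirely in the middle row are discarded). A partition is planar if, placing $i$ at $(i,1)$ and $i'$ at $(i,0)$, its blocks can be drawn as pairwise disjoint connected sets in the rectangle $[1,n]\times[0,1]$. $\mathscr M_n$ is the monoid of planar partitions with all blocks of size $1$ or $2$; $\mathscr J_n\subseteq\mathscr M_n$ consists of planar partitions with all blocks of size exactly $2$. A block is transversal if it meets both $[n]$ and $[n]'$; the rank of $\alpha$ is its number of transversal blocks. $E(S)$ is the set of idempotents of $S$. $D(S)$ is the set of all elements of $S$ of rank $0$ together with all idempotents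 of $S$ of rank $1$. Hat map: for $\alpha\in E(\mathscr M_n)$ of rank $r$ with transversal blocks $\{j_1,i_1'\},\dots,\{j_r,i_r'\}$, $j_1<\dots<j_r$ (then $i_1<\dots<i_r$ by planarity), let $s=2\lfloor r/2\rfloor$ and let $\widehat\alpha$ be obtained from $\alpha$ by replacing, for $t=1,\dots,s/2$, the blocks $\{j_{2t-1},i'_{2t-1}\},\{j_{2t},i'_{2t}\}$ by $\{j_{2t-1},j_{2t}\}$ and $\{i'_{2t-1},i'_{2t}\}$ (so $\widehat\alpha=\alpha$ if $r\le1$). Interface graph: for $\alpha\in\mathscr M_n$, $\Gamma(\alpha)$ is the graph on vertex set $[n]$ with an upper edge $\{a,b\}$ for each block $\{a,b\}\subseteq[n]$ of $\alpha$ and a lower edge $\{a,b\}$ for each block $\{a',b'\}\subseteq[n]'$ of $\alpha$ (upper and lower edges are distinguished, so an upper and a lower edge on the same pair form a cycle of length 2). Its connected components are cycles or paths. Returns: an upper block $\{a,b\}$ ($a<b$) of $\alpha$ is a return if there is no upper block $\{c,d\}$ with $c<a<b<d$ and no upper vertex $x<a$ lies in a transversal block; a lower block $\{a',b'\}$ ($a<b$) is a return if there is no lower block $\{c',d'\}$ with $c<a<b<d$ and no lower vertex $x'$ with $x<a$ lies in a transversal block. The corresponding edges of $\Gamma(\alpha)$ are called upper/lower return edges. For a cycle $\theta$ of $\Gamma(\alpha)$, $u_\theta$ and $l_\theta$ are the numbers of upper and lower return edges in $\theta$. (The paper takes the product over the cycles lying to the left of the leftmost transversal; cycles containing no return edges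 contribute factor $1$, so this is the same product.) *)

theory Defs
  imports "HOL-Analysis.Analysis"
begin

datatype vertex = Upper nat | Lower nat

type_synonym diagram = "vertex set set"

definition vertices :: "nat \<Rightarrow> vertex set" where
  "vertices n = Upper ` {1..n} \<union> Lower ` {1..n}"

definition partition_monoid :: "nat \<Rightarrow> diagram set" where
  "partition_monoid n = {\<alpha>. partition_on (vertices n) \<alpha>}"

datatype vertex3 = Top nat | Mid nat | Bot nat

primrec stack_upper :: "vertex \<Rightarrow> vertex3" where
  "stack_upper (Upper i) = Top i"
| "stack_upper (Lower i) = Mid i"

primrec stack_lower :: "vertex \<Rightarrow> vertex3" where
  "stack_lower (Upper i) = Mid i"
| "stack_lower (Lower i) = Bot i"

primrec stack_outer :: "vertex \<Rightarrow> vertex3" where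
  "stack_outer (Upper i) = Top i"
| "stack_outer (Lower i) = Bot i"

definition stacked_blocks :: "diagram \<Rightarrow> diagram \<Rightarrow> vertex3 set set" where
  "stacked_blocks \<alpha> \<beta> = (\<lambda>B. stack_upper ` B) ` \<alpha> \<union> (\<lambda>B. stack_lower ` B) ` \<beta>"

definition stacked_components :: "diagram \<Rightarrow> diagram \<Rightarrow> vertex3 set set" where
  "stacked_components \<alpha> \<beta> =
     \<Union>(stacked_blocks \<alpha> \<beta>) // (\<Union>B\<in>stacked_blocks \<alpha> \<beta>. B \<times> B)\<^sup>*"

text \<open>A component lying entirely in the middle row has an empty preimage under
  \<^const>\<open>stack_outer\<close>, so removing the empty set discards exactly those components.\<close>

definition diagram_mult :: "diagram \<Rightarrow> diagram \<Rightarrow> diagram" where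
  "diagram_mult \<alpha> \<beta> = (\<lambda>K. stack_outer -` K) ` stacked_components \<alpha> \<beta> - {{}}"

primrec position :: "vertex \<Rightarrow> real \<times> real" where
  "position (Upper i) = (real i, 1)"
| "position (Lower i) = (real i, 0)"

text \<open>The connected sets in which the blocks are drawn are required to be path-connected.
  Bare topological connectedness would be too weak: a rectangle contains two disjoint
  connected (but not path-connected) sets, each of which contains a pair of opposite corners,
  so that crossing blocks would be admitted.\<close>

definition planar :: "nat \<Rightarrow> diagram \<Rightarrow> bool" where
  "planar n \<alpha> \<longleftrightarrow>
     (\<exists>C :: vertex set \<Rightarrow> (real \<times> real) set.
        (\<forall>B\<in>\<alpha>. path_connected (C B) \<and> position ` B \<subseteq> C B \<and> C B \<subseteq> {1..real n} \<times> {0..1}) \<and>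
        disjoint_family_on C \<alpha>)"

definition motzkin_monoid :: "nat \<Rightarrow> diagram set" where
  "motzkin_monoid n =
     {\<alpha> \<in> partition_monoid n. planar n \<alpha> \<and> (\<forall>B\<in>\<alpha>. card B = 1 \<or> card B = 2)}"

definition jones_monoid :: "nat \<Rightarrow> diagram set" where
  "jones_monoid n = {\<alpha> \<in> partition_monoid n. planar n \<alpha> \<and> (\<forall>B\<in>\<alpha>. card B = 2)}"

definition transversal :: "vertex set \<Rightarrow> bool" where
  "transversal B \<longleftrightarrow> (\<exists>i. Upper i \<in> B) \<and> (\<exists>i. Lower i \<in> B)"

definition diagram_rank :: "diagram \<Rightarrow> nat" where
  "diagram_rank \<alpha> = card {B \<in> \<alpha>. transversal B}"

definition idempotents :: "diagram set \<Rightarrow> diagram set" where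
  "idempotents S = {\<alpha> \<in> S. diagram_mult \<alpha> \<alpha> = \<alpha>}"

definition D_set :: "diagram set \<Rightarrow> diagram set" where
  "D_set S = {\<alpha> \<in> S. diagram_rank \<alpha> = 0} \<union> {\<alpha> \<in> idempotents S. diagram_rank \<alpha> = 1}"

text \<open>The transversal blocks are numbered from 1, by increasing upper vertex:
  the \<open>t\<close>-th one consists of the upper vertex \<open>trans_upper \<alpha> t\<close> and
  the lower vertex \<open>trans_lower \<alpha> t\<close>.\<close>

definition trans_upper :: "diagram \<Rightarrow> nat \<Rightarrow> nat" where
  "trans_upper \<alpha> t = sorted_list_of_set {j. \<exists>i. {Upper j, Lower i} \<in> \<alpha>} ! (t - 1)"

definition trans_lower :: "diagram \<Rightarrow> nat \<Rightarrow> nat" where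
  "trans_lower \<alpha> t = (THE i. {Upper (trans_upper \<alpha> t), Lower i} \<in> \<alpha>)"

definition hat :: "diagram \<Rightarrow> diagram" where
  "hat \<alpha> =
     (let j = trans_upper \<alpha>; i = trans_lower \<alpha>; T = {1..diagram_rank \<alpha> div 2} in
       (\<alpha> - (\<Union>t\<in>T. {{Upper (j (2 * t - 1)), Lower (i (2 * t - 1))},
                        {Upper (j (2 * t)), Lower (i (2 * t))}}))
       \<union> (\<Union>t\<in>T. {{Upper (j (2 * t - 1)), Upper (j (2 * t))},
                    {Lower (i (2 * t - 1)), Lower (i (2 * t))}}))"

definition F_set :: "diagram set \<Rightarrow> diagram \<Rightarrow> diagram set" where
  "F_set S \<delta> = {\<alpha> \<in> idempotents S. hat \<alpha> = \<delta>}"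

text \<open>The edges of the interface graph are represented by the blocks they come from, so that an
  upper and a lower edge on the same pair of vertices remain distinct.\<close>

definition interface_edges :: "diagram \<Rightarrow> vertex set set" where
  "interface_edges \<alpha> =
     {e \<in> \<alpha>. \<exists>a b. a \<noteq> b \<and> (e = {Upper a, Upper b} \<or> e = {Lower a, Lower b})}"

definition endpoints :: "vertex set \<Rightarrow> nat set" where
  "endpoints e = {a. Upper a \<in> e \<or> Lower a \<in> e}"

definition interface_components :: "nat \<Rightarrow> diagram \<Rightarrow> nat set set" where
  "interface_components n \<alpha> =
     {1..n} // (\<Union>e\<in>interface_edges \<alpha>. endpoints e \<times> endpoints e)\<^sup>*"

definition edges_in :: "diagram \<Rightarrow> nat set \<Rightarrow> vertex set set" where
  "edges_in \<alpha> \<theta> = {e \<in> interface_edges \<alpha>. endpoints e \<subseteq> \<theta>}"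

definition is_cycle :: "diagram \<Rightarrow> nat set \<Rightarrow> bool" where
  "is_cycle \<alpha> \<theta> \<longleftrightarrow>
     (\<exists>vs es. length vs \<ge> 2 \<and> length es = length vs \<and> distinct vs \<and> distinct es \<and>
        set vs = \<theta> \<and> set es = edges_in \<alpha> \<theta> \<and>
        (\<forall>k<length vs. endpoints (es ! k) = {vs ! k, vs ! (Suc k mod length vs)}))"

definition cycle_components :: "nat \<Rightarrow> diagram \<Rightarrow> nat set set" where
  "cycle_components n \<alpha> = {\<theta> \<in> interface_components n \<alpha>. is_cycle \<alpha> \<theta>}"

definition upper_return :: "diagram \<Rightarrow> vertex set \<Rightarrow> bool" where
  "upper_return \<alpha> e \<longleftrightarrow> e \<in> \<alpha> \<and>
     (\<exists>a b. a < b \<and> e = {Upper a, Upper b} \<and>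
        \<not> (\<exists>c d. {Upper c, Upper d} \<in> \<alpha> \<and> c < a \<and> b < d) \<and>
        \<not> (\<exists>x B. x < a \<and> B \<in> \<alpha> \<and> transversal B \<and> Upper x \<in> B))"

definition lower_return :: "diagram \<Rightarrow> vertex set \<Rightarrow> bool" where
  "lower_return \<alpha> e \<longleftrightarrow> e \<in> \<alpha> \<and>
     (\<exists>a b. a < b \<and> e = {Lower a, Lower b} \<and>
        \<not> (\<exists>c d. {Lower c, Lower d} \<in> \<alpha> \<and> c < a \<and> b < d) \<and>
        \<not> (\<exists>x B. x < a \<and> B \<in> \<alpha> \<and> transversal B \<and> Lower x \<in> B))"

definition u_num :: "diagram \<Rightarrow> nat set \<Rightarrow> nat" where
  "u_num \<alpha> \<theta> = card {e \<in> edges_in \<alpha> \<theta>. upper_return \<alpha> e}"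

definition l_num :: "diagram \<Rightarrow> nat set \<Rightarrow> nat" where
  "l_num \<alpha> \<theta> = card {e \<in> edges_in \<alpha> \<theta>. lower_return \<alpha> e}"

definition f_num :: "nat \<Rightarrow> diagram \<Rightarrow> nat" where
  "f_num n \<delta> = (\<Prod>\<theta>\<in>cycle_components n \<delta>. 1 + u_num \<delta> \<theta> * l_num \<delta> \<theta>)"

end

theory Submission
  imports Defs
begin

text \<open>By the Fashoda theorem a diagram with blocks of size at most 2 is planar iff its blocks do not
  interleave along the boundary of the rectangle. Such a diagram is idempotent iff the two ends of every
  transversal are connected in the interface graph, in which case their component is a path with no
  further free ends. The hat map therefore closes the paths of two consecutive transversals to
  one cycle, through one upper and one lower return edge. Conversely, choose in some of the cycles of
  \<open>\<delta> \<in> D(S)\<close> one upper and one lower return edge and cut them. The cycles fall apart into paths, each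
  with one free upper and one free lower end; paths cannot cross, so joining the ends of each path by
  a transversal gives a planar diagram, which is idempotent and is mapped to \<open>\<delta>\<close> by the hat map. Hence
  the idempotents over \<open>\<delta>\<close> correspond to the choices of cuts, and a cycle \<open>\<theta>\<close> offers
  \<open>1 + u\<^sub>\<theta> l\<^sub>\<theta>\<close> of them.\<close>

text \<open>Topology serves only to characterise planarity. Afterwards the interface graph is a pair
  of involutions, \<open>mate Upper\<close> and \<open>mate Lower\<close>, whose fixed points are
  the vertices without an arc on that side; components are orbits, and that paths do not cross is a
  parity count of fixed points. The obstacle is that the hat map pairs ends by position alone,
  whereas cuts are chosen cycle by cycle. Both clauses of the definition of a return reconcile the
  two. No arc lies over a return edge, so its ends lie beneath no arc: transversals may start there,
  and no end of a cut edge lies inside another cut edge. No transversal lies to its left, so the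
  ends to its left all stem from cut edges and are even in number; its own two ends therefore have
  positions 2t - 1 and 2t. In the other direction, an arc made by the hat map is a return because an
  unpaired transversal can only be the rightmost one.\<close>

abbreviation side :: "(nat \<Rightarrow> vertex) \<Rightarrow> bool" where
  "side c \<equiv> c \<in> {Upper, Lower}"

section \<open>Planar matchings are the non-crossing ones\<close>

definition ends :: "(nat \<Rightarrow> vertex) \<Rightarrow> diagram \<Rightarrow> nat set" where
  "ends c \<alpha> = {x. \<exists>B\<in>\<alpha>. transversal B \<and> c x \<in> B}"

text \<open>An upper and a lower arc never interleave along the boundary, so three cases remain: two
  arcs of one side, an arc and a transversal, two transversals. A singleton counts as the arc with
  \<open>a = b\<close> and cannot violate the clauses.\<close>

definition noncrossing :: "diagram \<Rightarrow> bool" where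
  "noncrossing \<alpha> \<longleftrightarrow>
     (\<forall>c\<in>{Upper, Lower}.
        (\<forall>a b d e. {c a, c b} \<in> \<alpha> \<longrightarrow> {c d, c e} \<in> \<alpha> \<longrightarrow> a < d \<longrightarrow> d < b \<longrightarrow> \<not> b < e) \<and>
        (\<forall>a b x. {c a, c b} \<in> \<alpha> \<longrightarrow> x \<in> ends c \<alpha> \<longrightarrow> a < x \<longrightarrow> \<not> x < b)) \<and>
     (\<forall>x y x' y'. {Upper x, Lower y} \<in> \<alpha> \<longrightarrow> {Upper x', Lower y'} \<in> \<alpha> \<longrightarrow> x < x' \<longrightarrow> y < y')"

definition motzkin_diagram :: "nat \<Rightarrow> diagram \<Rightarrow> bool" where
  "motzkin_diagram n \<alpha> \<longleftrightarrow>
     partition_on (vertices n) \<alpha> \<and> (\<forall>B\<in>\<alpha>. card B = 1 \<or> card B = 2) \<and> noncrossing \<alpha>"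

text \<open>Writing a singleton as \<open>{Upper a, Upper a}\<close> avoids separate cases for
  blocks of size 1: they are arcs of width 0.\<close>

lemma block_cases [consumes 1, case_names upper lower transversal]:
  assumes "card B = 1 \<or> card B = 2"
  obtains (upper) a b where "a \<le> b" "B = {Upper a, Upper b}"
  | (lower) a b where "a \<le> b" "B = {Lower a, Lower b}"
  | (transversal) x y where "B = {Upper x, Lower y}"
proof -
  obtain v w where B: "B = {v, w}"
    using assms by (metis card_1_singletonE card_2_iff insert_absorb2)
  show ?thesis
  proof (cases v)
    case v: (Upper a)
    show ?thesis
    proof (cases w)
      case (Upper b)
      then show ?thesis using v B upper[of a b] upper[of b a] by (metis insert_commute nle_le)
    next
      case (Lower b)
      then show ?thesis using v B transversal by blast
    qed
  next
    case v: (Lower a)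
    show ?thesis
    proof (cases w)
      case (Upper b)
      then show ?thesis using v B transversal by (metis insert_commute)
    next
      case (Lower b)
      then show ?thesis using v B lower[of a b] lower[of b a] by (metis insert_commute nle_le)
    qed
  qed
qed

lemma transversal_simps [simp]:
  "transversal {Upper x, Lower y}"
  "\<not> transversal {Upper x, Upper y}"
  "\<not> transversal {Lower x, Lower y}"
  by (auto simp: transversal_def)

section \<open>Planar diagrams are non-crossing, by the Fashoda theorem\<close>

lemma path_connected_bracket:
  fixes a b s :: real
  assumes "convex S" "convex T" "s \<in> S" "s \<in> T" "a \<le> b"
  shows "path_connected ({a} \<times> S \<union> {a..b} \<times> {s} \<union> {b} \<times> T)"
proof -
  have "path_connected ({a} \<times> S)"
    by (intro convex_imp_path_connected convex_Times convex_singleton assms)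
  moreover have "path_connected ({a..b} \<times> {s})"
    by (intro convex_imp_path_connected convex_Times convex_singleton convex_closed_interval)
  moreover have "path_connected ({b} \<times> T)"
    by (intro convex_imp_path_connected convex_Times convex_singleton assms)
  moreover have "(a, s) \<in> ({a} \<times> S) \<inter> ({a..b} \<times> {s})"
    "(b, s) \<in> ({a} \<times> S \<union> {a..b} \<times> {s}) \<inter> ({b} \<times> T)"
    using assms by simp_all
  ultimately show ?thesis by (intro path_connected_Un) blast+
qed

text \<open>The tails extend the drawing around the right side of the rectangle, so that all vertices come to lie
  on one horizontal line, in the order of the boundary.\<close>

definition boundary_index :: "nat \<Rightarrow> vertex \<Rightarrow> nat" where
  "boundary_index n v = (case v of Upper i \<Rightarrow> i | Lower i \<Rightarrow> 2 * n + 1 - i)"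

primrec tail :: "nat \<Rightarrow> vertex \<Rightarrow> (real \<times> real) set" where
  "tail n (Upper i) = {(real i, 1)}"
| "tail n (Lower i) =
     {real i} \<times> {real i - real n - 1..0}
     \<union> {real i..2 * real n + 1 - real i} \<times> {real i - real n - 1}
     \<union> {2 * real n + 1 - real i} \<times> {real i - real n - 1..1}"

lemma path_connected_tail:
  assumes "v \<in> vertices n"
  shows "path_connected (tail n v)"
proof (cases v)
  case (Lower i)
  then have "1 \<le> i" "i \<le> n" using assms by (auto simp: vertices_def)
  then show ?thesis
    unfolding Lower tail.simps by (intro path_connected_bracket) auto
qed simp

lemma position_in_tail:
  assumes "v \<in> vertices n"
  shows "position v \<in> tail n v" and "(real (boundary_index n v), 1) \<in> tail n v"
proof -
  show "position v \<in> tail n v"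
    using assms by (cases v) (auto simp: vertices_def)
  show "(real (boundary_index n v), 1) \<in> tail n v"
  proof (cases v)
    case (Lower i)
    then have "1 \<le> i" "i \<le> n" using assms by (auto simp: vertices_def)
    then have "real (boundary_index n v) = 2 * real n + 1 - real i"
      using Lower by (simp add: boundary_index_def)
    then show ?thesis using Lower \<open>i \<le> n\<close> by simp
  qed (simp add: boundary_index_def)
qed

lemma tail_box:
  assumes "v \<in> vertices n"
  shows "tail n v \<subseteq> {1..2 * real n} \<times> {- real n..1}"
proof (cases v)
  case (Lower i)
  then have "1 \<le> i" "i \<le> n" using assms by (auto simp: vertices_def)
  then show ?thesis using Lower by auto
qed (use assms in \<open>auto simp: vertices_def\<close>)

text \<open>The tail of \<open>Lower i\<close> descends to height \<open>i - n - 1\<close> and comes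
  up at abscissa \<open>2n + 1 - i\<close>. A smaller \<open>i\<close> runs deeper and further out,
  so the tails are nested like brackets; their right legs stand beyond all upper vertices.\<close>

lemma tail_disjoint:
  assumes "v \<in> vertices n" "w \<in> vertices n" "v \<noteq> w"
  shows "tail n v \<inter> tail n w = {}"
  using assms by (cases v; cases w) (auto simp: vertices_def)

lemma tail_Int_rectangle:
  assumes "v \<in> vertices n" "p \<in> tail n v" "p \<in> {1..real n} \<times> {0..1}"
  shows "p = position v"
  using assms by (cases v) (auto simp: vertices_def)

lemma interleaved_paths_meet:
  fixes P Q :: "(real \<times> real) set"
  assumes "path_connected P" "path_connected Q"
    and "P \<subseteq> {x0..x1} \<times> {y0..y1}" "Q \<subseteq> {x0..x1} \<times> {y0..y1}"
    and "(a, y1) \<in> P" "(c, y1) \<in> P" "(b, y1) \<in> Q" "(d, y1) \<in> Q"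
    and "a < b" "b < c" "c < d"
  shows "P \<inter> Q \<noteq> {}"
proof -
  \<comment> \<open>\<open>fashoda_interlace\<close> is about curves in \<open>real ^ 2\<close>
    whose four ends lie on the bottom edge of a box. The map \<open>h\<close> changes the type and
    turns the top edge into the bottom edge.\<close>
  define h :: "real \<times> real \<Rightarrow> real ^ 2" where "h = (\<lambda>(x, y). vector [x, - y])"
  have h1: "h p $ 1 = fst p" and h2: "h p $ 2 = - snd p" for p
    by (simp_all add: h_def vector_2 split: prod.splits)
  have inj: "h p = h q \<Longrightarrow> p = q" for p q
    using h1 h2 by (metis neg_equal_iff_equal prod_eqI)
  have cont: "continuous_on A h" for A
  proof -
    have "continuous_on A (\<lambda>p. h p $ i)" for i :: 2
      using exhaust_2[of i] by (auto simp: h1 h2 intro: continuous_on_fst[OF continuous_on_id]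
          continuous_on_minus[OF continuous_on_snd[OF continuous_on_id]])
    then have "continuous_on A (\<lambda>p. \<chi> i. h p $ i)"
      by (rule continuous_on_vec_lambda)
    then show ?thesis by simp
  qed
  obtain f where f: "path f" "path_image f \<subseteq> P" "pathstart f = (a, y1)" "pathfinish f = (c, y1)"
    using assms unfolding path_connected_def by blast
  obtain g where g: "path g" "path_image g \<subseteq> Q" "pathstart g = (b, y1)" "pathfinish g = (d, y1)"
    using assms unfolding path_connected_def by blast
  have box: "h ` A \<subseteq> cbox (vector [x0, - y1]) (vector [x1, - y0])"
    if "A \<subseteq> {x0..x1} \<times> {y0..y1}" for A
    using that by (fastforce simp: mem_box_cart forall_2 h1 h2 vector_2)
  obtain z where "z \<in> path_image (h \<circ> f)" "z \<in> path_image (h \<circ> g)"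
  proof (rule fashoda_interlace[of "h \<circ> f" "h \<circ> g" "vector [x0, - y1]" "vector [x1, - y0]"])
    show "path (h \<circ> f)" "path (h \<circ> g)"
      using f(1) g(1) by (simp_all add: path_continuous_image cont)
    have "path_image f \<subseteq> {x0..x1} \<times> {y0..y1}" "path_image g \<subseteq> {x0..x1} \<times> {y0..y1}"
      using f(2) g(2) assms(3,4) by blast+
    then show "path_image (h \<circ> f) \<subseteq> cbox (vector [x0, - y1]) (vector [x1, - y0])"
      "path_image (h \<circ> g) \<subseteq> cbox (vector [x0, - y1]) (vector [x1, - y0])"
      by (simp_all add: path_image_compose box)
  qed (use f(3,4) g(3,4) assms(9-11) in \<open>simp_all add: pathstart_compose pathfinish_compose h1 h2\<close>)
  then show ?thesis
    using f(2) g(2) by (auto simp: path_image_compose dest!: inj)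
qed

text \<open>Each drawing is prolonged by the tails of two of its vertices. The prolonged sets lie in
  one rectangle and have interleaved ends on its top edge, so they meet. But tails of different
  vertices are disjoint, and a tail meets the original rectangle only in its own vertex, which
  belongs to the drawing of its own block.\<close>

lemma planar_not_interleaved:
  assumes part: "partition_on (vertices n) \<alpha>" and pl: "planar n \<alpha>"
    and AB: "A \<in> \<alpha>" "B \<in> \<alpha>" "{v1, v2} \<subseteq> A" "{w1, w2} \<subseteq> B"
    and idx: "boundary_index n v1 < boundary_index n w1" "boundary_index n w1 < boundary_index n v2"
      "boundary_index n v2 < boundary_index n w2"
    and "A \<noteq> B"
  shows False
proof -
  obtain C where C: "\<And>B. B \<in> \<alpha> \<Longrightarrow> path_connected (C B)" "\<And>B. B \<in> \<alpha> \<Longrightarrow> position ` B \<subseteq> C B"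
      "\<And>B. B \<in> \<alpha> \<Longrightarrow> C B \<subseteq> {1..real n} \<times> {0..1}" "disjoint_family_on C \<alpha>"
    using pl unfolding planar_def by metis
  have V: "A \<subseteq> vertices n" "B \<subseteq> vertices n" and disj: "A \<inter> B = {}"
    using part AB \<open>A \<noteq> B\<close> by (auto simp: partition_on_def disjoint_def)
  have CAB: "C A \<inter> C B = {}"
    using C(4) AB \<open>A \<noteq> B\<close> by (auto simp: disjoint_family_on_def)
  define P where "P = (C A \<union> tail n v1) \<union> tail n v2"
  define Q where "Q = (C B \<union> tail n w1) \<union> tail n w2"
  have pc: "path_connected ((C D \<union> tail n x) \<union> tail n y)"
    if "D \<in> \<alpha>" "{x, y} \<subseteq> D" "D \<subseteq> vertices n" for D x y
  proof -
    have "position x \<in> C D \<inter> tail n x" "position y \<in> C D \<inter> tail n y"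
      using that C(2)[of D] position_in_tail by auto
    then show ?thesis
      using that C(1) path_connected_tail
      by (intro path_connected_Un) auto
  qed
  have box: "(C D \<union> tail n x) \<union> tail n y \<subseteq> {1..2 * real n} \<times> {- real n..1}"
    if "D \<in> \<alpha>" "{x, y} \<subseteq> D" "D \<subseteq> vertices n" for D x y
  proof -
    have "{1..real n} \<times> {0..1::real} \<subseteq> {1..2 * real n} \<times> {- real n..1}" by auto
    then show ?thesis
      using that C(3)[of D] tail_box[of x n] tail_box[of y n] by blast
  qed
  have "P \<inter> Q \<noteq> {}"
  proof (rule interleaved_paths_meet)
    show "path_connected P" "path_connected Q"
      unfolding P_def Q_def using AB V by (intro pc; blast)+
    show "P \<subseteq> {1..2 * real n} \<times> {- real n..1}" "Q \<subseteq> {1..2 * real n} \<times> {- real n..1}"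
      unfolding P_def Q_def using AB V by (intro box; blast)+
    show "(real (boundary_index n v1), 1) \<in> P" "(real (boundary_index n v2), 1) \<in> P"
      "(real (boundary_index n w1), 1) \<in> Q" "(real (boundary_index n w2), 1) \<in> Q"
      unfolding P_def Q_def using AB V position_in_tail(2) by auto
  qed (use idx in auto)
  moreover have "C D \<inter> tail n x = {}" if "D \<in> \<alpha>" "E \<in> \<alpha>" "C D \<inter> C E = {}" "x \<in> E" "E \<subseteq> vertices n" for D E x
  proof -
    have "p = position x" if "p \<in> C D" "p \<in> tail n x" for p
      using that \<open>D \<in> \<alpha>\<close> \<open>x \<in> E\<close> \<open>E \<subseteq> vertices n\<close> C(3)[of D] tail_Int_rectangle[of x n p] by blast
    then show ?thesis using C(2)[of E] that by blast
  qed
  then have "C A \<inter> tail n w1 = {}" "C A \<inter> tail n w2 = {}" "C B \<inter> tail n v1 = {}" "C B \<inter> tail n v2 = {}"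
    using AB V CAB by (metis Int_commute insert_subset)+
  moreover have "tail n v \<inter> tail n w = {}" if "v \<in> {v1, v2}" "w \<in> {w1, w2}" for v w
    using that AB V disj by (intro tail_disjoint) auto
  ultimately show False
    using CAB unfolding P_def Q_def by blast
qed

lemma planar_imp_noncrossing:
  assumes part: "partition_on (vertices n) \<alpha>" and pl: "planar n \<alpha>"
    and sz: "\<forall>B\<in>\<alpha>. card B = 1 \<or> card B = 2"
  shows "noncrossing \<alpha>"
proof -
  have le: "i \<in> {1..n}" if "B \<in> \<alpha>" "Upper i \<in> B \<or> Lower i \<in> B" for i B
  proof -
    have "B \<subseteq> vertices n" using part that by (auto simp: partition_on_def)
    then show ?thesis using that by (auto simp: vertices_def)
  qed
  note cross = planar_not_interleaved[OF part pl]
  have upper_less: "boundary_index n (Upper i) < boundary_index n (Upper j)" if "i < j" for i j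
    using that by (simp add: boundary_index_def)
  have lower_less: "boundary_index n (Lower j) < boundary_index n (Lower i)"
    if "i < j" "B \<in> \<alpha>" "Lower j \<in> B" for i j B
    using that le[of B j] by (auto simp: boundary_index_def)
  have mixed_less: "boundary_index n (Upper i) < boundary_index n (Lower j)"
    if "A \<in> \<alpha>" "Upper i \<in> A" "B \<in> \<alpha>" "Lower j \<in> B" for i j A B
    using that le[of A i] le[of B j] by (auto simp: boundary_index_def)
  have 1: "\<not> (a < d \<and> d < b \<and> b < e)" if "{Upper a, Upper b} \<in> \<alpha>" "{Upper d, Upper e} \<in> \<alpha>" for a b d e
    using cross[OF that, of "Upper a" "Upper b" "Upper d" "Upper e"] upper_less
    by (auto simp: doubleton_eq_iff)
  \<comment> \<open>The boundary runs through the lower vertices from right to left, so the two arcs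
    exchange their roles.\<close>
  have 2: "\<not> (a < d \<and> d < b \<and> b < e)" if "{Lower a, Lower b} \<in> \<alpha>" "{Lower d, Lower e} \<in> \<alpha>" for a b d e
    using cross[OF that(2,1), of "Lower e" "Lower d" "Lower b" "Lower a"] that
      lower_less[OF _ that(1), of _ b] lower_less[OF _ that(2), of _ e] lower_less[OF _ that(2), of _ d]
    by (auto simp: doubleton_eq_iff)
  have 3: "\<not> (a < x \<and> x < b)" if "{Upper a, Upper b} \<in> \<alpha>" "{Upper x, Lower y} \<in> \<alpha>" for a b x y
    using cross[OF that, of "Upper a" "Upper b" "Upper x" "Lower y"] upper_less
      mixed_less[OF that(1) _ that(2), of b y]
    by (auto simp: doubleton_eq_iff)
  have 4: "\<not> (a < y \<and> y < b)" if "{Lower a, Lower b} \<in> \<alpha>" "{Upper x, Lower y} \<in> \<alpha>" for a b x y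
    using cross[OF that(2,1), of "Upper x" "Lower y" "Lower b" "Lower a"]
      mixed_less[OF that(2) _ that(1), of x b] lower_less[OF _ that(1), of _ b]
          lower_less[OF _ that(2), of _ y]
    by (auto simp: doubleton_eq_iff)
  have 5: "y < y'" if "{Upper x, Lower y} \<in> \<alpha>" "{Upper x', Lower y'} \<in> \<alpha>" "x < x'" for x y x' y'
  proof -
    have ne: "{Upper x, Lower y} \<noteq> {Upper x', Lower y'}" using that by (auto simp: doubleton_eq_iff)
    then have "{Upper x, Lower y} \<inter> {Upper x', Lower y'} = {}"
      using disjointD[OF partition_onD2[OF part] that(1,2)] by blast
    then have "y \<noteq> y'" by auto
    moreover have False if "y' < y"
    proof (rule cross)
      show "{Upper x, Lower y} \<in> \<alpha>" "{Upper x', Lower y'} \<in> \<alpha>" by fact+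
      show "{Upper x, Lower y} \<subseteq> {Upper x, Lower y}" "{Upper x', Lower y'} \<subseteq> {Upper x', Lower y'}" by blast+
      show "boundary_index n (Upper x) < boundary_index n (Upper x')"
        using upper_less \<open>x < x'\<close> .
      show "boundary_index n (Upper x') < boundary_index n (Lower y)"
        by (rule mixed_less[OF \<open>{Upper x', Lower y'} \<in> \<alpha>\<close> _ \<open>{Upper x, Lower y} \<in> \<alpha>\<close>]) auto
      show "boundary_index n (Lower y) < boundary_index n (Lower y')"
        by (rule lower_less[OF that \<open>{Upper x, Lower y} \<in> \<alpha>\<close>]) auto
    qed (fact ne)
    ultimately show ?thesis using linorder_neqE_nat by blast
  qed
  have tr: "\<exists>y. B = {Upper x, Lower y}" if "B \<in> \<alpha>" "transversal B" "Upper x \<in> B" for B x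
    using sz[rule_format, OF that(1)] that(2,3) by (cases rule: block_cases) auto
  have tr': "\<exists>x. B = {Upper x, Lower y}" if "B \<in> \<alpha>" "transversal B" "Lower y \<in> B" for B y
    using sz[rule_format, OF that(1)] that(2,3) by (cases rule: block_cases) auto
  have "\<not> (a < x \<and> x < b)" if "{Upper a, Upper b} \<in> \<alpha>" "x \<in> ends Upper \<alpha>" for a b x
    using 3[OF that(1)] that(2) tr unfolding ends_def by blast
  moreover have "\<not> (a < x \<and> x < b)" if "{Lower a, Lower b} \<in> \<alpha>" "x \<in> ends Lower \<alpha>" for a b x
    using 4[OF that(1)] that(2) tr' unfolding ends_def by blast
  ultimately show ?thesis
    unfolding noncrossing_def using 1 2 5 by simp
qed

text \<open>The depth of an arc is proportional to its width, so nested arcs do not meet.\<close>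

definition drawing :: "nat \<Rightarrow> vertex set \<Rightarrow> (real \<times> real) set" where
  "drawing n B =
     (\<Union>(a, b)\<in>{(a, b). a \<le> b \<and> B = {Upper a, Upper b}}.
        let h = 1 - (real b - real a) / (3 * real n) in
        {real a} \<times> {h..1} \<union> {real a..real b} \<times> {h} \<union> {real b} \<times> {h..1})
     \<union> (\<Union>(a, b)\<in>{(a, b). a \<le> b \<and> B = {Lower a, Lower b}}.
        let h = (real b - real a) / (3 * real n) in
        {real a} \<times> {0..h} \<union> {real a..real b} \<times> {h} \<union> {real b} \<times> {0..h})
     \<union> (\<Union>(x, y)\<in>{(x, y). B = {Upper x, Lower y}}.
        (\<lambda>t. let m = max 0 (min 1 (3 * t - 1)) in (real x * m + real y * (1 - m), t)) ` {0..1})"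

lemma drawing_upper:
  assumes "a \<le> b"
  shows "drawing n {Upper a, Upper b} =
        (let h = 1 - (real b - real a) / (3 * real n) in
        {real a} \<times> {h..1} \<union> {real a..real b} \<times> {h} \<union> {real b} \<times> {h..1})"
proof -
  have "{(a', b'). a' \<le> b' \<and> {Upper a, Upper b} = {Upper a', Upper b'}} = {(a, b)}"
    using assms by (auto simp: doubleton_eq_iff)
  then show ?thesis by (simp add: drawing_def doubleton_eq_iff)
qed

lemma drawing_lower:
  assumes "a \<le> b"
  shows "drawing n {Lower a, Lower b} =
        (let h = (real b - real a) / (3 * real n) in
        {real a} \<times> {0..h} \<union> {real a..real b} \<times> {h} \<union> {real b} \<times> {0..h})"
proof -
  have "{(a', b'). a' \<le> b' \<and> {Lower a, Lower b} = {Lower a', Lower b'}} = {(a, b)}"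
    using assms by (auto simp: doubleton_eq_iff)
  then show ?thesis by (simp add: drawing_def doubleton_eq_iff)
qed

text \<open>The weight \<open>m\<close> is 0 for \<open>t <= 1/3\<close> and 1 for
  \<open>t >= 2/3\<close>: a transversal is vertical in the outer thirds of the rectangle and moves
  sideways only in the middle third. Arcs stay in the outer thirds, since their width is less than
  \<open>n\<close> and is divided by \<open>3 * n\<close>. Hence they could meet a transversal only
  where it is vertical.\<close>

lemma drawing_transversal:
  "drawing n {Upper x, Lower y} =
    (\<lambda>t. let m = max 0 (min 1 (3 * t - 1)) in (real x * m + real y * (1 - m), t)) ` {0..1}"
proof -
  have "{(x', y'). {Upper x, Lower y} = {Upper x', Lower y'}} = {(x, y)}"
    by (auto simp: doubleton_eq_iff)
  then show ?thesis by (simp add: drawing_def doubleton_eq_iff)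
qed

lemma block_within:
  assumes "partition_on (vertices n) \<alpha>" "{c x, v} \<in> \<alpha>" "c = Upper \<or> c = Lower"
  shows "1 \<le> x" "x \<le> n"
proof -
  have "{c x, v} \<subseteq> vertices n" using assms by (auto simp: partition_on_def)
  then show "1 \<le> x" "x \<le> n" using assms by (auto simp: vertices_def)
qed

lemma noncrossing_imp_planar:
  assumes part: "partition_on (vertices n) \<alpha>"
    and sz: "\<forall>B\<in>\<alpha>. card B = 1 \<or> card B = 2"
    and nc: "noncrossing \<alpha>"
  shows "planar n \<alpha>"
proof -
  have dj: "A = B" if "A \<in> \<alpha>" "B \<in> \<alpha>" "v \<in> A" "v \<in> B" for A B v
    using part that by (auto simp: partition_on_def disjoint_def)
  note rng = block_within[OF part]
  have ends: "x \<in> ends Upper \<alpha>" "y \<in> ends Lower \<alpha>" if "{Upper x, Lower y} \<in> \<alpha>" for x y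
    using that unfolding ends_def by (auto intro!: bexI[of _ "{Upper x, Lower y}"])
  have arc_depth: "(real b - real a) / (3 * real n) < 1 / 3" if "1 \<le> a" "b \<le> n" for a b
  proof -
    have "real b - real a < real n" using that by linarith
    then show ?thesis by (cases "n = 0") (simp_all add: divide_less_eq)
  qed
  have C: "path_connected (drawing n B)" "position ` B \<subseteq> drawing n B"
      "drawing n B \<subseteq> {1..real n} \<times> {0..1}" if "B \<in> \<alpha>" for B
  proof -
    have "path_connected (drawing n B) \<and> position ` B \<subseteq> drawing n B
      \<and> drawing n B \<subseteq> {1..real n} \<times> {0..1}"
      using sz[rule_format, OF that]
    proof (cases rule: block_cases)
      case (upper a b)
      then have r: "1 \<le> a" "b \<le> n"
          using rng[of Upper a "Upper b"] rng[of Upper b "Upper a"] that by (auto simp: insert_commute)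
      define h where "h = 1 - (real b - real a) / (3 * real n)"
      have h: "0 \<le> h" "h \<le> 1" using r arc_depth[of a b] upper by (auto simp: h_def)
      have D: "drawing n B = {real a} \<times> {h..1} \<union> {real a..real b} \<times> {h} \<union> {real b} \<times> {h..1}"
        using upper by (simp add: drawing_upper Let_def h_def)
      show ?thesis unfolding D
        using h r upper by (auto intro!: path_connected_bracket)
    next
      case (lower a b)
      then have r: "1 \<le> a" "b \<le> n"
          using rng[of Lower a "Lower b"] rng[of Lower b "Lower a"] that by (auto simp: insert_commute)
      define h where "h = (real b - real a) / (3 * real n)"
      have h: "0 \<le> h" "h \<le> 1" using r arc_depth[of a b] lower by (auto simp: h_def)
      have D: "drawing n B = {real a} \<times> {0..h} \<union> {real a..real b} \<times> {h} \<union> {real b} \<times> {0..h}"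
        using lower by (simp add: drawing_lower Let_def h_def)
      show ?thesis unfolding D
        using h r lower by (auto intro!: path_connected_bracket)
    next
      case (transversal x y)
      then have r: "1 \<le> x" "x \<le> n" "1 \<le> y" "y \<le> n"
        using rng[of Upper x "Lower y"] rng[of Lower y "Upper x"] that by (auto simp: insert_commute)
      define m where "m = (\<lambda>t::real. max 0 (min 1 (3 * t - 1)))"
      have m: "0 \<le> m t" "m t \<le> 1" for t by (auto simp: m_def)
      have D: "drawing n B = (\<lambda>t. (real x * m t + real y * (1 - m t), t)) ` {0..1}"
        using transversal by (simp add: drawing_transversal Let_def m_def)
      have "path_connected (drawing n B)"
        unfolding D m_def
        by (intro path_connected_continuous_image convex_imp_path_connected continuous_intros
            convex_closed_interval)
      moreover have "position ` B \<subseteq> drawing n B"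
        unfolding D using transversal by (auto simp: m_def image_iff intro: bexI[of _ 0] bexI[of _ 1])
      moreover have "1 \<le> real x * m t + real y * (1 - m t) \<and> real x * m t + real y * (1 - m t) \<le> n" for t
        using convex_bound_le[of "real x" "n" "real y" "m t" "1 - m t"]
          convex_bound_le[of "- real x" "-1" "- real y" "m t" "1 - m t"] r m[of t]
        by (auto simp: mult.commute)
      then have "drawing n B \<subseteq> {1..real n} \<times> {0..1}"
        unfolding D by auto
      ultimately show ?thesis by blast
    qed
    then show "path_connected (drawing n B)" "position ` B \<subseteq> drawing n B"
      "drawing n B \<subseteq> {1..real n} \<times> {0..1}" by auto
  qed
  have uu: "drawing n {Upper a, Upper b} \<inter> drawing n {Upper c, Upper d} = {}"
    if "{Upper a, Upper b} \<in> \<alpha>" "{Upper c, Upper d} \<in> \<alpha>" "a \<le> b" "c \<le> d" "a < c" for a b c d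
  proof -
    have n0: "n > 0" using rng that by force
    have "{Upper a, Upper b} \<noteq> {Upper c, Upper d}" using that by (auto simp: doubleton_eq_iff)
    then have "b \<noteq> c" "b \<noteq> d" using dj[OF that(1,2)] by auto
    moreover have "\<not> (c < b \<and> b < d)" using nc that unfolding noncrossing_def by blast
    ultimately consider "b < c" | "d < b" by linarith
    then show ?thesis
    proof cases
      case 1
      then show ?thesis using that by (auto simp: drawing_upper Let_def)
    next
      case 2
      then have "(real b - real a) / (3 * real n) > (real d - real c) / (3 * real n)"
        using that n0 by (intro divide_strict_right_mono) auto
      then show ?thesis using 2 that by (auto simp: drawing_upper Let_def)
    qed
  qed
  have ll: "drawing n {Lower a, Lower b} \<inter> drawing n {Lower c, Lower d} = {}"
    if "{Lower a, Lower b} \<in> \<alpha>" "{Lower c, Lower d} \<in> \<alpha>" "a \<le> b" "c \<le> d" "a < c" for a b c d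
  proof -
    have n0: "n > 0" using rng that by force
    have "{Lower a, Lower b} \<noteq> {Lower c, Lower d}" using that by (auto simp: doubleton_eq_iff)
    then have "b \<noteq> c" "b \<noteq> d" using dj[OF that(1,2)] by auto
    moreover have "\<not> (c < b \<and> b < d)" using nc that unfolding noncrossing_def by blast
    ultimately consider "b < c" | "d < b" by linarith
    then show ?thesis
    proof cases
      case 1
      then show ?thesis using that by (auto simp: drawing_lower Let_def)
    next
      case 2
      then have "(real b - real a) / (3 * real n) > (real d - real c) / (3 * real n)"
        using that n0 by (intro divide_strict_right_mono) auto
      then show ?thesis using 2 that by (auto simp: drawing_lower Let_def)
    qed
  qed
  have snd_u: "snd p > 2 / 3" if "{Upper a, Upper b} \<in> \<alpha>" "a \<le> b" "p \<in> drawing n {Upper a, Upper b}"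
      for a b p
  proof -
    define h where "h = (real b - real a) / (3 * real n)"
    have "1 \<le> a" "b \<le> n"
      using rng[of Upper a "Upper b"] rng[of Upper b "Upper a"] that by (auto simp: insert_commute)
    then have "h < 1 / 3" unfolding h_def by (rule arc_depth)
    moreover have "drawing n {Upper a, Upper b} = {real a} \<times> {1 - h..1} \<union> {real a..real b} \<times> {1 - h}
        \<union> {real b} \<times> {1 - h..1}"
      using that by (simp add: drawing_upper Let_def h_def)
    ultimately show ?thesis using that(3) by auto
  qed
  have snd_l: "snd p < 1 / 3" if "{Lower a, Lower b} \<in> \<alpha>" "a \<le> b" "p \<in> drawing n {Lower a, Lower b}"
      for a b p
  proof -
    define h where "h = (real b - real a) / (3 * real n)"
    have "1 \<le> a" "b \<le> n"
      using rng[of Lower a "Lower b"] rng[of Lower b "Lower a"] that by (auto simp: insert_commute)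
    then have "h < 1 / 3" unfolding h_def by (rule arc_depth)
    moreover have "drawing n {Lower a, Lower b} = {real a} \<times> {0..h} \<union> {real a..real b} \<times> {h}
        \<union> {real b} \<times> {0..h}"
      using that by (simp add: drawing_lower Let_def h_def)
    ultimately show ?thesis using that(3) by auto
  qed
  have ul: "drawing n {Upper a, Upper b} \<inter> drawing n {Lower c, Lower d} = {}"
    if "{Upper a, Upper b} \<in> \<alpha>" "{Lower c, Lower d} \<in> \<alpha>" "a \<le> b" "c \<le> d" for a b c d
    using snd_u[OF that(1,3)] snd_l[OF that(2,4)] by fastforce
  have ut: "drawing n {Upper a, Upper b} \<inter> drawing n {Upper x, Lower y} = {}"
    if "{Upper a, Upper b} \<in> \<alpha>" "{Upper x, Lower y} \<in> \<alpha>" "a \<le> b" for a b x y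
  proof -
    have "{Upper a, Upper b} \<noteq> {Upper x, Lower y}" by (auto simp: doubleton_eq_iff)
    then have "x \<noteq> a" "x \<noteq> b" using dj[OF that(1,2)] by auto
    moreover have "\<not> (a < x \<and> x < b)" using nc ends that unfolding noncrossing_def by blast
    ultimately have x: "x < a \<or> b < x" by linarith
    have False if p: "p \<in> drawing n {Upper a, Upper b}" "p \<in> drawing n {Upper x, Lower y}" for p
    proof -
      have "snd p > 2 / 3" using snd_u p that \<open>a \<le> b\<close> \<open>{Upper a, Upper b} \<in> \<alpha>\<close> by blast
      then have "fst p = real x" using p(2) by (auto simp: drawing_transversal Let_def)
      moreover have "real a \<le> fst p \<and> fst p \<le> real b"
        using p(1) \<open>a \<le> b\<close> by (auto simp: drawing_upper Let_def)
      ultimately show False using x by auto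
    qed
    then show ?thesis by blast
  qed
  have lt: "drawing n {Lower a, Lower b} \<inter> drawing n {Upper x, Lower y} = {}"
    if "{Lower a, Lower b} \<in> \<alpha>" "{Upper x, Lower y} \<in> \<alpha>" "a \<le> b" for a b x y
  proof -
    have "{Lower a, Lower b} \<noteq> {Upper x, Lower y}" by (auto simp: doubleton_eq_iff)
    then have "y \<noteq> a" "y \<noteq> b" using dj[OF that(1,2)] by auto
    moreover have "\<not> (a < y \<and> y < b)" using nc ends that unfolding noncrossing_def by blast
    ultimately have x: "y < a \<or> b < y" by linarith
    have False if p: "p \<in> drawing n {Lower a, Lower b}" "p \<in> drawing n {Upper x, Lower y}" for p
    proof -
      have "snd p < 1 / 3" using snd_l p that \<open>a \<le> b\<close> \<open>{Lower a, Lower b} \<in> \<alpha>\<close> by blast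
      then have "fst p = real y" using p(2) by (auto simp: drawing_transversal Let_def)
      moreover have "real a \<le> fst p \<and> fst p \<le> real b"
        using p(1) \<open>a \<le> b\<close> by (auto simp: drawing_lower Let_def)
      ultimately show False using x by auto
    qed
    then show ?thesis by blast
  qed
  have tt: "drawing n {Upper x, Lower y} \<inter> drawing n {Upper x', Lower y'} = {}"
    if "{Upper x, Lower y} \<in> \<alpha>" "{Upper x', Lower y'} \<in> \<alpha>" "x < x'" for x y x' y'
  proof -
    have y: "y < y'" using nc that unfolding noncrossing_def by blast
    \<comment> \<open>At a given height all transversals use the same weight \<open>m\<close>, so
      the order that they have on both sides of the rectangle is kept in between.\<close>
    have mono: "real x * m + real y * (1 - m) < real x' * m + real y' * (1 - m)" if "0 \<le> m" "m \<le> 1" for m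
    proof (cases "m = 0")
      case False
      then have "real x * m < real x' * m" using that \<open>x < x'\<close> by simp
      moreover have "real y * (1 - m) \<le> real y' * (1 - m)" using that y by (intro mult_right_mono) auto
      ultimately show ?thesis by simp
    qed (use y in simp)
    have "real x * max 0 (min 1 (3 * t - 1)) + real y * (1 - max 0 (min 1 (3 * t - 1)))
      \<noteq> real x' * max 0 (min 1 (3 * t - 1)) + real y' * (1 - max 0 (min 1 (3 * t - 1)))" for t
      using mono[of "max 0 (min 1 (3 * t - 1))"] by simp
    then show ?thesis by (auto simp: drawing_transversal Let_def)
  qed
  have "drawing n A \<inter> drawing n B = {}" if "A \<in> \<alpha>" "B \<in> \<alpha>" "A \<noteq> B" for A B
  proof -
    have A: "card A = 1 \<or> card A = 2" and B: "card B = 1 \<or> card B = 2"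
      using sz that by auto
    from A show ?thesis
    proof (cases rule: block_cases)
      case A: (upper a b)
      from B show ?thesis
      proof (cases rule: block_cases)
        case (upper c d)
        then have "a \<noteq> c" using dj that A by blast
        then show ?thesis using uu[of a b c d] uu[of c d a b]
            that A upper by (metis Int_commute linorder_neq_iff)
      next
        case (lower c d)
        then show ?thesis using ul that A by blast
      next
        case (transversal c d)
        then show ?thesis using ut that A by blast
      qed
    next
      case A: (lower a b)
      from B show ?thesis
      proof (cases rule: block_cases)
        case (upper c d)
        then show ?thesis using ul that A by blast
      next
        case (lower c d)
        then have "a \<noteq> c" using dj that A by blast
        then show ?thesis using ll[of a b c d] ll[of c d a b]
            that A lower by (metis Int_commute linorder_neq_iff)
      next
        case (transversal c d)
        then show ?thesis using lt that A by blast
      qed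
    next
      case A: (transversal x y)
      from B show ?thesis
      proof (cases rule: block_cases)
        case (upper c d)
        then show ?thesis using ut that A by blast
      next
        case (lower c d)
        then show ?thesis using lt that A by blast
      next
        case (transversal c d)
        then have "x \<noteq> c" using dj that A by blast
        then show ?thesis using tt[of x y c d] tt[of c d x y]
            that A transversal by (metis Int_commute linorder_neq_iff)
      qed
    qed
  qed
  then show ?thesis
    unfolding planar_def using C by (intro exI[of _ "drawing n"]) (auto simp: disjoint_family_on_def)
qed

lemma planar_iff_noncrossing:
  assumes "partition_on (vertices n) \<alpha>" "\<forall>B\<in>\<alpha>. card B = 1 \<or> card B = 2"
  shows "planar n \<alpha> \<longleftrightarrow> noncrossing \<alpha>"
  using planar_imp_noncrossing[OF assms(1) _ assms(2)] noncrossing_imp_planar[OF assms] by (rule iffI)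

lemma motzkin_monoid_eq: "motzkin_monoid n = {\<alpha>. motzkin_diagram n \<alpha>}"
  by (auto simp: motzkin_monoid_def motzkin_diagram_def partition_monoid_def planar_iff_noncrossing
      simp del: One_nat_def)

lemma jones_monoid_eq: "jones_monoid n = {\<alpha>. motzkin_diagram n \<alpha> \<and> (\<forall>B\<in>\<alpha>. card B = 2)}"
  by (auto simp: jones_monoid_def motzkin_diagram_def partition_monoid_def planar_iff_noncrossing)

section \<open>Walks of two involutions\<close>

definition mate_closed :: "(nat \<Rightarrow> nat) \<Rightarrow> (nat \<Rightarrow> nat) \<Rightarrow> nat set \<Rightarrow> bool" where
  "mate_closed u l A \<longleftrightarrow> (\<forall>x\<in>A. u x \<in> A \<and> l x \<in> A)"

text \<open>The walk begins with \<open>l\<close> because in \<open>orbit_of_fixed_point\<close> its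
  first vertex is fixed by \<open>u\<close>.\<close>

primrec walk :: "(nat \<Rightarrow> nat) \<Rightarrow> (nat \<Rightarrow> nat) \<Rightarrow> nat \<Rightarrow> nat \<Rightarrow> nat" where
  "walk u l a 0 = a"
| "walk u l a (Suc k) = (if even k then l else u) (walk u l a k)"

declare walk.simps(2) [simp del]

lemma walk_back:
  assumes "\<And>x. u (u x) = x" "\<And>x. l (l x) = x"
  shows "(if even k then l else u) (walk u l a (Suc k)) = walk u l a k"
  using assms by (simp add: walk.simps)

lemma walk_in:
  assumes "mate_closed u l A" "a \<in> A"
  shows "walk u l a k \<in> A"
  using assms by (induction k) (auto simp: mate_closed_def walk.simps)

text \<open>A repetition at odd distance is a palindrome, whose centre is a fixed point.\<close>

lemma walk_odd_return:
  assumes inv: "\<And>x. u (u x) = x" "\<And>x. l (l x) = x"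
    and "walk u l a i = walk u l a (i + d)" "odd d"
  shows "\<exists>k. i \<le> k \<and> k < i + d \<and> walk u l a (Suc k) = walk u l a k"
  using assms(3,4)
proof (induction d arbitrary: i rule: less_induct)
  case (less d)
  show ?case
  proof (cases "d = 1")
    case True
    then show ?thesis using less.prems by (intro exI[of _ i]) simp
  next
    case False
    then obtain e where d: "d = Suc (Suc e)" "odd e"
      using \<open>odd d\<close> that[of "d - 2"] by (cases d; cases "d - 1") auto
    \<comment> \<open>At odd distance the step out of position \<open>i\<close> and the step into
      position \<open>i + d\<close> apply the same involution, so the repetition moves inward by one
      on both sides and the distance drops by 2.\<close>
    have "walk u l a (Suc i) = (if even i then l else u) (walk u l a (Suc (Suc i + e)))"
      using less.prems d by (simp add: walk.simps(2)[of u l a i])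
    also have "\<dots> = walk u l a (Suc i + e)"
      using walk_back[of u l "Suc i + e" a, OF inv] d(2) by (cases "even i") auto
    finally obtain k where "Suc i \<le> k" "k < Suc i + e" "walk u l a (Suc k) = walk u l a k"
      using less.IH[of e "Suc i"] d by auto
    then show ?thesis using d by (intro exI[of _ k]) auto
  qed
qed

text \<open>At even distance the steps into positions \<open>i\<close> and \<open>i + d\<close>
  apply the same involution, so the repetition can be moved back until it starts at position
  0.\<close>

lemma walk_even_return:
  assumes inv: "\<And>x. u (u x) = x" "\<And>x. l (l x) = x"
    and "walk u l a i = walk u l a (i + d)" "even d"
  shows "walk u l a d = a"
  using assms(3)
proof (induction i)
  case (Suc i)
  have "walk u l a i = (if even i then l else u) (walk u l a (Suc i))"
    using walk_back[OF inv, of i a] by simp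
  also have "\<dots> = (if even (i + d) then l else u) (walk u l a (Suc (i + d)))"
    using Suc.prems \<open>even d\<close> by simp
  also have "\<dots> = walk u l a (i + d)"
    using walk_back[OF inv, of "i + d" a] .
  finally show ?case using Suc.IH by blast
qed simp

lemma walk_repeats:
  assumes "finite A" "mate_closed u l A" "a \<in> A"
  obtains i d where "d > 0" "walk u l a i = walk u l a (i + d)"
proof -
  have "\<not> inj (walk u l a)"
    using assms walk_in[OF assms(2,3)]
        by (meson finite_subset image_subsetI finite_imageD infinite_UNIV_nat)
  then obtain i j where "i < j" "walk u l a i = walk u l a j"
    by (metis injI linorder_neqE_nat)
  then show ?thesis using that[of "j - i" i] by auto
qed

text \<open>The points that \<open>u\<close> moves fall into pairs \<open>{x, u x}\<close>. This
  count takes the place of geometric arguments about paths: it shows that they do not cross, and it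
  locates the ends of the cut edges.\<close>

lemma involution_parity:
  fixes u :: "'a \<Rightarrow> 'a"
  assumes "finite A" "\<And>x. x \<in> A \<Longrightarrow> u x \<in> A" "\<And>x. x \<in> A \<Longrightarrow> u (u x) = x"
  shows "even (card A) \<longleftrightarrow> even (card {x \<in> A. u x = x})"
  using assms
proof (induction "card A" arbitrary: A rule: less_induct)
  case less
  show ?case
  proof (cases "\<exists>x\<in>A. u x \<noteq> x")
    case False
    then have "{x \<in> A. u x = x} = A" by auto
    then show ?thesis by simp
  next
    case True
    then obtain x where x: "x \<in> A" "u x \<noteq> x" by blast
    let ?B = "A - {x, u x}"
    have sub: "{x, u x} \<subseteq> A" using x less.prems by auto
    have "card {x, u x} = 2" using x by (metis card_2_iff)
    then have card: "card A = card ?B + 2"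
      using sub less.prems(1) by (metis card_Diff_subset card_mono finite_subset le_add_diff_inverse2)
    have "u y \<in> ?B" if "y \<in> ?B" for y
      using that x less.prems by (metis DiffD1 DiffD2 DiffI insert_iff singletonD)
    then have "even (card ?B) \<longleftrightarrow> even (card {x \<in> ?B. u x = x})"
      using less.prems card by (intro less.hyps) auto
    moreover have "{y \<in> ?B. u y = y} = {y \<in> A. u y = y}"
      using x less.prems(3)[OF x(1)] by auto
    ultimately show ?thesis using card by simp
  qed
qed

text \<open>The orbit is a path from \<open>a\<close> to \<open>z\<close>.\<close>

lemma orbit_of_fixed_point:
  assumes inv: "\<And>x. u (u x) = x" "\<And>x. l (l x) = x"
    and A: "finite A" "mate_closed u l A" "a \<in> A" and fix_a: "u a = a"
  obtains P z where "P \<subseteq> A" "a \<in> P" "mate_closed u l P"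
    "\<And>B. a \<in> B \<Longrightarrow> mate_closed u l B \<Longrightarrow> P \<subseteq> B"
    "z \<in> P"
    "{x \<in> P. u x = x} = {a} \<and> {x \<in> P. l x = x} = {z}
     \<or> {x \<in> P. u x = x} = {a, z} \<and> z \<noteq> a \<and> {x \<in> P. l x = x} = {}"
proof -
  define w where "w = walk u l a"
  have w0: "w 0 = a" by (simp add: w_def)
  have step: "w (Suc k) = (if even k then l (w k) else u (w k))" for k
    by (simp add: w_def walk.simps)
  have "\<exists>k. w (Suc k) = w k"
  proof -
    obtain i d where d: "d > 0" "w i = w (i + d)"
      using walk_repeats[OF A] unfolding w_def by blast
    show ?thesis
    proof (cases "even d")
      case False
      then show ?thesis using walk_odd_return[OF inv, of a i d] d unfolding w_def by blast
    next
      case True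
      then have "w d = a" using walk_even_return[OF inv, of a i d] d by (simp add: w_def)
      \<comment> \<open>As \<open>d\<close> is even, the last step of the return applied
        \<open>u\<close>; since \<open>a\<close> is fixed by \<open>u\<close>, that step stood
        still.\<close>
      moreover obtain e where "d = Suc e" "odd e" using True d by (cases d) auto
      ultimately have "u (w e) = a" using step[of e] by simp
      then have "w e = a" using inv(1) fix_a by metis
      then show ?thesis using \<open>w d = a\<close> \<open>d = Suc e\<close> by auto
    qed
  qed
  \<comment> \<open>The first step that stands still marks the far end of the path. The parity of
    \<open>K\<close> tells which of the two involutions fixes the last vertex: \<open>l\<close> if
    \<open>K\<close> is even, \<open>u\<close> if it is odd.\<close>
  define K where "K = (LEAST k. w (Suc k) = w k)"
  have K: "w (Suc K) = w K" unfolding K_def by (rule LeastI_ex) fact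
  have K_least: "w (Suc k) \<noteq> w k" if "k < K" for k
    using that not_less_Least unfolding K_def by blast
  have even_u: "u (w k) = (if k = 0 then w 0 else w (k - 1))" if "even k" for k
    using that step[of "k - 1"] inv w0 fix_a by (cases k) auto
  have even_l: "l (w k) = w (Suc k)" if "even k" for k
    using that step by simp
  have odd_u: "u (w k) = w (Suc k)" if "odd k" for k
    using that step by simp
  have odd_l: "l (w k) = w (k - 1)" if "odd k" for k
    using that step[of "k - 1"] inv by (cases k) auto
  define P where "P = w ` {..K}"
  have inP: "w k \<in> P" if "k \<le> Suc K" for k
    using that K unfolding P_def by (cases "k = Suc K") auto
  have closed: "mate_closed u l P"
    unfolding mate_closed_def
  proof
    fix x assume "x \<in> P"
    then obtain k where k: "k \<le> K" "x = w k" by (auto simp: P_def)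
    show "u x \<in> P \<and> l x \<in> P"
      using k even_u[of k] even_l[of k] odd_u[of k] odd_l[of k] inP[of "Suc k"] inP[of "k - 1"] inP[of 0]
      by (cases "even k") auto
  qed
  have prev_ne: "w (k - 1) \<noteq> w k" if "0 < k" "k \<le> K" for k
    using K_least[of "k - 1"] that by (cases k) auto
  have fix_u: "u (w k) = w k \<longleftrightarrow> k = 0 \<or> k = K \<and> odd K" if "k \<le> K" for k
    using that even_u[of k] odd_u[of k] K prev_ne[of k] K_least[of k]
    by (cases "even k"; cases "k = 0"; cases "k = K") auto
  have fix_l: "l (w k) = w k \<longleftrightarrow> k = K \<and> even K" if "k \<le> K" for k
    using that even_l[of k] odd_l[of k] K prev_ne[of k] K_least[of k]
    by (cases "even k"; cases "k = 0"; cases "k = K") auto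
  have U: "{x \<in> P. u x = x} = (if even K then {a} else {a, w K})"
    using fix_u w0 unfolding P_def by auto
  have L: "{x \<in> P. l x = x} = (if even K then {w K} else {})"
    using fix_l unfolding P_def by auto
  have fin: "finite P" by (simp add: P_def)
  \<comment> \<open>Otherwise \<open>P\<close> would contain one fixed point of \<open>u\<close> and
    none of \<open>l\<close>, although both numbers have the parity of
    \<open>card P\<close>.\<close>
  have "w K \<noteq> a" if "odd K"
  proof
    assume "w K = a"
    then have "card {x \<in> P. u x = x} = 1" "card {x \<in> P. l x = x} = 0"
      unfolding U L using that by simp_all
    moreover have "even (card P) \<longleftrightarrow> even (card {x \<in> P. u x = x})"
      "even (card P) \<longleftrightarrow> even (card {x \<in> P. l x = x})"
      using fin closed inv unfolding mate_closed_def by (intro involution_parity; simp)+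
    ultimately show False by simp
  qed
  show ?thesis
  proof (rule that[of P "w K"])
    show "P \<subseteq> A" using walk_in[OF A(2,3)] by (auto simp: P_def w_def)
    show "a \<in> P" "w K \<in> P" using inP[of 0] inP[of K] w0 by auto
    show "P \<subseteq> B" if "a \<in> B" "mate_closed u l B" for B
      using walk_in[OF that(2,1)] by (auto simp: P_def w_def)
  qed (use closed U L \<open>odd K \<Longrightarrow> w K \<noteq> a\<close> in auto)
qed

text \<open>Without fixed points the walk never stands still, so every repetition has even distance
  and yields a return to \<open>a\<close>. As the first return time \<open>m\<close> is even, the
  step that closes the cycle applies \<open>u\<close> while the first step applies \<open>l\<close>;
  so both neighbours of \<open>a\<close> lie on the cycle, and the orbit is closed.\<close>

lemma walk_cycle:
  assumes inv: "\<And>x. u (u x) = x" "\<And>x. l (l x) = x"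
    and A: "finite A" "mate_closed u l A" "a \<in> A"
    and free: "\<And>x. x \<in> A \<Longrightarrow> u x \<noteq> x" "\<And>x. x \<in> A \<Longrightarrow> l x \<noteq> x"
  obtains m where "m \<ge> 2" "even m" "walk u l a m = a" "inj_on (walk u l a) {..<m}"
    "mate_closed u l (walk u l a ` {..<m})"
proof -
  define w where "w = walk u l a"
  have w0: "w 0 = a" by (simp add: w_def)
  have step: "w (Suc k) = (if even k then l (w k) else u (w k))" for k
    by (simp add: w_def walk.simps)
  have wA: "w k \<in> A" for k using walk_in[OF A(2,3)] by (simp add: w_def)
  have nofix: "w (Suc k) \<noteq> w k" for k using step[of k] free wA by auto
  have ret: "even d \<and> w d = a" if "w i = w (i + d)" for i d
    using that nofix walk_odd_return[OF inv, of a i d] walk_even_return[OF inv, of a i d]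
    by (auto simp: w_def)
  define m where "m = (LEAST d. d > 0 \<and> w d = a)"
  have "\<exists>d. d > 0 \<and> w d = a"
    using walk_repeats[OF A] ret unfolding w_def by metis
  then have "m > 0 \<and> w m = a" unfolding m_def by (rule LeastI_ex)
  then have m: "m > 0" "w m = a" by auto
  have m_least: "\<not> (d > 0 \<and> w d = a)" if "d < m" for d
    using that not_less_Least unfolding m_def by blast
  have em: "even m" using ret[of 0 m] m w0 by simp
  have "inj_on w {..<m}"
  proof (rule linorder_inj_onI)
    fix i j assume "i < j" "i \<in> {..<m}" "j \<in> {..<m}"
    then show "w i \<noteq> w j" using ret[of i "j - i"] m_least[of "j - i"] by auto
  qed auto
  moreover have "mate_closed u l (w ` {..<m})"
    unfolding mate_closed_def
  proof
    fix x assume "x \<in> w ` {..<m}"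
    then obtain k where k: "k < m" "x = w k" by auto
    have next_in: "w (Suc k) \<in> w ` {..<m}"
      using k m w0 by (cases "Suc k = m") (auto intro: image_eqI[of _ _ 0])
    define p where "p = (if k = 0 then m - 1 else k - 1)"
    have p: "p < m" "even p \<longleftrightarrow> odd k" "w (Suc p) = w k"
      using k m w0 em unfolding p_def by (auto simp: even_Suc)
    then have prev: "(if even p then l else u) x = w p"
      using step[of p] inv(1)[of "w p"] inv(2)[of "w p"] k by (cases "even p") auto
    show "u x \<in> w ` {..<m} \<and> l x \<in> w ` {..<m}"
      using next_in prev p step[of k] k by (cases "even k") auto
  qed
  moreover have "m \<ge> 2" using m(1) em by presburger
  ultimately show ?thesis using that[of m] m em unfolding w_def by blast
qed

section \<open>The interface graph and idempotents\<close>

text \<open>A vertex without an arc on side \<open>c\<close>, whether a singleton block or an end of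
  a transversal, is its own mate. This makes \<open>mate c\<close> a total involution, and its fixed
  points are where paths of the interface graph end.\<close>

definition mate :: "(nat \<Rightarrow> vertex) \<Rightarrow> diagram \<Rightarrow> nat \<Rightarrow> nat" where
  "mate c \<alpha> x = (if \<exists>y. {c x, c y} \<in> \<alpha> then THE y. {c x, c y} \<in> \<alpha> else x)"

definition conn :: "diagram \<Rightarrow> (nat \<times> nat) set" where
  "conn \<alpha> = (\<Union>e\<in>interface_edges \<alpha>. endpoints e \<times> endpoints e)\<^sup>*"

abbreviation ends_connected :: "diagram \<Rightarrow> bool" where
  "ends_connected \<alpha> \<equiv> \<forall>x y. {Upper x, Lower y} \<in> \<alpha> \<longrightarrow> (x, y) \<in> conn \<alpha>"

abbreviation closed_under_mates :: "diagram \<Rightarrow> nat set \<Rightarrow> bool" where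
  "closed_under_mates \<alpha> \<equiv> mate_closed (mate Upper \<alpha>) (mate Lower \<alpha>)"

abbreviation free_ends :: "(nat \<Rightarrow> vertex) \<Rightarrow> diagram \<Rightarrow> nat \<Rightarrow> nat set" where
  "free_ends c \<alpha> s \<equiv> {z \<in> conn \<alpha> `` {s}. mate c \<alpha> z = z}"

lemma endpoints_simps [simp]:
  "endpoints {Upper a, Upper b} = {a, b}"
  "endpoints {Lower a, Lower b} = {a, b}"
  by (auto simp: endpoints_def)

lemma side_eq_iff:
  assumes "side c"
  shows "c x = c y \<longleftrightarrow> x = y"
  using assms by auto

lemma disjoint_block_eq:
  assumes "disjoint \<alpha>" "A \<in> \<alpha>" "B \<in> \<alpha>" "v \<in> A" "v \<in> B"
  shows "A = B"
  using assms by (auto simp: disjoint_def)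

lemma mate_eq:
  assumes "disjoint \<alpha>" "side c" "{c x, c y} \<in> \<alpha>"
  shows "mate c \<alpha> x = y"
proof -
  have "z = y" if "{c x, c z} \<in> \<alpha>" for z
    using disjoint_block_eq[OF assms(1) that assms(3), of "c x"] side_eq_iff[OF assms(2)]
    by (auto simp: doubleton_eq_iff)
  then have "(THE z. {c x, c z} \<in> \<alpha>) = y" using assms(3) by (intro the_equality)
  moreover have "\<exists>z. {c x, c z} \<in> \<alpha>" using assms(3) by (rule exI)
  ultimately show ?thesis by (simp only: mate_def if_True)
qed

lemma mate_block:
  assumes "disjoint \<alpha>" "side c" "mate c \<alpha> x \<noteq> x"
  shows "{c x, c (mate c \<alpha> x)} \<in> \<alpha>"
  using assms mate_eq[OF assms(1,2)] by (metis mate_def)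

lemma mate_mate:
  assumes "disjoint \<alpha>" "side c"
  shows "mate c \<alpha> (mate c \<alpha> x) = x"
proof (cases "mate c \<alpha> x = x")
  case False
  then have "{c (mate c \<alpha> x), c x} \<in> \<alpha>"
    using mate_block[OF assms] by (simp add: insert_commute)
  then show ?thesis by (rule mate_eq[OF assms])
qed simp

lemma mate_in:
  assumes "disjoint \<alpha>" "side c" "\<Union>\<alpha> \<subseteq> vertices n" "x \<in> {1..n}"
  shows "mate c \<alpha> x \<in> {1..n}"
proof (cases "mate c \<alpha> x = x")
  case False
  then have "c (mate c \<alpha> x) \<in> vertices n"
    using mate_block[OF assms(1,2)] assms(3) by blast
  then show ?thesis using assms(2) by (auto simp: vertices_def)
qed (use assms in simp)

lemma mate_fixed_iff:
  assumes "disjoint \<alpha>" "side c"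
  shows "mate c \<alpha> x \<noteq> x \<longleftrightarrow> (\<exists>y. y \<noteq> x \<and> {c x, c y} \<in> \<alpha>)"
  using mate_block[OF assms] mate_eq[OF assms] by metis

lemma range_closed_under_mates:
  assumes "disjoint \<alpha>" "\<Union>\<alpha> \<subseteq> vertices n"
  shows "closed_under_mates \<alpha> {1..n}"
  using mate_in[OF assms(1) _ assms(2)] unfolding mate_closed_def by blast

lemma interface_edgesE:
  assumes "e \<in> interface_edges \<alpha>"
  obtains c a b where "side c" "a \<noteq> b" "e = {c a, c b}" "e \<in> \<alpha>" "endpoints e = {a, b}"
proof -
  obtain a b where ab: "a \<noteq> b" "e = {Upper a, Upper b} \<or> e = {Lower a, Lower b}" "e \<in> \<alpha>"
    using assms unfolding interface_edges_def by auto
  from ab(2) show ?thesis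
    using ab that[of Upper a b] that[of Lower a b] endpoints_simps by auto
qed

lemma interface_edgesI:
  assumes "{c a, c b} \<in> \<alpha>" "a \<noteq> b" "side c"
  shows "{c a, c b} \<in> interface_edges \<alpha>"
  using assms unfolding interface_edges_def by auto

lemma conn_refl: "(x, x) \<in> conn \<alpha>"
  by (simp add: conn_def)

lemma conn_trans: "(x, y) \<in> conn \<alpha> \<Longrightarrow> (y, z) \<in> conn \<alpha> \<Longrightarrow> (x, z) \<in> conn \<alpha>"
  unfolding conn_def by (rule rtrancl_trans)

lemma conn_sym: "(x, y) \<in> conn \<alpha> \<Longrightarrow> (y, x) \<in> conn \<alpha>"
  unfolding conn_def by (rule symD[OF sym_rtrancl]) (auto simp: sym_def)

lemma conn_mate:
  assumes "disjoint \<alpha>" "side c"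
  shows "(x, mate c \<alpha> x) \<in> conn \<alpha>"
proof (cases "mate c \<alpha> x = x")
  case False
  then have "{c x, c (mate c \<alpha> x)} \<in> interface_edges \<alpha>"
    using mate_block[OF assms] assms(2) by (intro interface_edgesI) auto
  then show ?thesis
    unfolding conn_def using assms(2) by (intro r_into_rtrancl UN_I) auto
qed (simp add: conn_refl)

lemma conn_closed:
  assumes "disjoint \<alpha>"
  shows "closed_under_mates \<alpha> (conn \<alpha> `` {x})"
  unfolding mate_closed_def using conn_mate[OF assms] conn_trans by blast

text \<open>Together with \<open>conn_closed\<close>: the component of \<open>x\<close> is the least
  set containing \<open>x\<close> that is closed under both mates. This links the closure of the
  edge relation to the orbits of walks.\<close>

lemma conn_least:
  assumes "disjoint \<alpha>" "(x, y) \<in> conn \<alpha>" "closed_under_mates \<alpha> B" "x \<in> B"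
  shows "y \<in> B"
  using assms(2) unfolding conn_def
proof (induction rule: rtrancl_induct)
  case (step y z)
  then obtain e where e: "e \<in> interface_edges \<alpha>" "y \<in> endpoints e" "z \<in> endpoints e" by blast
  then obtain c a b where c: "side c" "e = {c a, c b}" "e \<in> \<alpha>" "endpoints e = {a, b}"
    by (elim interface_edgesE)
  have "mate c \<alpha> a = b" "mate c \<alpha> b = a"
    using mate_eq[OF assms(1) c(1)] c(2,3) by (auto simp: insert_commute)
  then show ?case
    using e c step.IH assms(3) unfolding mate_closed_def by auto
qed (fact assms)

text \<open>The component is the orbit of \<open>a\<close>, a path whose edges alternate, beginning
  with a lower one. Its far end has no lower arc if the number of edges is even, and no upper arc if
  it is odd; these are the two alternatives.\<close>

lemma component_ends:
  assumes "disjoint \<alpha>" "\<Union>\<alpha> \<subseteq> vertices n" "a \<in> {1..n}" "mate Upper \<alpha> a = a"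
  defines "P \<equiv> conn \<alpha> `` {a}"
  obtains z where "z \<in> P"
    "{x \<in> P. mate Upper \<alpha> x = x} = {a} \<and> {x \<in> P. mate Lower \<alpha> x = x} = {z}
     \<or> {x \<in> P. mate Upper \<alpha> x = x} = {a, z} \<and> z \<noteq> a \<and> {x \<in> P. mate Lower \<alpha> x = x} = {}"
proof -
  have inv: "mate Upper \<alpha> (mate Upper \<alpha> x) = x" "mate Lower \<alpha> (mate Lower \<alpha> x) = x" for x
    using mate_mate[OF assms(1)] by auto
  obtain Q z where Q: "Q \<subseteq> {1..n}" "a \<in> Q" "closed_under_mates \<alpha> Q"
    "\<And>B. a \<in> B \<Longrightarrow> closed_under_mates \<alpha> B \<Longrightarrow> Q \<subseteq> B" and z: "z \<in> Q"
    "{x \<in> Q. mate Upper \<alpha> x = x} = {a} \<and> {x \<in> Q. mate Lower \<alpha> x = x} = {z}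
     \<or> {x \<in> Q. mate Upper \<alpha> x = x} = {a, z} \<and> z \<noteq> a \<and> {x \<in> Q. mate Lower \<alpha> x = x} = {}"
    using orbit_of_fixed_point[of "mate Upper \<alpha>" "mate Lower \<alpha>" "{1..n}" a, OF inv
        finite_atLeastAtMost range_closed_under_mates[OF assms(1,2)] assms(3,4)] by blast
  have "P = Q"
  proof
    show "P \<subseteq> Q" unfolding P_def using conn_least[OF assms(1) _ Q(3,2)] by blast
    show "Q \<subseteq> P" unfolding P_def using conn_closed[OF assms(1)] by (intro Q(4)) (auto simp: conn_refl)
  qed
  then show ?thesis using that z by blast
qed

lemma motzkin_disjoint: "motzkin_diagram n \<alpha> \<Longrightarrow> disjoint \<alpha>"
  by (auto simp: motzkin_diagram_def partition_on_def)

lemma motzkin_Union: "motzkin_diagram n \<alpha> \<Longrightarrow> \<Union>\<alpha> = vertices n"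
  by (auto simp: motzkin_diagram_def partition_on_def)

lemma motzkin_block:
  assumes "motzkin_diagram n \<alpha>" "B \<in> \<alpha>"
  obtains (side) c a b where "side c" "B = {c a, c b}"
  | (transversal) x y where "B = {Upper x, Lower y}"
proof -
  have "card B = 1 \<or> card B = 2" using assms by (auto simp: motzkin_diagram_def)
  then show ?thesis
    by (cases rule: block_cases) (use that in blast)+
qed

lemma motzkin_transversal:
  assumes "motzkin_diagram n \<alpha>" "B \<in> \<alpha>" "transversal B"
  obtains x y where "B = {Upper x, Lower y}"
  using assms(1,2)
proof (cases rule: motzkin_block)
  case (side c a b)
  then show ?thesis using assms(3) by auto
qed (use that in blast)

lemma ends_Upper:
  assumes "motzkin_diagram n \<alpha>"
  shows "x \<in> ends Upper \<alpha> \<longleftrightarrow> (\<exists>y. {Upper x, Lower y} \<in> \<alpha>)"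
proof
  assume "x \<in> ends Upper \<alpha>"
  then obtain B where "B \<in> \<alpha>" "transversal B" "Upper x \<in> B" by (auto simp: ends_def)
  then show "\<exists>y. {Upper x, Lower y} \<in> \<alpha>" using motzkin_transversal[OF assms]
      by (metis insertE singletonD vertex.distinct(1) vertex.inject(1))
next
  assume "\<exists>y. {Upper x, Lower y} \<in> \<alpha>"
  then show "x \<in> ends Upper \<alpha>" unfolding ends_def using transversal_simps(1) by blast
qed

lemma ends_Lower:
  assumes "motzkin_diagram n \<alpha>"
  shows "y \<in> ends Lower \<alpha> \<longleftrightarrow> (\<exists>x. {Upper x, Lower y} \<in> \<alpha>)"
proof
  assume "y \<in> ends Lower \<alpha>"
  then obtain B where "B \<in> \<alpha>" "transversal B" "Lower y \<in> B" by (auto simp: ends_def)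
  then show "\<exists>x. {Upper x, Lower y} \<in> \<alpha>" using motzkin_transversal[OF assms]
      by (metis insertE singletonD vertex.distinct(1) vertex.inject(2))
next
  assume "\<exists>x. {Upper x, Lower y} \<in> \<alpha>"
  then show "y \<in> ends Lower \<alpha>" unfolding ends_def using transversal_simps(1) by blast
qed

lemma ends_in:
  assumes "motzkin_diagram n \<alpha>" "x \<in> ends c \<alpha>" "side c"
  shows "x \<in> {1..n}"
proof -
  have "c x \<in> vertices n" using assms(2) motzkin_Union[OF assms(1)] unfolding ends_def by blast
  then show ?thesis using assms(3) by (auto simp: vertices_def)
qed

lemma ends_mate:
  assumes "disjoint \<alpha>" "x \<in> ends c \<alpha>" "side c"
  shows "mate c \<alpha> x = x"
proof (rule ccontr)
  assume "mate c \<alpha> x \<noteq> x"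
  then have B: "{c x, c (mate c \<alpha> x)} \<in> \<alpha>" by (rule mate_block[OF assms(1,3)])
  obtain A where A: "A \<in> \<alpha>" "transversal A" "c x \<in> A" using assms(2) by (auto simp: ends_def)
  then have "A = {c x, c (mate c \<alpha> x)}" using disjoint_block_eq[OF assms(1) A(1) B A(3)] by blast
  then show False using A(2) assms(3) by auto
qed

lemma transversal_unique:
  assumes "disjoint \<alpha>" "{Upper x, Lower y} \<in> \<alpha>" "{Upper x', Lower y'} \<in> \<alpha>"
  shows "x = x' \<longleftrightarrow> y = y'"
  using disjoint_block_eq[OF assms, of "Upper x"] disjoint_block_eq[OF assms, of "Lower y"]
  by (auto simp: doubleton_eq_iff)

text \<open>In the product of a diagram with itself, the middle row of the stacked diagram is the interface
  graph.\<close>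

definition middle_block :: "diagram \<Rightarrow> nat set \<Rightarrow> vertex set" where
  "middle_block \<alpha> C = {Upper x | x. \<exists>y\<in>C. {Upper x, Lower y} \<in> \<alpha>}
     \<union> {Lower y | y. \<exists>x\<in>C. {Upper x, Lower y} \<in> \<alpha>}"

text \<open>The non-transversal blocks on the two outer sides are components by themselves. Every
  other component meets the middle row in a component of the interface graph, to which the
  transversals of the two copies attach their outer ends; one without transversals leaves the empty
  set.\<close>

lemma diagram_square:
  assumes \<alpha>: "motzkin_diagram n \<alpha>"
  shows "diagram_mult \<alpha> \<alpha> =
    {B \<in> \<alpha>. \<not> transversal B} \<union> ((\<lambda>y. middle_block \<alpha> (conn \<alpha> `` {y})) ` {1..n} - {{}})"
proof -
  note dj = motzkin_disjoint[OF \<alpha>]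
  define R where "R = (\<Union>B\<in>stacked_blocks \<alpha> \<alpha>. B \<times> B)"
  \<comment> \<open>The expected component of \<open>Mid y\<close>. A transversal with upper end
    \<open>x\<close> and lower end \<open>z\<close> joins \<open>Top x\<close> to
    \<open>Mid z\<close> in the upper copy and \<open>Mid x\<close> to \<open>Bot z\<close> in the
    lower copy.\<close>
  define K where "K y = Mid ` (conn \<alpha> `` {y}) \<union> {Top x | x. \<exists>z\<in>conn \<alpha> `` {y}. {Upper x, Lower z} \<in> \<alpha>}
     \<union> {Bot z | z. \<exists>x\<in>conn \<alpha> `` {y}. {Upper x, Lower z} \<in> \<alpha>}" for y
  have K_iff: "Mid z \<in> K y \<longleftrightarrow> (y, z) \<in> conn \<alpha>"
    "Top x \<in> K y \<longleftrightarrow> (\<exists>z. (y, z) \<in> conn \<alpha> \<and> {Upper x, Lower z} \<in> \<alpha>)"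
    "Bot z \<in> K y \<longleftrightarrow> (\<exists>x. (y, x) \<in> conn \<alpha> \<and> {Upper x, Lower z} \<in> \<alpha>)" for x y z
    unfolding K_def by auto
  have RI: "(v, w) \<in> R" if "B \<in> stacked_blocks \<alpha> \<alpha>" "v \<in> B" "w \<in> B" for v w B
    using that unfolding R_def by blast
  have R_up: "(stack_upper v, stack_upper w) \<in> R" if "B \<in> \<alpha>" "v \<in> B" "w \<in> B" for v w B
    using that by (intro RI[of "stack_upper ` B"]) (auto simp: stacked_blocks_def)
  have R_lo: "(stack_lower v, stack_lower w) \<in> R" if "B \<in> \<alpha>" "v \<in> B" "w \<in> B" for v w B
    using that by (intro RI[of "stack_lower ` B"]) (auto simp: stacked_blocks_def)
  have RE: "(\<exists>B\<in>\<alpha>. \<exists>v'\<in>B. \<exists>w'\<in>B. v = stack_upper v' \<and> w = stack_upper w')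
      \<or> (\<exists>B\<in>\<alpha>. \<exists>v'\<in>B. \<exists>w'\<in>B. v = stack_lower v' \<and> w = stack_lower w')" if "(v, w) \<in> R" for v w
    using that unfolding R_def stacked_blocks_def by blast
  have symR: "sym (R\<^sup>*)" by (rule sym_rtrancl) (auto simp: sym_def R_def)
  have class_eq: "R\<^sup>* `` {v} = R\<^sup>* `` {w}" if "(v, w) \<in> R\<^sup>*" for v w
    using that symD[OF symR] by (auto intro: rtrancl_trans)
  have least: "R\<^sup>* `` {v} \<subseteq> A" if "v \<in> A" "\<And>a b. a \<in> A \<Longrightarrow> (a, b) \<in> R \<Longrightarrow> b \<in> A" for v A
  proof
    fix w assume "w \<in> R\<^sup>* `` {v}"
    then have "(v, w) \<in> R\<^sup>*" by simp
    then show "w \<in> A" using that by (induction rule: rtrancl_induct) auto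
  qed
  have trans_eq: "B = {Upper x, Lower y}" if "B \<in> \<alpha>" "{Upper x, Lower y} \<in> \<alpha>"
      "Upper x \<in> B \<or> Lower y \<in> B" for B x y
    using disjoint_block_eq[OF dj that(1,2)] that(3) by blast
  have conn_block: "(a, b) \<in> conn \<alpha>" if "{c a, c b} \<in> \<alpha>" "side c" for a b c
    using conn_mate[OF dj that(2), of a] mate_eq[OF dj that(2,1)] by simp
  have K: "R\<^sup>* `` {Mid y} = K y" if "y \<in> {1..n}" for y
  proof
    show "R\<^sup>* `` {Mid y} \<subseteq> K y"
    proof (rule least)
      show "Mid y \<in> K y" by (auto simp: K_iff conn_refl)
      fix a b assume a: "a \<in> K y" and "(a, b) \<in> R"
      from RE[OF this(2)] show "b \<in> K y"
      proof (elim disjE bexE conjE)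
        fix B v w assume B: "B \<in> \<alpha>" "v \<in> B" "w \<in> B" "a = stack_upper v" "b = stack_upper w"
        from \<alpha> B(1) show ?thesis
        proof (cases rule: motzkin_block)
          case (side c p q)
          show ?thesis
          proof (cases "c = Upper")
            case True
            then obtain x where x: "v = Upper x" using B(2) side by auto
            have "{Upper x, Lower z} \<notin> \<alpha>" for z
              using trans_eq[OF B(1), of x z] B(2) x side True by (auto simp: doubleton_eq_iff)
            then have False using a B(4) x by (auto simp: K_iff)
            then show ?thesis ..
          next
            case False
            then have c: "c = Lower" using side by auto
            have "(p, q) \<in> conn \<alpha>" "(q, p) \<in> conn \<alpha>"
              using conn_block[of c p q] B(1) side conn_sym by auto
            then show ?thesis using a B side c by (auto simp: K_iff intro: conn_trans)
          qed
        next
          case (transversal p q)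
          have pq: "{Upper p, Lower q} \<in> \<alpha>" using B(1) transversal by simp
          consider "a = Top p" | "a = Mid q" using B(2,4) transversal by auto
          then have "(y, q) \<in> conn \<alpha>"
            using a transversal_unique[OF dj pq] by cases (auto simp: K_iff)
          then show ?thesis using B(3,5) transversal pq by (auto simp: K_iff)
        qed
      next
        fix B v w assume B: "B \<in> \<alpha>" "v \<in> B" "w \<in> B" "a = stack_lower v" "b = stack_lower w"
        from \<alpha> B(1) show ?thesis
        proof (cases rule: motzkin_block)
          case (side c p q)
          show ?thesis
          proof (cases "c = Lower")
            case True
            then obtain z where z: "v = Lower z" using B(2) side by auto
            have "{Upper x, Lower z} \<notin> \<alpha>" for x
              using trans_eq[OF B(1), of x z] B(2) z side True by (auto simp: doubleton_eq_iff)
            then have False using a B(4) z by (auto simp: K_iff)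
            then show ?thesis ..
          next
            case False
            then have c: "c = Upper" using side by auto
            have "(p, q) \<in> conn \<alpha>" "(q, p) \<in> conn \<alpha>"
              using conn_block[of c p q] B(1) side conn_sym by auto
            then show ?thesis using a B side c by (auto simp: K_iff intro: conn_trans)
          qed
        next
          case (transversal p q)
          have pq: "{Upper p, Lower q} \<in> \<alpha>" using B(1) transversal by simp
          consider "a = Mid p" | "a = Bot q" using B(2,4) transversal by auto
          then have "(y, p) \<in> conn \<alpha>"
            using a transversal_unique[OF dj pq] by cases (auto simp: K_iff)
          then show ?thesis using B(3,5) transversal pq by (auto simp: K_iff)
        qed
      qed
    qed
    have mid: "(Mid y, Mid z) \<in> R\<^sup>*" if "(y, z) \<in> conn \<alpha>" for z
      using that unfolding conn_def
    proof (induction rule: rtrancl_induct)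
      case (step z z')
      then obtain e where e: "e \<in> interface_edges \<alpha>" "z \<in> endpoints e" "z' \<in> endpoints e" by blast
      then obtain c a b where c: "side c" "e = {c a, c b}" "e \<in> \<alpha>" "endpoints e = {a, b}"
        by (elim interface_edgesE)
      have "(Mid z, Mid z') \<in> R"
        using c(1)
      proof (elim insertE emptyE)
        assume "c = Upper"
        then show ?thesis using R_lo[OF c(3), of "Upper z" "Upper z'"] e c by auto
      next
        assume "c = Lower"
        then show ?thesis using R_up[OF c(3), of "Lower z" "Lower z'"] e c by auto
      qed
      then show ?case using step.IH by (rule rtrancl_into_rtrancl[rotated])
    qed simp
    show "K y \<subseteq> R\<^sup>* `` {Mid y}"
    proof
      fix v assume "v \<in> K y"
      then consider z where "(y, z) \<in> conn \<alpha>" "v = Mid z"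
        | x z where "(y, z) \<in> conn \<alpha>" "v = Top x" "{Upper x, Lower z} \<in> \<alpha>"
        | x z where "(y, x) \<in> conn \<alpha>" "v = Bot z" "{Upper x, Lower z} \<in> \<alpha>"
        unfolding K_def by blast
      then show "v \<in> R\<^sup>* `` {Mid y}"
      proof cases
        case 1
        then show ?thesis using mid by auto
      next
        case 2
        then have "(Mid z, v) \<in> R" using R_up[OF 2(3), of "Lower z" "Upper x"] by simp
        then show ?thesis using mid[OF 2(1)] by (auto intro: rtrancl_into_rtrancl)
      next
        case 3
        then have "(Mid x, v) \<in> R" using R_lo[OF 3(3), of "Upper x" "Lower z"] by simp
        then show ?thesis using mid[OF 3(1)] by (auto intro: rtrancl_into_rtrancl)
      qed
    qed
  qed
  have K_outer: "stack_outer -` K y = middle_block \<alpha> (conn \<alpha> `` {y})" for y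
  proof -
    have "v \<in> stack_outer -` K y \<longleftrightarrow> v \<in> middle_block \<alpha> (conn \<alpha> `` {y})" for v
      by (cases v) (auto simp: K_iff middle_block_def)
    then show ?thesis by blast
  qed
  have upper: "R\<^sup>* `` {Top x} = stack_upper ` {Upper a, Upper b}"
    if B: "{Upper a, Upper b} \<in> \<alpha>" and x: "x \<in> {a, b}" for x a b
  proof
    show "R\<^sup>* `` {Top x} \<subseteq> stack_upper ` {Upper a, Upper b}"
    proof (rule least)
      fix v w assume v: "v \<in> stack_upper ` {Upper a, Upper b}" and "(v, w) \<in> R"
      from RE[OF this(2)] show "w \<in> stack_upper ` {Upper a, Upper b}"
      proof (elim disjE bexE conjE)
        fix D v' w' assume D: "D \<in> \<alpha>" "v' \<in> D" "w' \<in> D" "v = stack_upper v'" "w = stack_upper w'"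
        then have "v' \<in> {Upper a, Upper b}" using v by (cases v') auto
        then have "D = {Upper a, Upper b}" using disjoint_block_eq[OF dj D(1) B D(2)] by simp
        then show ?thesis using D by blast
      next
        fix D v' w' assume "v = stack_lower v'"
        then show ?thesis using v by (cases v') auto
      qed
    qed (use x in auto)
    show "stack_upper ` {Upper a, Upper b} \<subseteq> R\<^sup>* `` {Top x}"
      using R_up[OF B, of "Upper x" "Upper a"] R_up[OF B, of "Upper x" "Upper b"] x by auto
  qed
  have lower: "R\<^sup>* `` {Bot x} = stack_lower ` {Lower a, Lower b}"
    if B: "{Lower a, Lower b} \<in> \<alpha>" and x: "x \<in> {a, b}" for x a b
  proof
    show "R\<^sup>* `` {Bot x} \<subseteq> stack_lower ` {Lower a, Lower b}"
    proof (rule least)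
      fix v w assume v: "v \<in> stack_lower ` {Lower a, Lower b}" and "(v, w) \<in> R"
      from RE[OF this(2)] show "w \<in> stack_lower ` {Lower a, Lower b}"
      proof (elim disjE bexE conjE)
        fix D v' w' assume "v = stack_upper v'"
        then show ?thesis using v by (cases v') auto
      next
        fix D v' w' assume D: "D \<in> \<alpha>" "v' \<in> D" "w' \<in> D" "v = stack_lower v'" "w = stack_lower w'"
        then have "v' \<in> {Lower a, Lower b}" using v by (cases v') auto
        then have "D = {Lower a, Lower b}" using disjoint_block_eq[OF dj D(1) B D(2)] by simp
        then show ?thesis using D by blast
      qed
    qed (use x in auto)
    show "stack_lower ` {Lower a, Lower b} \<subseteq> R\<^sup>* `` {Bot x}"
      using R_lo[OF B, of "Lower x" "Lower a"] R_lo[OF B, of "Lower x" "Lower b"] x by auto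
  qed
  have outer_upper: "stack_outer -` (stack_upper ` {Upper a, Upper b}) = {Upper a, Upper b}" for a b
  proof -
    have "v \<in> stack_outer -` (stack_upper ` {Upper a, Upper b}) \<longleftrightarrow> v \<in> {Upper a, Upper b}" for v
      by (cases v) auto
    then show ?thesis by blast
  qed
  have outer_lower: "stack_outer -` (stack_lower ` {Lower a, Lower b}) = {Lower a, Lower b}" for a b
  proof -
    have "v \<in> stack_outer -` (stack_lower ` {Lower a, Lower b}) \<longleftrightarrow> v \<in> {Lower a, Lower b}" for v
      by (cases v) auto
    then show ?thesis by blast
  qed
  have range: "x \<in> {1..n}" if "B \<in> \<alpha>" "Upper x \<in> B \<or> Lower x \<in> B" for x B
  proof -
    have "Upper x \<in> vertices n \<or> Lower x \<in> vertices n" using that motzkin_Union[OF \<alpha>] by blast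
    then show ?thesis by (auto simp: vertices_def)
  qed
  have carrier: "v \<in> \<Union>(stacked_blocks \<alpha> \<alpha>) \<longleftrightarrow> (\<exists>w\<in>\<Union>\<alpha>. v = stack_upper w \<or> v = stack_lower w)" for v
    unfolding stacked_blocks_def by blast
  have comp: "stacked_components \<alpha> \<alpha> = (\<lambda>v. R\<^sup>* `` {v}) ` \<Union>(stacked_blocks \<alpha> \<alpha>)"
    unfolding stacked_components_def R_def[symmetric] quotient_def by (simp add: UNION_singleton_eq_range)
  show ?thesis
  proof (intro equalityI subsetI)
    fix D assume "D \<in> diagram_mult \<alpha> \<alpha>"
    then obtain v where v: "D \<noteq> {}" "D = stack_outer -` (R\<^sup>* `` {v})" "v \<in> \<Union>(stacked_blocks \<alpha> \<alpha>)"
      unfolding diagram_mult_def comp image_image by blast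
    from v(3) obtain w where "w \<in> \<Union>\<alpha>" "v = stack_upper w \<or> v = stack_lower w"
      unfolding carrier by (elim bexE)
    note D = v(1,2) this
    obtain B where B: "B \<in> \<alpha>" "w \<in> B" using D by blast
    let ?M = "(\<lambda>y. middle_block \<alpha> (conn \<alpha> `` {y})) ` {1..n} - {{}}"
    have mid: "D \<in> ?M" if "(v, Mid y) \<in> R\<^sup>*" "y \<in> {1..n}" for y
      using D(1,2) class_eq[OF that(1)] K[OF that(2)] K_outer[of y] that(2) by auto
    from \<alpha> B(1) show "D \<in> {B \<in> \<alpha>. \<not> transversal B} \<union> ?M"
    proof (cases rule: motzkin_block)
      case (side c a b)
      then obtain x where x: "w = c x" "x \<in> {a, b}" using B by auto
      have xn: "x \<in> {1..n}" using range[OF B(1), of x] side x B by auto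
      have nt: "\<not> transversal B" using side by auto
      consider "v = Mid x" | "c = Upper" "v = Top x" | "c = Lower" "v = Bot x"
        using D(4) side x by auto
      then show ?thesis
      proof cases
        case 1
        then show ?thesis using mid[OF _ xn] by auto
      next
        case 2
        then have "D = B"
          using D(2) side upper[of a b x] x B(1) outer_upper[of a b] by simp
        then show ?thesis using B nt by blast
      next
        case 3
        then have "D = B"
          using D(2) side lower[of a b x] x B(1) outer_lower[of a b] by simp
        then show ?thesis using B nt by blast
      qed
    next
      case (transversal x y)
      have "x \<in> {1..n}" "y \<in> {1..n}" using range[OF B(1)] transversal by auto
      moreover have "(Top x, Mid y) \<in> R" "(Bot y, Mid x) \<in> R"
        using R_up[OF B(1), of "Upper x" "Lower y"] R_lo[OF B(1), of "Lower y"
            "Upper x"] transversal by auto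
      moreover have "v \<in> {Top x, Mid x, Mid y, Bot y}" using D(4) B(2) transversal by auto
      ultimately have "D \<in> ?M" using mid[of x] mid[of y] by (elim insertE emptyE) blast+
      then show ?thesis by blast
    qed
  next
    fix D assume D: "D \<in> {B \<in> \<alpha>. \<not> transversal B} \<union> ((\<lambda>y. middle_block \<alpha> (conn \<alpha> `` {y})) ` {1..n} - {{}})"
    have memI: "D \<in> diagram_mult \<alpha> \<alpha>"
      if "D = stack_outer -` (R\<^sup>* `` {v})" "D \<noteq> {}" "w \<in> \<Union>\<alpha>" "v = stack_upper w \<or> v = stack_lower w" for v w
    proof -
      have "v \<in> \<Union>(stacked_blocks \<alpha> \<alpha>)" unfolding carrier using that(3,4) by (rule bexI[rotated])
      then show ?thesis unfolding diagram_mult_def comp image_image using that(1,2) by blast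
    qed
    from D show "D \<in> diagram_mult \<alpha> \<alpha>"
    proof
      assume "D \<in> {B \<in> \<alpha>. \<not> transversal B}"
      then have DA: "D \<in> \<alpha>" "\<not> transversal D" by auto
      from \<alpha> DA(1) show ?thesis
      proof (cases rule: motzkin_block)
        case (side c a b)
        from side(1) show ?thesis
        proof (elim insertE emptyE)
          assume "c = Upper"
          then show ?thesis
            using upper[of a b a] outer_upper[of a b] DA side by (intro memI[of "Top a" "Upper a"]) auto
        next
          assume "c = Lower"
          then show ?thesis
            using lower[of a b a] outer_lower[of a b] DA side by (intro memI[of "Bot a" "Lower a"]) auto
        qed
      qed (use DA in auto)
    next
      assume "D \<in> (\<lambda>y. middle_block \<alpha> (conn \<alpha> `` {y})) ` {1..n} - {{}}"
      then obtain y where y: "y \<in> {1..n}" "D = middle_block \<alpha> (conn \<alpha> `` {y})" "D \<noteq> {}" by blast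
      have "Upper y \<in> \<Union>\<alpha>" using y(1) motzkin_Union[OF \<alpha>] by (auto simp: vertices_def)
      then show ?thesis
        using y K[OF y(1)] K_outer[of y] by (intro memI[of "Mid y" "Upper y"]) auto
    qed
  qed
qed

text \<open>The component is a path with end \<open>x\<close>. Because \<open>y\<close> has no lower
  arc, the alternative of two upper ends in \<open>component_ends\<close> is excluded and
  \<open>y\<close> must be the other end.\<close>

lemma idempotent_component:
  assumes \<alpha>: "motzkin_diagram n \<alpha>" and xy: "{Upper x, Lower y} \<in> \<alpha>" "(x, y) \<in> conn \<alpha>"
  shows "free_ends Upper \<alpha> x = {x}" "free_ends Lower \<alpha> x = {y}"
proof -
  note dj = motzkin_disjoint[OF \<alpha>]
  have x: "x \<in> ends Upper \<alpha>" and y: "y \<in> ends Lower \<alpha>"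
    using xy(1) ends_Upper[OF \<alpha>] ends_Lower[OF \<alpha>] by auto
  have xn: "x \<in> {1..n}" using ends_in[OF \<alpha> x] by simp
  have mx: "mate Upper \<alpha> x = x" and my: "mate Lower \<alpha> y = y"
    using ends_mate[OF dj x] ends_mate[OF dj y] by auto
  define U L where "U = free_ends Upper \<alpha> x"
    and "L = free_ends Lower \<alpha> x"
  obtain z where "z \<in> conn \<alpha> `` {x}" and z: "U = {x} \<and> L = {z} \<or> U = {x, z} \<and> z \<noteq> x \<and> L = {}"
    unfolding U_def L_def by (rule component_ends[OF dj equalityD1[OF motzkin_Union[OF \<alpha>]] xn mx])
  have "y \<in> L" unfolding L_def using xy(2) my by simp
  then have "U = {x}" "L = {y}" using z by auto
  then show "free_ends Upper \<alpha> x = {x}" "free_ends Lower \<alpha> x = {y}"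
    unfolding U_def L_def .
qed

text \<open>A transversal of the square runs through a component of the middle row. If the square
  equals the diagram, the block \<open>{Upper x, Lower y}\<close> arises from a component that
  contains \<open>y\<close>, where the upper copy enters it, and \<open>x\<close>, where the lower
  copy leaves it. Conversely, a path from \<open>x\<close> to \<open>y\<close> has no further free
  ends, so no other transversal attaches to this component and the same block arises again.\<close>

lemma idempotent_iff:
  assumes \<alpha>: "motzkin_diagram n \<alpha>"
  shows "diagram_mult \<alpha> \<alpha> = \<alpha> \<longleftrightarrow> (\<forall>x y. {Upper x, Lower y} \<in> \<alpha> \<longrightarrow> (x, y) \<in> conn \<alpha>)"
proof (intro iffI allI impI)
  note dj = motzkin_disjoint[OF \<alpha>]
  fix x y assume idem: "diagram_mult \<alpha> \<alpha> = \<alpha>" and xy: "{Upper x, Lower y} \<in> \<alpha>"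
  then have "{Upper x, Lower y} \<in> diagram_mult \<alpha> \<alpha>" by simp
  then obtain m where m: "{Upper x, Lower y} = middle_block \<alpha> (conn \<alpha> `` {m})"
    unfolding diagram_square[OF \<alpha>] by auto
  then have "Upper x \<in> middle_block \<alpha> (conn \<alpha> `` {m})" "Lower y \<in> middle_block \<alpha> (conn \<alpha> `` {m})" by auto
  then obtain y' x' where "(m, y') \<in> conn \<alpha>" "{Upper x, Lower y'} \<in> \<alpha>" "(m, x') \<in> conn \<alpha>"
      "{Upper x', Lower y} \<in> \<alpha>"
    by (auto simp: middle_block_def)
  moreover from this have "y' = y" "x' = x" using transversal_unique[OF dj xy] by auto
  ultimately show "(x, y) \<in> conn \<alpha>" using conn_sym conn_trans by blast
next
  note dj = motzkin_disjoint[OF \<alpha>]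
  assume H: "\<forall>x y. {Upper x, Lower y} \<in> \<alpha> \<longrightarrow> (x, y) \<in> conn \<alpha>"
  have block: "middle_block \<alpha> (conn \<alpha> `` {m}) = {Upper x, Lower y}"
    if xy: "{Upper x, Lower y} \<in> \<alpha>" "(m, x) \<in> conn \<alpha> \<or> (m, y) \<in> conn \<alpha>" for x y m
  proof -
    have c: "(x, y) \<in> conn \<alpha>" using H xy(1) by blast
    have C: "conn \<alpha> `` {m} = conn \<alpha> `` {x}"
      using xy(2) c conn_sym conn_trans by blast
    note e = idempotent_component[OF \<alpha> xy(1) c]
    have "x' = x \<and> y' = y" if "{Upper x', Lower y'} \<in> \<alpha>" "x' \<in> conn \<alpha> `` {x} \<or> y' \<in> conn \<alpha> `` {x}" for x' y'
    proof -
      have "mate Upper \<alpha> x' = x'" "mate Lower \<alpha> y' = y'"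
        using ends_mate[OF dj] ends_Upper[OF \<alpha>] ends_Lower[OF \<alpha>] that(1) by blast+
      then have "x' = x \<or> y' = y" using e that(2) by blast
      then show ?thesis using transversal_unique[OF dj that(1) xy(1)] by blast
    qed
    then show ?thesis unfolding C middle_block_def using xy(1) c conn_refl by blast
  qed
  have empty: "middle_block \<alpha> (conn \<alpha> `` {m}) = {}"
    if "\<And>x y. {Upper x, Lower y} \<in> \<alpha> \<Longrightarrow> \<not> ((m, x) \<in> conn \<alpha> \<or> (m, y) \<in> conn \<alpha>)" for m
    using that unfolding middle_block_def by blast
  show "diagram_mult \<alpha> \<alpha> = \<alpha>"
  proof (intro equalityI subsetI)
    fix D assume "D \<in> diagram_mult \<alpha> \<alpha>"
    then consider "D \<in> \<alpha>" | m where "D = middle_block \<alpha> (conn \<alpha> `` {m})" "D \<noteq> {}"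
      unfolding diagram_square[OF \<alpha>] by auto
    then show "D \<in> \<alpha>"
    proof cases
      case 2
      then obtain x y where "{Upper x, Lower y} \<in> \<alpha>" "(m, x) \<in> conn \<alpha> \<or> (m, y) \<in> conn \<alpha>"
        using empty by blast
      then show ?thesis using block 2(1) by simp
    qed
  next
    fix D assume D: "D \<in> \<alpha>"
    show "D \<in> diagram_mult \<alpha> \<alpha>"
    proof (cases "transversal D")
      case True
      then obtain x y where xy: "D = {Upper x, Lower y}" using motzkin_transversal[OF \<alpha> D] by blast
      have "x \<in> {1..n}" using ends_in[OF \<alpha>] ends_Upper[OF \<alpha>] D xy by blast
      then show ?thesis
        unfolding diagram_square[OF \<alpha>] using block[of x y x] xy D conn_refl by auto
    qed (simp add: diagram_square[OF \<alpha>] D)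
  qed
qed

section \<open>Cycles, and order of paths\<close>

lemma edge_at:
  assumes "disjoint \<alpha>" "e \<in> interface_edges \<alpha>" "x \<in> endpoints e"
  obtains c where "side c" "e = {c x, c (mate c \<alpha> x)}" "mate c \<alpha> x \<noteq> x"
proof -
  obtain c a b where c: "side c" "a \<noteq> b" "e = {c a, c b}" "e \<in> \<alpha>" "endpoints e = {a, b}"
    using assms(2) by (elim interface_edgesE)
  have "mate c \<alpha> a = b" "mate c \<alpha> b = a"
    using mate_eq[OF assms(1) c(1)] c(3,4) by (auto simp: insert_commute)
  then show ?thesis using that[OF c(1)] c assms(3) by (auto simp: insert_commute)
qed

lemma mate_edge:
  assumes "disjoint \<alpha>" "side c" "mate c \<alpha> x \<noteq> x"
  shows "{c x, c (mate c \<alpha> x)} \<in> interface_edges \<alpha>"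
  using mate_block[OF assms] assms by (intro interface_edgesI) auto

text \<open>On one side a vertex has at most one arc. The two consecutive edges of the cycle at
  \<open>x\<close> are distinct, as the cycle has length at least 2, so one of them is an upper edge
  and the other a lower edge.\<close>

lemma is_cycleD:
  assumes dj: "disjoint \<alpha>" and cyc: "is_cycle \<alpha> \<theta>" and x: "x \<in> \<theta>" and c: "side c"
  shows "mate c \<alpha> x \<noteq> x"
proof -
  obtain vs es where len: "length vs \<ge> 2" "length es = length vs" and dist: "distinct es"
    and sets: "set vs = \<theta>" "set es = edges_in \<alpha> \<theta>"
    and ep: "\<And>k. k < length vs \<Longrightarrow> endpoints (es ! k) = {vs ! k, vs ! (Suc k mod length vs)}"
    using cyc unfolding is_cycle_def by blast
  obtain k where k: "k < length vs" "vs ! k = x" using x sets by (metis in_set_conv_nth)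
  define p where "p = (if k = 0 then length vs - 1 else k - 1)"
  have p: "p < length vs" "Suc p mod length vs = k" "p \<noteq> k"
    using k len unfolding p_def by (auto split: if_splits)
  have edge: "es ! i \<in> interface_edges \<alpha>" if "i < length vs" for i
    using that len sets nth_mem[of i es] unfolding edges_in_def by auto
  obtain c1 where c1: "side c1" "es ! k = {c1 x, c1 (mate c1 \<alpha> x)}" "mate c1 \<alpha> x \<noteq> x"
    using edge_at[OF dj edge[OF k(1)], of x] ep[OF k(1)] k by auto
  obtain c2 where c2: "side c2" "es ! p = {c2 x, c2 (mate c2 \<alpha> x)}" "mate c2 \<alpha> x \<noteq> x"
    using edge_at[OF dj edge[OF p(1)], of x] ep[OF p(1)] p k by auto
  have "es ! k \<noteq> es ! p" using dist k p len by (simp add: nth_eq_iff_index_eq)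
  then have "c1 \<noteq> c2" using c1 c2 by auto
  then have "c = c1 \<or> c = c2" using c c1(1) c2(1) by auto
  then show ?thesis using c1 c2 by auto
qed

text \<open>The walk from \<open>a\<close> up to its first return lists the vertices in cyclic
  order, and its steps are the edges, alternately lower and upper.\<close>

lemma is_cycleI:
  assumes dj: "disjoint \<alpha>" and sub: "\<Union>\<alpha> \<subseteq> vertices n" and a: "a \<in> {1..n}"
    and free: "\<And>x c. x \<in> conn \<alpha> `` {a} \<Longrightarrow> side c \<Longrightarrow> mate c \<alpha> x \<noteq> x"
  shows "is_cycle \<alpha> (conn \<alpha> `` {a})"
proof -
  let ?\<theta> = "conn \<alpha> `` {a}" and ?u = "mate Upper \<alpha>" and ?l = "mate Lower \<alpha>"
  have "?\<theta> \<subseteq> {1..n}"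
    using conn_least[OF dj _ range_closed_under_mates[OF dj sub] a] by blast
  then have fin: "finite ?\<theta>" by (rule finite_subset) simp
  have inv: "?u (?u x) = x" "?l (?l x) = x" for x
    using mate_mate[OF dj] by auto
  have a\<theta>: "a \<in> ?\<theta>" by (simp add: conn_refl)
  obtain m where m: "m \<ge> 2" "even m" "walk ?u ?l a m = a" "inj_on (walk ?u ?l a) {..<m}"
    "closed_under_mates \<alpha> (walk ?u ?l a ` {..<m})"
    using walk_cycle[of ?u ?l, OF inv fin conn_closed[OF dj] a\<theta>] free by auto
  define w where "w = walk ?u ?l a"
  have w0: "w 0 = a" by (simp add: w_def)
  have wm: "w m = a" using m by (simp add: w_def)
  have step: "w (Suc k) = (if even k then ?l (w k) else ?u (w k))" for k
    by (simp add: w_def walk.simps)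
  have w\<theta>: "w k \<in> ?\<theta>" for k
    using walk_in[OF conn_closed[OF dj] a\<theta>] by (simp add: w_def)
  have inj: "w i = w j \<Longrightarrow> i < m \<Longrightarrow> j < m \<Longrightarrow> i = j" for i j
    using m(4) by (auto simp: inj_on_def w_def)
  have W: "w ` {..<m} = ?\<theta>"
  proof
    have "a \<in> w ` {..<m}" using w0 m(1) by (intro image_eqI[of _ _ 0]) auto
    then show "?\<theta> \<subseteq> w ` {..<m}"
      using conn_least[OF dj _ m(5)] unfolding w_def by blast
  qed (use w\<theta> in auto)
  define edge where "edge k = (if even k then {Lower (w k), Lower (w (Suc k))} else {Upper (w k),
      Upper (w (Suc k))})" for k
  have edge: "edge k \<in> interface_edges \<alpha>" for k
    using mate_edge[OF dj, of Upper "w k"] mate_edge[OF dj, of Lower "w k"] free[OF w\<theta>[of k]] step[of k]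
    by (auto simp: edge_def)
  have ep: "endpoints (edge k) = {w k, w (Suc k)}" for k by (auto simp: edge_def)
  have suc: "w (Suc k) = w (Suc k mod m)" if "k < m" for k
    using that w0 wm by (cases "Suc k = m") auto
  \<comment> \<open>Equal edges lie on the same side, so \<open>i\<close> and \<open>j\<close> have
    the same parity. Traversal in opposite directions would mean \<open>i = Suc j mod m\<close>,
    which contradicts this as \<open>m\<close> is even. For \<open>m = 2\<close> the sides keep the
    two parallel edges apart.\<close>
  have edge_inj: "i = j" if "i < m" "j < m" "edge i = edge j" for i j
  proof -
    have par: "even i \<longleftrightarrow> even j" using that(3) by (auto simp: edge_def doubleton_eq_iff split: if_splits)
    have "w i = w j \<or> w i = w (Suc j)"
        using that(3) par by (auto simp: edge_def doubleton_eq_iff split: if_splits)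
    moreover have "w i \<noteq> w (Suc j)"
    proof
      assume "w i = w (Suc j)"
      then have "i = Suc j mod m" using suc[OF that(2)] inj[OF _ that(1), of "Suc j mod m"] m(1) by simp
      then show False using par m(2) that(2) by (cases "Suc j = m") auto
    qed
    ultimately show ?thesis using inj that by blast
  qed
  have "edges_in \<alpha> ?\<theta> \<subseteq> edge ` {..<m}"
  proof
    fix e assume "e \<in> edges_in \<alpha> ?\<theta>"
    then have e: "e \<in> interface_edges \<alpha>" "endpoints e \<subseteq> ?\<theta>" by (auto simp: edges_in_def)
    obtain x where x: "x \<in> endpoints e" using e(1) by (elim interface_edgesE) auto
    obtain c where c: "side c" "e = {c x, c (mate c \<alpha> x)}"
      using edge_at[OF dj e(1) x] by blast
    obtain k where k: "k < m" "x = w k" using x e(2) W by auto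
    define p where "p = (if k = 0 then m - 1 else k - 1)"
    have p: "p < m" "even p \<longleftrightarrow> odd k" "w (Suc p) = w k"
      using k m(1,2) w0 wm unfolding p_def by auto
    have "e = edge k \<or> e = edge p"
      using c(1)
    proof (elim insertE emptyE)
      assume "c = Upper"
      then show ?thesis
        using c(2) k step[of k] step[of p] p inv(1)[of "w p"] by (cases "even k")
            (auto simp: edge_def insert_commute)
    next
      assume "c = Lower"
      then show ?thesis
        using c(2) k step[of k] step[of p] p inv(2)[of "w p"] by (cases "even k")
            (auto simp: edge_def insert_commute)
    qed
    then show "e \<in> edge ` {..<m}" using k p by auto
  qed
  moreover have "edge ` {..<m} \<subseteq> edges_in \<alpha> ?\<theta>"
    using edge ep w\<theta> unfolding edges_in_def by auto
  ultimately have E: "edge ` {..<m} = edges_in \<alpha> ?\<theta>" by blast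
  show ?thesis
    unfolding is_cycle_def
  proof (intro exI[of _ "map w [0..<m]"] exI[of _ "map edge [0..<m]"] conjI allI impI)
    show "distinct (map w [0..<m])" "distinct (map edge [0..<m])"
      using inj edge_inj by (auto simp: distinct_map inj_on_def)
    show "set (map w [0..<m]) = ?\<theta>" "set (map edge [0..<m]) = edges_in \<alpha> ?\<theta>"
      using W E by (simp_all add: atLeast0LessThan)
    fix k assume "k < length (map w [0..<m])"
    then show "endpoints (map edge [0..<m] ! k) = {map w [0..<m] ! k, map w [0..<m] ! (Suc k mod
        length (map w [0..<m]))}"
      using ep[of k] suc[of k] m(1) by simp
  qed (use m(1) in auto)
qed

section \<open>Parity counts in place of the Jordan curve theorem\<close>

definition nested :: "(nat \<Rightarrow> nat) \<Rightarrow> bool" where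
  "nested f \<longleftrightarrow> (\<forall>x z. x < z \<longrightarrow> z < f x \<longrightarrow> x < f z \<and> f z < f x)"

text \<open>\<open>nested\<close> tolerates fixed points beneath an arc, since singleton blocks may
  lie there. Being \<open>exposed\<close> is the additional condition on vertices from which a
  transversal can start.\<close>

definition exposed :: "(nat \<Rightarrow> nat) \<Rightarrow> nat \<Rightarrow> bool" where
  "exposed f p \<longleftrightarrow> \<not> (\<exists>x. x < p \<and> p < f x)"

text \<open>The points of \<open>P\<close> strictly between the ends of an arc are permuted by
  \<open>f\<close>, and none of them is fixed because fixed points in \<open>P\<close> are exposed;
  so their number is even. The ends of the arc themselves are not in \<open>P\<close>.\<close>

lemma parity_across_arc:
  assumes inv: "\<And>x. f (f x) = x" and "nested f"
    and P: "finite P" "\<And>y. y \<in> P \<Longrightarrow> f y \<in> P" "\<And>y. y \<in> P \<Longrightarrow> f y = y \<Longrightarrow> exposed f y"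
    and "x \<notin> P"
  shows "even (card {y \<in> P. y < x}) \<longleftrightarrow> even (card {y \<in> P. y < f x})"
proof -
  have *: "even (card {y \<in> P. y < x}) \<longleftrightarrow> even (card {y \<in> P. y < f x})" if "x \<notin> P" "x < f x" for x
  proof -
    let ?B = "{y \<in> P. x < y \<and> y < f x}"
    have "even (card ?B) \<longleftrightarrow> even (card {y \<in> ?B. f y = y})"
      using P \<open>nested f\<close> inv by (intro involution_parity) (auto simp: nested_def)
    moreover have "{y \<in> ?B. f y = y} = {}" using P(3) by (auto simp: exposed_def)
    ultimately have "even (card ?B)" by (metis card.empty even_zero)
    moreover have "{y \<in> P. y < f x} = {y \<in> P. y < x} \<union> ?B"
      using that by (auto simp: not_less le_less)
    then have "card {y \<in> P. y < f x} = card {y \<in> P. y < x} + card ?B"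
      using P(1) by (simp add: card_Un_disjoint disjoint_iff)
    ultimately show ?thesis by simp
  qed
  have "f x \<notin> P" using assms(6) P(2)[of "f x"] inv by auto
  then show ?thesis
    using *[of x] *[of "f x"] assms(6) inv[of x] by (cases x "f x" rule: linorder_cases) auto
qed

text \<open>No arc passes over \<open>x\<close>, so \<open>f\<close> permutes the points of
  \<open>P\<close> to the left of \<open>x\<close>, and the only one of them that can be fixed is
  \<open>p\<close>.\<close>

lemma parity_at_exposed:
  assumes inv: "\<And>x. f (f x) = x"
    and P: "finite P" "\<And>y. y \<in> P \<Longrightarrow> f y \<in> P" "{y \<in> P. f y = y} = {p}"
    and x: "x \<notin> P" "exposed f x"
  shows "even (card {y \<in> P. y < x}) \<longleftrightarrow> \<not> p < x"
proof -
  let ?A = "{y \<in> P. y < x}"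
  have "f y \<in> ?A" if "y \<in> ?A" for y
  proof -
    have "f y \<in> P" "f y \<noteq> x" using that P(2)[of y] x(1) by auto
    moreover have "\<not> x < f y" using that x(2) by (auto simp: exposed_def)
    ultimately show ?thesis by simp
  qed
  then have "even (card ?A) \<longleftrightarrow> even (card {y \<in> ?A. f y = y})"
    using P inv by (intro involution_parity) auto
  moreover have "{y \<in> ?A. f y = y} = {y \<in> P. f y = y} \<inter> {..<x}" by auto
  then have "{y \<in> ?A. f y = y} = (if p < x then {p} else {})" using P(3) by auto
  ultimately show ?thesis by (simp split: if_splits)
qed

text \<open>A path from an exposed upper end \<open>p\<close> to an exposed lower end \<open>q\<close> separates the rectangle
  into a left and a right part; the side of a vertex is the parity of the number of path vertices
  to its left.\<close>

lemma paths_do_not_cross: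
  assumes dj: "disjoint \<alpha>" and nest: "\<And>c. side c \<Longrightarrow> nested (mate c \<alpha>)"
    and P: "finite P" "closed_under_mates \<alpha> P"
    and p: "{y \<in> P. mate Upper \<alpha> y = y} = {p}" "exposed (mate Upper \<alpha>) p"
    and q: "{y \<in> P. mate Lower \<alpha> y = y} = {q}" "exposed (mate Lower \<alpha>) q"
    and st: "(s, t) \<in> conn \<alpha>" "s \<notin> P" "t \<notin> P" "exposed (mate Upper \<alpha>) s" "exposed (mate Lower \<alpha>) t"
  shows "p < s \<longleftrightarrow> q < t"
proof -
  define N where "N x = card {y \<in> P. y < x}" for x
  \<comment> \<open>The vertices off the path that lie on the same side of it as \<open>s\<close>.
    The set is closed under both mates and hence contains \<open>t\<close>. The parity is then
    evaluated at \<open>s\<close> with the upper arcs and at \<open>t\<close> with the lower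
    arcs.\<close>
  define B where "B = {x. x \<notin> P \<and> (even (N x) \<longleftrightarrow> even (N s))}"
  have inv: "mate c \<alpha> (mate c \<alpha> x) = x" if "side c" for c x
    using mate_mate[OF dj that] .
  have cl: "mate c \<alpha> y \<in> P" if "side c" "y \<in> P" for c y
    using that P(2) unfolding mate_closed_def by auto
  have fx: "exposed (mate c \<alpha>) y" if "side c" "y \<in> P" "mate c \<alpha> y = y" for c y
    using that p q by auto
  have "mate c \<alpha> x \<in> B" if "side c" "x \<in> B" for c x
  proof -
    have "x \<notin> P" using that by (simp add: B_def)
    then have "mate c \<alpha> x \<notin> P" using cl[OF that(1), of "mate c \<alpha> x"] inv[OF that(1)] by auto
    moreover have "even (N x) \<longleftrightarrow> even (N (mate c \<alpha> x))"
      unfolding N_def using inv[OF that(1)] nest[OF that(1)] P(1) cl[OF that(1)] fx[OF that(1)] \<open>x \<notin> P\<close>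
      by (intro parity_across_arc) auto
    ultimately show ?thesis using that(2) by (simp add: B_def)
  qed
  then have "closed_under_mates \<alpha> B" unfolding mate_closed_def by blast
  moreover have "s \<in> B" using st(2) by (simp add: B_def)
  ultimately have "t \<in> B" by (rule conn_least[OF dj st(1)])
  then have "even (N t) \<longleftrightarrow> even (N s)" by (simp add: B_def)
  moreover have "even (N s) \<longleftrightarrow> \<not> p < s"
    unfolding N_def using inv[of Upper] P(1) cl[of Upper] p(1) st by (intro parity_at_exposed) auto
  moreover have "even (N t) \<longleftrightarrow> \<not> q < t"
    unfolding N_def using inv[of Lower] P(1) cl[of Lower] q(1) st by (intro parity_at_exposed) auto
  ultimately show ?thesis by blast
qed

lemma noncrossing_arcs:
  assumes "noncrossing \<alpha>" "side c" "{c a, c b} \<in> \<alpha>" "{c d, c e} \<in> \<alpha>" "a < d" "d < b"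
  shows "\<not> b < e"
  using assms unfolding noncrossing_def by blast

lemma noncrossing_ends:
  assumes "noncrossing \<alpha>" "side c" "{c a, c b} \<in> \<alpha>" "x \<in> ends c \<alpha>" "a < x"
  shows "\<not> x < b"
  using assms unfolding noncrossing_def by blast

lemma noncrossing_transversals:
  assumes "noncrossing \<alpha>" "{Upper x, Lower y} \<in> \<alpha>" "{Upper x', Lower y'} \<in> \<alpha>" "x < x'"
  shows "y < y'"
  using assms unfolding noncrossing_def by blast

lemma nested_mate:
  assumes dj: "disjoint \<alpha>" and nc: "noncrossing \<alpha>" and c: "side c"
  shows "nested (mate c \<alpha>)"
  unfolding nested_def
proof (intro allI impI)
  fix x z assume xz: "x < z" "z < mate c \<alpha> x"
  let ?y = "mate c \<alpha> x" and ?w = "mate c \<alpha> z"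
  have inv: "mate c \<alpha> (mate c \<alpha> v) = v" for v using mate_mate[OF dj c] .
  have xy: "{c x, c ?y} \<in> \<alpha>" using mate_block[OF dj c, of x] xz by auto
  show "x < ?w \<and> ?w < ?y"
  proof (cases "?w = z")
    case False
    then have zw: "{c z, c ?w} \<in> \<alpha>" "{c ?w, c z} \<in> \<alpha>"
      using mate_block[OF dj c, of z] by (auto simp: insert_commute)
    have "?w \<noteq> ?y" "?w \<noteq> x" using inv[of z] inv[of x] xz by auto
    moreover have "\<not> ?y < ?w" using noncrossing_arcs[OF nc c xy zw(1)] xz by blast
    moreover have "\<not> ?w < x" using noncrossing_arcs[OF nc c zw(2) xy] xz by blast
    ultimately show ?thesis by linarith
  qed (use xz in simp)
qed

lemma exposed_ends:
  assumes dj: "disjoint \<alpha>" and nc: "noncrossing \<alpha>" and c: "side c" and "p \<in> ends c \<alpha>"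
  shows "exposed (mate c \<alpha>) p"
  unfolding exposed_def
proof
  assume "\<exists>x<p. p < mate c \<alpha> x"
  then obtain x where x: "x < p" "p < mate c \<alpha> x" by blast
  then have "{c x, c (mate c \<alpha> x)} \<in> \<alpha>" using mate_block[OF dj c, of x] by auto
  then show False using noncrossing_ends[OF nc c _ assms(4)] x by blast
qed

text \<open>Ranks are counted from 0: the paired elements are numbers \<open>2t - 1\<close> and \<open>2t\<close> in the numbering of
  \<^const>\<open>trans_upper\<close>.\<close>

definition rk :: "nat set \<Rightarrow> nat \<Rightarrow> nat" where
  "rk J x = card {y \<in> J. y < x}"

definition paired :: "nat set \<Rightarrow> nat \<Rightarrow> nat \<Rightarrow> bool" where
  "paired J x y \<longleftrightarrow> x \<in> J \<and> y \<in> J \<and> x < y \<and> even (rk J x) \<and> rk J y = Suc (rk J x)"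

lemma rk_less:
  assumes "finite J" "x \<in> J" "x < y"
  shows "rk J x < rk J y"
  unfolding rk_def using assms by (intro psubset_card_mono) auto

lemma rk_inj:
  assumes "finite J" "x \<in> J" "y \<in> J" "rk J x = rk J y"
  shows "x = y"
  using assms rk_less by (metis linorder_neqE_nat less_irrefl)

lemma rk_less_iff:
  assumes "finite J" "x \<in> J" "y \<in> J"
  shows "rk J x < rk J y \<longleftrightarrow> x < y"
  using assms rk_less rk_inj by (metis linorder_neqE_nat less_asym less_irrefl)

lemma rk_less_card:
  assumes "finite J" "x \<in> J"
  shows "rk J x < card J"
  unfolding rk_def using assms by (intro psubset_card_mono) auto

lemma rk_nth:
  assumes "finite J" "k < card J"
  shows "sorted_list_of_set J ! k \<in> J" "rk J (sorted_list_of_set J ! k) = k"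
proof -
  let ?js = "sorted_list_of_set J"
  have js: "set ?js = J" "length ?js = card J" "sorted_wrt (<) ?js"
    using assms(1) by (auto simp: strict_sorted_list_of_set)
  show "?js ! k \<in> J" using js assms(2) by (metis nth_mem)
  have lt: "?js ! i < ?js ! j \<longleftrightarrow> i < j" if "i < card J" "j < card J" for i j
    using that js sorted_wrt_nth_less[OF js(3)] by (metis less_asym less_irrefl linorder_neqE_nat)
  have "{y \<in> J. y < ?js ! k} = (\<lambda>i. ?js ! i) ` {..<k}"
  proof (intro equalityI subsetI)
    fix y assume "y \<in> {y \<in> J. y < ?js ! k}"
    then have y: "y \<in> set ?js" "y < ?js ! k" using js(1) by auto
    then obtain i where "i < card J" "?js ! i = y" using js(2) by (metis in_set_conv_nth)
    then show "y \<in> (\<lambda>i. ?js ! i) ` {..<k}" using lt[of i k] assms(2) y(2) by auto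
  next
    fix y assume "y \<in> (\<lambda>i. ?js ! i) ` {..<k}"
    then obtain i where "i < k" "y = ?js ! i" by auto
    then show "y \<in> {y \<in> J. y < ?js ! k}" using lt[of i k] assms(2) js nth_mem[of i ?js] by auto
  qed
  moreover have "inj_on (\<lambda>i. ?js ! i) {..<k}"
    using lt assms(2) by (intro linorder_inj_onI) (auto simp: less_imp_neq)
  ultimately show "rk J (?js ! k) = k" unfolding rk_def by (simp add: card_image)
qed

lemma nth_rk:
  assumes "finite J" "x \<in> J"
  shows "sorted_list_of_set J ! rk J x = x"
  using rk_nth[OF assms(1) rk_less_card[OF assms]] rk_inj[OF assms(1) _ assms(2)] by blast

lemma paired_right_unique:
  assumes "finite J" "paired J x y" "paired J x z"
  shows "y = z"
  using assms rk_inj[of J y z] by (auto simp: paired_def)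

lemma paired_left_unique:
  assumes "finite J" "paired J x z" "paired J y z"
  shows "x = y"
  using assms rk_inj[of J x y] by (auto simp: paired_def)

lemma paired_not_both: "paired J x y \<Longrightarrow> \<not> paired J y z"
  by (auto simp: paired_def)

lemma paired_consecutive:
  assumes "finite J" "paired J x y" "z \<in> J" "x < z"
  shows "y \<le> z"
proof -
  have "rk J x < rk J z" using assms rk_less by (auto simp: paired_def)
  then have "\<not> rk J z < rk J y" using assms(2) by (auto simp: paired_def)
  then show ?thesis using rk_less[OF assms(1,3), of y] by (meson not_le)
qed

text \<open>An element of odd rank is always paired with its predecessor, and one of even rank with
  its successor if there is one. Only a last element can be left over.\<close>

lemma unpaired_greatest:
  assumes J: "finite J" and z: "z \<in> J" "\<And>y. \<not> paired J z y" "\<And>y. \<not> paired J y z" and w: "w \<in> J"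
  shows "w \<le> z"
proof (rule ccontr)
  assume "\<not> w \<le> z"
  then have "rk J z < rk J w" using rk_less[OF J z(1)] by simp
  then have lt: "Suc (rk J z) < card J" using rk_less_card[OF J w] by simp
  show False
  proof (cases "even (rk J z)")
    case True
    have "paired J z (sorted_list_of_set J ! Suc (rk J z))"
      using rk_nth[OF J lt] rk_less_iff[OF J z(1) rk_nth(1)[OF J lt]] z(1) True by (auto simp: paired_def)
    then show False using z(2) by blast
  next
    case False
    then obtain k where k: "rk J z = Suc k" "even k" by (cases "rk J z") auto
    then have "k < card J" using lt by simp
    then have "paired J (sorted_list_of_set J ! k) z"
      using rk_nth[OF J, of k] rk_less_iff[OF J rk_nth(1)[OF J] z(1), of k] z(1)
          k by (auto simp: paired_def)
    then show False using z(3) by blast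
  qed
qed

lemma rk_strict_mono_image:
  assumes "finite J" and mono: "\<And>x y. x \<in> J \<Longrightarrow> y \<in> J \<Longrightarrow> x < y \<Longrightarrow> t x < t y" and "x \<in> J"
  shows "rk (t ` J) (t x) = rk J x"
proof -
  have lt: "t y < t x \<longleftrightarrow> y < x" if "y \<in> J" for y
    using mono[OF that \<open>x \<in> J\<close>] mono[OF \<open>x \<in> J\<close> that] by (metis less_asym linorder_neqE_nat)
  have "{y \<in> t ` J. y < t x} = t ` {y \<in> J. y < x}" using lt by auto
  moreover have "inj_on t J" using mono by (intro linorder_inj_onI) (auto simp: less_imp_neq)
  then have "inj_on t {y \<in> J. y < x}" by (rule inj_on_subset) auto
  ultimately show ?thesis unfolding rk_def by (simp add: card_image)
qed

lemma paired_strict_mono_image: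
  assumes "finite J" and mono: "\<And>x y. x \<in> J \<Longrightarrow> y \<in> J \<Longrightarrow> x < y \<Longrightarrow> t x < t y" and "x \<in> J" "y \<in> J"
  shows "paired (t ` J) (t x) (t y) \<longleftrightarrow> paired J x y"
proof -
  have "t x < t y \<longleftrightarrow> x < y"
    using mono assms(3,4) by (metis less_asym linorder_neqE_nat)
  moreover have "rk (t ` J) (t x) = rk J x" "rk (t ` J) (t y) = rk J y"
    using rk_strict_mono_image[of J t, OF assms(1) mono] assms(3,4) by auto
  ultimately show ?thesis
    unfolding paired_def using assms(3,4) by auto
qed

lemma finite_ends:
  assumes "motzkin_diagram n \<alpha>" "side c"
  shows "finite (ends c \<alpha>)"
proof (rule finite_subset)
  show "ends c \<alpha> \<subseteq> {1..n}" using ends_in[OF assms(1) _ assms(2)] by (rule subsetI)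
qed simp

definition lower_end :: "diagram \<Rightarrow> nat \<Rightarrow> nat" where
  "lower_end \<alpha> x = (THE y. {Upper x, Lower y} \<in> \<alpha>)"

lemma lower_end_eq:
  assumes "disjoint \<alpha>" "{Upper x, Lower y} \<in> \<alpha>"
  shows "lower_end \<alpha> x = y"
  unfolding lower_end_def using assms(2)
proof (rule the_equality)
  fix z assume "{Upper x, Lower z} \<in> \<alpha>"
  then show "z = y" using transversal_unique[OF assms] by auto
qed

lemma lower_end_block:
  assumes "motzkin_diagram n \<alpha>" "x \<in> ends Upper \<alpha>"
  shows "{Upper x, Lower (lower_end \<alpha> x)} \<in> \<alpha>"
  using assms ends_Upper[OF assms(1)] lower_end_eq[OF motzkin_disjoint[OF assms(1)]] by metis

lemma ends_Lower_image:
  assumes "motzkin_diagram n \<alpha>"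
  shows "ends Lower \<alpha> = lower_end \<alpha> ` ends Upper \<alpha>"
proof (intro equalityI subsetI)
  fix y assume "y \<in> ends Lower \<alpha>"
  then obtain x where "{Upper x, Lower y} \<in> \<alpha>" using ends_Lower[OF assms] by blast
  then show "y \<in> lower_end \<alpha> ` ends Upper \<alpha>"
    using lower_end_eq[OF motzkin_disjoint[OF assms]] ends_Upper[OF assms] by blast
next
  fix y assume "y \<in> lower_end \<alpha> ` ends Upper \<alpha>"
  then show "y \<in> ends Lower \<alpha>"
    using lower_end_block[OF assms] ends_Lower[OF assms] by blast
qed

lemma lower_end_mono:
  assumes "motzkin_diagram n \<alpha>" "x \<in> ends Upper \<alpha>" "y \<in> ends Upper \<alpha>" "x < y"
  shows "lower_end \<alpha> x < lower_end \<alpha> y"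
proof -
  have "noncrossing \<alpha>" using assms(1) by (simp add: motzkin_diagram_def)
  then show ?thesis
    using lower_end_block[OF assms(1,2)] lower_end_block[OF assms(1,3)] assms(4)
    by (rule noncrossing_transversals)
qed

text \<open>Transversals do not cross, so \<open>lower_end\<close> preserves positions. The lower
  ends may therefore be paired on their own, without reference to the upper ones.\<close>

lemma paired_lower_end:
  assumes "motzkin_diagram n \<alpha>" "x \<in> ends Upper \<alpha>" "y \<in> ends Upper \<alpha>"
  shows "paired (ends Lower \<alpha>) (lower_end \<alpha> x) (lower_end \<alpha> y) \<longleftrightarrow> paired (ends Upper \<alpha>) x y"
  unfolding ends_Lower_image[OF assms(1)]
  using finite_ends[OF assms(1), of Upper] lower_end_mono[OF assms(1)] assms(2,3)
  by (intro paired_strict_mono_image) auto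

lemma paired_LowerE:
  assumes "motzkin_diagram n \<alpha>" "paired (ends Lower \<alpha>) a b"
  obtains x y where "paired (ends Upper \<alpha>) x y" "a = lower_end \<alpha> x" "b = lower_end \<alpha> y"
proof -
  have "a \<in> ends Lower \<alpha>" "b \<in> ends Lower \<alpha>" using assms(2) by (auto simp: paired_def)
  then obtain x y where "x \<in> ends Upper \<alpha>" "a = lower_end \<alpha> x" "y \<in> ends Upper \<alpha>" "b = lower_end \<alpha> y"
    unfolding ends_Lower_image[OF assms(1)] by blast
  then show ?thesis using that assms paired_lower_end[OF assms(1)] by blast
qed

lemma diagram_rank_eq:
  assumes "motzkin_diagram n \<alpha>"
  shows "diagram_rank \<alpha> = card (ends Upper \<alpha>)"
proof -
  have "{B \<in> \<alpha>. transversal B} = (\<lambda>x. {Upper x, Lower (lower_end \<alpha> x)}) ` ends Upper \<alpha>"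
  proof (intro equalityI subsetI)
    fix B assume "B \<in> {B \<in> \<alpha>. transversal B}"
    then have B: "B \<in> \<alpha>" "transversal B" by auto
    then obtain x y where "B = {Upper x, Lower y}" using motzkin_transversal[OF assms] by blast
    then show "B \<in> (\<lambda>x. {Upper x, Lower (lower_end \<alpha> x)}) ` ends Upper \<alpha>"
      using B lower_end_eq[OF motzkin_disjoint[OF assms], of x y] ends_Upper[OF assms, of x] by auto
  qed (use lower_end_block[OF assms] in auto)
  moreover have "inj_on (\<lambda>x. {Upper x, Lower (lower_end \<alpha> x)}) (ends Upper \<alpha>)"
    by (auto simp: inj_on_def doubleton_eq_iff)
  ultimately show ?thesis unfolding diagram_rank_def by (simp add: card_image)
qed

section \<open>The hat map in terms of positions on each side\<close>

definition removed :: "diagram \<Rightarrow> diagram" where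
  "removed \<alpha> = {{Upper x, Lower y} | x y. {Upper x, Lower y} \<in> \<alpha> \<and>
     (\<exists>z. paired (ends Upper \<alpha>) x z \<or> paired (ends Upper \<alpha>) z x)}"

definition new_arcs :: "diagram \<Rightarrow> diagram" where
  "new_arcs \<alpha> = {{c x, c y} | c x y. side c \<and> paired (ends c \<alpha>) x y}"

text \<open>The indexed definition pairs transversals, listed by upper ends. Pairing the ends of
  each side separately treats both sides alike, so later arguments can be carried out for a generic
  side \<open>c\<close>.\<close>

lemma hat_eq:
  assumes \<alpha>: "motzkin_diagram n \<alpha>"
  shows "hat \<alpha> = (\<alpha> - removed \<alpha>) \<union> new_arcs \<alpha>"
proof -
  define J where "J = ends Upper \<alpha>"
  have fin: "finite J" using finite_ends[OF \<alpha>] by (simp add: J_def)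
  have J: "{j. \<exists>i. {Upper j, Lower i} \<in> \<alpha>} = J" using ends_Upper[OF \<alpha>] by (auto simp: J_def)
  define j where "j = trans_upper \<alpha>"
  define i where "i = trans_lower \<alpha>"
  define T where "T = {1..diagram_rank \<alpha> div 2}"
  have r: "diagram_rank \<alpha> = card J" using diagram_rank_eq[OF \<alpha>] by (simp add: J_def)
  have j: "j t = sorted_list_of_set J ! (t - 1)" for t by (simp add: j_def trans_upper_def J)
  have i: "i t = lower_end \<alpha> (j t)" for t by (simp add: i_def j_def trans_lower_def lower_end_def)
  have pj: "paired J (j (2 * t - 1)) (j (2 * t))" if "t \<in> T" for t
  proof -
    have lt: "2 * t - 2 < card J" "2 * t - 1 < card J" and t: "t \<ge> 1" using that by (auto simp: T_def r)
    have "j (2 * t - 1) = sorted_list_of_set J ! (2 * t - 2)" by (simp add: j numeral_2_eq_2)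
    moreover have "2 * t - Suc 0 = Suc (2 * t - 2)" using t by simp
    ultimately show ?thesis
      using rk_nth[OF fin lt(1)] rk_nth[OF fin lt(2)] t rk_less_iff[OF fin, of "j (2 * t - 1)" "j (2 * t)"]
      by (auto simp: paired_def j)
  qed
  have jp: "\<exists>t\<in>T. x = j (2 * t - 1) \<and> y = j (2 * t)" if "paired J x y" for x y
  proof -
    have "even (rk J x)" using that by (simp add: paired_def)
    then obtain k where k: "rk J x = 2 * k" by (elim evenE)
    have "x \<in> J" "y \<in> J" "rk J y = 2 * k + 1" using that k by (auto simp: paired_def)
    then have "x = sorted_list_of_set J ! (2 * k)" "y = sorted_list_of_set J ! (2 * k + 1)"
        "2 * k + 1 < card J"
      using nth_rk[OF fin] k rk_less_card[OF fin, of y] by metis+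
    \<comment> \<open>Ranks start at 0 and the index \<open>t\<close> at 1, so the pair with ranks
      \<open>2 * k\<close> and \<open>2 * k + 1\<close> has index \<open>Suc k\<close>.\<close>
    then show ?thesis by (intro bexI[of _ "Suc k"]) (auto simp: j T_def r)
  qed
  have rem: "removed \<alpha> = (\<Union>t\<in>T. {{Upper (j (2 * t - 1)), Lower (i (2 * t - 1))}, {Upper (j (2 * t)),
      Lower (i (2 * t))}})"
  proof (intro equalityI subsetI)
    fix B assume "B \<in> removed \<alpha>"
    then obtain x y z where B: "B = {Upper x, Lower y}" "B \<in> \<alpha>" and "paired J x z \<or> paired J z x"
      unfolding removed_def J_def by blast
    then obtain t where "t \<in> T" "x = j (2 * t - 1) \<or> x = j (2 * t)" using jp by blast
    moreover have "y = lower_end \<alpha> x" using B lower_end_eq[OF motzkin_disjoint[OF \<alpha>]] by blast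
    ultimately show "B \<in> (\<Union>t\<in>T. {{Upper (j (2 * t - 1)), Lower (i (2 * t - 1))}, {Upper (j (2 * t)),
        Lower (i (2 * t))}})"
      using B(1) i by auto
  next
    fix B assume "B \<in> (\<Union>t\<in>T. {{Upper (j (2 * t - 1)), Lower (i (2 * t - 1))}, {Upper (j (2 * t)),
        Lower (i (2 * t))}})"
    then obtain t x where t: "t \<in> T" "x = j (2 * t - 1) \<or> x = j (2 * t)"
        "B = {Upper x, Lower (lower_end \<alpha> x)}"
      using i by auto
    have "paired J x (j (2 * t)) \<or> paired J (j (2 * t - 1)) x" using pj[OF t(1)] t(2) by blast
    moreover from this have "x \<in> J" by (auto simp: paired_def)
    then have "B \<in> \<alpha>" using lower_end_block[OF \<alpha>] t(3) by (simp add: J_def)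
    ultimately show "B \<in> removed \<alpha>" unfolding removed_def using t(3) J_def by blast
  qed
  have new: "new_arcs \<alpha> = (\<Union>t\<in>T. {{Upper (j (2 * t - 1)), Upper (j (2 * t))}, {Lower (i (2 * t -
      1)), Lower (i (2 * t))}})"
  proof (intro equalityI subsetI)
    fix B assume "B \<in> new_arcs \<alpha>"
    then obtain c x y where B: "B = {c x, c y}" "side c" "paired (ends c \<alpha>) x y"
      unfolding new_arcs_def by blast
    from B(2) show "B \<in> (\<Union>t\<in>T. {{Upper (j (2 * t - 1)), Upper (j (2 * t))}, {Lower (i (2 * t - 1)),
        Lower (i (2 * t))}})"
    proof (elim insertE emptyE)
      assume "c = Upper"
      then obtain t where "t \<in> T" "x = j (2 * t - 1)" "y = j (2 * t)" using B(3) jp by (auto simp: J_def)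
      then show ?thesis using B(1) \<open>c = Upper\<close> by auto
    next
      assume "c = Lower"
      then obtain x' y' where "paired J x' y'" "x = lower_end \<alpha> x'" "y = lower_end \<alpha> y'"
        using B(3) paired_LowerE[OF \<alpha>] unfolding J_def by blast
      moreover from this obtain t where "t \<in> T" "x' = j (2 * t - 1)" "y' = j (2 * t)" using jp by blast
      ultimately show ?thesis using B(1) \<open>c = Lower\<close> i by auto
    qed
  next
    fix B assume "B \<in> (\<Union>t\<in>T. {{Upper (j (2 * t - 1)), Upper (j (2 * t))}, {Lower (i (2 * t - 1)),
        Lower (i (2 * t))}})"
    then obtain t where t: "t \<in> T"
      "B = {Upper (j (2 * t - 1)), Upper (j (2 * t))}
          \<or> B = {Lower (i (2 * t - 1)), Lower (i (2 * t))}" by blast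
    have "paired (ends Upper \<alpha>) (j (2 * t - 1)) (j (2 * t))" using pj[OF t(1)] by (simp add: J_def)
    moreover from this have "paired (ends Lower \<alpha>) (i (2 * t - 1)) (i (2 * t))"
      unfolding i using paired_lower_end[OF \<alpha>] by (auto simp: paired_def)
    ultimately show "B \<in> new_arcs \<alpha>" unfolding new_arcs_def using t(2) by blast
  qed
  show ?thesis
    unfolding hat_def Let_def rem new i_def[symmetric] j_def[symmetric] T_def[symmetric] ..
qed

section \<open>The hat map\<close>

abbreviation is_paired :: "nat set \<Rightarrow> nat \<Rightarrow> bool" where
  "is_paired J x \<equiv> \<exists>z. paired J x z \<or> paired J z x"

lemma side_doubleton_eq_iff:
  assumes "side c" "side c'"
  shows "{c a, c b} = {c' x, c' y} \<longleftrightarrow> c = c' \<and> (a = x \<and> b = y \<or> a = y \<and> b = x)"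
proof -
  have "Upper \<noteq> Lower" by (metis vertex.distinct(1))
  then show ?thesis using assms by (auto simp: doubleton_eq_iff)
qed

lemma side_eq_side:
  assumes "side c" "side c'"
  shows "c x = c' y \<longleftrightarrow> c = c' \<and> x = y"
proof -
  have "Upper \<noteq> Lower" by (metis vertex.distinct(1))
  then show ?thesis using assms by auto
qed

text \<open>Serves both directions: the hat map replaces transversals by arcs, and a cut replaces
  arcs by transversals.\<close>

lemma partition_on_replace:
  assumes "partition_on V \<alpha>" "A \<subseteq> \<alpha>" "partition_on (\<Union>A) B"
  shows "partition_on V ((\<alpha> - A) \<union> B)"
proof -
  have dj: "C \<inter> D = {}" if "C \<in> \<alpha>" "D \<in> \<alpha>" "C \<noteq> D" for C D
    using disjointD[OF partition_onD2[OF assms(1)] that] .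
  have dB: "C \<inter> D = {}" if "C \<in> B" "D \<in> B" "C \<noteq> D" for C D
    using disjointD[OF partition_onD2[OF assms(3)] that] .
  have UB: "\<Union>B = \<Union>A" using partition_onD1[OF assms(3)] by simp
  have mix: "C \<inter> D = {}" if "C \<in> \<alpha> - A" "D \<in> B" for C D
  proof -
    have "C \<inter> E = {}" if "E \<in> A" for E using dj[of C E] \<open>C \<in> \<alpha> - A\<close> that assms(2) by blast
    then have "C \<inter> \<Union>A = {}" by blast
    then show ?thesis using that(2) UB by blast
  qed
  show ?thesis
  proof (rule partition_onI)
    have "\<Union>((\<alpha> - A) \<union> B) = \<Union>(\<alpha> - A) \<union> \<Union>A" using UB by blast
    also have "\<dots> = \<Union>\<alpha>" using assms(2) by blast
    finally show "\<Union>((\<alpha> - A) \<union> B) = V" using partition_onD1[OF assms(1)] by simp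
  next
    fix C D assume C: "C \<in> (\<alpha> - A) \<union> B" and D: "D \<in> (\<alpha> - A) \<union> B" and "C \<noteq> D"
    have "C \<inter> D = {}"
      using C
    proof
      assume "C \<in> \<alpha> - A"
      from D show ?thesis using \<open>C \<in> \<alpha> - A\<close> dj[of C D] mix[of C D] \<open>C \<noteq> D\<close> by (elim UnE) auto
    next
      assume "C \<in> B"
      from D show ?thesis using \<open>C \<in> B\<close> dB[of C D] mix[of D C] \<open>C \<noteq> D\<close> by (elim UnE) auto
    qed
    then show "disjnt C D" by (simp add: disjnt_def)
  next
    show "{} \<notin> (\<alpha> - A) \<union> B" using partition_onD3[OF assms(1)] partition_onD3[OF assms(3)] by blast
  qed
qed

lemma paired_share:
  assumes "finite J" "paired J x y" "paired J x' y'" "v \<in> {x, y}" "v \<in> {x', y'}"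
  shows "x = x' \<and> y = y'"
  using assms paired_right_unique[OF assms(1)] paired_left_unique[OF assms(1)] paired_not_both
  by (elim insertE emptyE) blast+

lemma is_paired_mem: "is_paired J x \<Longrightarrow> x \<in> J"
  by (auto simp: paired_def)

lemma is_paired_lower_end:
  assumes "motzkin_diagram n \<alpha>" "x \<in> ends Upper \<alpha>"
  shows "is_paired (ends Lower \<alpha>) (lower_end \<alpha> x) \<longleftrightarrow> is_paired (ends Upper \<alpha>) x"
proof
  assume "is_paired (ends Lower \<alpha>) (lower_end \<alpha> x)"
  then obtain z where z: "paired (ends Lower \<alpha>)
      (lower_end \<alpha> x) z \<or> paired (ends Lower \<alpha>) z (lower_end \<alpha> x)" by blast
  then have "z \<in> ends Lower \<alpha>" by (auto simp: paired_def)
  then obtain w where "w \<in> ends Upper \<alpha>" "z = lower_end \<alpha> w"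
    unfolding ends_Lower_image[OF assms(1)] by blast
  then show "is_paired (ends Upper \<alpha>) x"
    using z paired_lower_end[OF assms(1)] assms(2) by blast
next
  assume "is_paired (ends Upper \<alpha>) x"
  then obtain z where z: "paired (ends Upper \<alpha>) x z \<or> paired (ends Upper \<alpha>) z x" by blast
  then have "z \<in> ends Upper \<alpha>" by (auto simp: paired_def)
  then show "is_paired (ends Lower \<alpha>) (lower_end \<alpha> x)"
    using z paired_lower_end[OF assms(1)] assms(2) by blast
qed

lemma removed_block:
  assumes "motzkin_diagram n \<alpha>" "B \<in> removed \<alpha>"
  obtains x where "x \<in> ends Upper \<alpha>" "B = {Upper x, Lower (lower_end \<alpha> x)}" "B \<in> \<alpha>"
    "is_paired (ends Upper \<alpha>) x" "is_paired (ends Lower \<alpha>) (lower_end \<alpha> x)"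
proof -
  obtain x y where B: "B = {Upper x, Lower y}" "B \<in> \<alpha>" "is_paired (ends Upper \<alpha>) x"
    using assms(2) unfolding removed_def by blast
  have x: "x \<in> ends Upper \<alpha>" using is_paired_mem[OF B(3)] .
  have "y = lower_end \<alpha> x" using lower_end_eq[OF motzkin_disjoint[OF assms(1)]] B by blast
  then show ?thesis using that[OF x] B is_paired_lower_end[OF assms(1) x] by blast
qed

text \<open>The upper end of a transversal is paired iff its lower end is. Hence the ends covered by
  the new arcs on both sides are exactly those of the removed transversals.\<close>

lemma new_arcs_partition:
  assumes \<alpha>: "motzkin_diagram n \<alpha>"
  shows "partition_on (\<Union>(removed \<alpha>)) (new_arcs \<alpha>)"
proof (rule partition_onI)
  show "\<Union>(new_arcs \<alpha>) = \<Union>(removed \<alpha>)"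
  proof (intro equalityI subsetI)
    fix v assume "v \<in> \<Union>(new_arcs \<alpha>)"
    then obtain c x y where c: "side c" "paired (ends c \<alpha>) x y" "v \<in> {c x, c y}"
      unfolding new_arcs_def by blast
    then obtain z where z: "v = c z" "is_paired (ends c \<alpha>) z" by blast
    from c(1) show "v \<in> \<Union>(removed \<alpha>)"
    proof (elim insertE emptyE)
      assume "c = Upper"
      then have "z \<in> ends Upper \<alpha>" using is_paired_mem z by blast
      then have "{Upper z, Lower (lower_end \<alpha> z)} \<in> removed \<alpha>"
        unfolding removed_def using lower_end_block[OF \<alpha>] z \<open>c = Upper\<close> by blast
      then show ?thesis using z \<open>c = Upper\<close> by blast
    next
      assume "c = Lower"
      then have "z \<in> ends Lower \<alpha>" using is_paired_mem z by blast
      then obtain w where w: "w \<in> ends Upper \<alpha>" "z = lower_end \<alpha> w"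
        unfolding ends_Lower_image[OF \<alpha>] by blast
      then have "is_paired (ends Upper \<alpha>) w" using is_paired_lower_end[OF \<alpha>] z \<open>c = Lower\<close> by blast
      then have "{Upper w, Lower (lower_end \<alpha> w)} \<in> removed \<alpha>"
        unfolding removed_def using lower_end_block[OF \<alpha> w(1)] by blast
      then show ?thesis using w z \<open>c = Lower\<close> by blast
    qed
  next
    fix v assume "v \<in> \<Union>(removed \<alpha>)"
    then obtain B where B: "B \<in> removed \<alpha>" "v \<in> B" by blast
    then obtain x where x: "B = {Upper x, Lower (lower_end \<alpha> x)}"
      "is_paired (ends Upper \<alpha>) x" "is_paired (ends Lower \<alpha>) (lower_end \<alpha> x)"
      using removed_block[OF \<alpha>] by metis
    have new: "c z \<in> \<Union>(new_arcs \<alpha>)" if "side c" and pz: "is_paired (ends c \<alpha>) z" for c z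
    proof -
      obtain w where "paired (ends c \<alpha>) z w \<or> paired (ends c \<alpha>) w z" using pz by blast
      then have "{c z, c w} \<in> new_arcs \<alpha> \<or> {c w, c z} \<in> new_arcs \<alpha>"
        unfolding new_arcs_def using that(1) by blast
      then show ?thesis by blast
    qed
    show "v \<in> \<Union>(new_arcs \<alpha>)"
      using B(2) x new[of Upper x] new[of Lower "lower_end \<alpha> x"] by auto
  qed
next
  fix C D assume "C \<in> new_arcs \<alpha>" "D \<in> new_arcs \<alpha>" "C \<noteq> D"
  then obtain c x y d x' y' where C: "side c" "paired (ends c \<alpha>) x y" "C = {c x, c y}"
    and D: "side d" "paired (ends d \<alpha>) x' y'" "D = {d x', d y'}"
    unfolding new_arcs_def by blast
  show "disjnt C D"
  proof (rule ccontr)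
    assume "\<not> disjnt C D"
    then obtain v where v: "v \<in> C" "v \<in> D" by (auto simp: disjnt_def)
    obtain z where z: "z \<in> {x, y}" "v = c z" using v(1) C(3) by blast
    obtain z' where z': "z' \<in> {x', y'}" "v = d z'" using v(2) D(3) by blast
    have "c z = d z'" using z(2) z'(2) by simp
    then have cd: "c = d" "z = z'" using side_eq_side[OF C(1) D(1)] by blast+
    then have "x = x' \<and> y = y'"
      using paired_share[OF finite_ends[OF \<alpha> C(1)] C(2), of x' y' z] D z z' by blast
    then show False using C(3) D(3) cd \<open>C \<noteq> D\<close> by blast
  qed
next
  show "{} \<notin> new_arcs \<alpha>" unfolding new_arcs_def by blast
qed

lemma removed_subset: "removed \<alpha> \<subseteq> \<alpha>"
  unfolding removed_def by blast

lemma removed_transversal: "B \<in> removed \<alpha> \<Longrightarrow> transversal B"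
  unfolding removed_def by auto

lemma new_arcs_not_transversal: "B \<in> new_arcs \<alpha> \<Longrightarrow> \<not> transversal B"
  unfolding new_arcs_def by auto

lemma side_not_transversal: "side c \<Longrightarrow> \<not> transversal {c a, c b}"
  by auto

lemma hat_arc_iff:
  assumes "motzkin_diagram n \<alpha>" "side c"
  shows "{c a, c b} \<in> hat \<alpha> \<longleftrightarrow> {c a, c b} \<in> \<alpha> \<or> paired (ends c \<alpha>) a b \<or> paired (ends c \<alpha>) b a"
proof -
  have "{c a, c b} \<notin> removed \<alpha>" using removed_transversal side_not_transversal[OF assms(2)] by blast
  moreover have "{c a, c b} \<in> new_arcs \<alpha> \<longleftrightarrow> paired (ends c \<alpha>) a b \<or> paired (ends c \<alpha>) b a"
  proof
    assume "{c a, c b} \<in> new_arcs \<alpha>"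
    then obtain d x y where d: "side d" "paired (ends d \<alpha>) x y" "{c a, c b} = {d x, d y}"
      unfolding new_arcs_def by blast
    show "paired (ends c \<alpha>) a b \<or> paired (ends c \<alpha>) b a"
      using d(2) d(3)[unfolded side_doubleton_eq_iff[OF assms(2) d(1)]] by blast
  next
    assume "paired (ends c \<alpha>) a b \<or> paired (ends c \<alpha>) b a"
    then show "{c a, c b} \<in> new_arcs \<alpha>"
      unfolding new_arcs_def using assms(2) insert_commute[of "c a" "c b" "{}"] by blast
  qed
  ultimately show ?thesis unfolding hat_eq[OF assms(1)] by blast
qed

lemma hat_transversal_iff:
  assumes "motzkin_diagram n \<alpha>"
  shows "{Upper x, Lower y} \<in> hat \<alpha> \<longleftrightarrow> {Upper x, Lower y} \<in> \<alpha> \<and> \<not> is_paired (ends Upper \<alpha>) x"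
proof -
  have "{Upper x, Lower y} \<notin> new_arcs \<alpha>" using new_arcs_not_transversal transversal_simps(1) by blast
  moreover have "{Upper x, Lower y} \<in> removed \<alpha> \<longleftrightarrow> {Upper x, Lower y} \<in> \<alpha> \<and> is_paired (ends Upper \<alpha>) x"
  proof
    assume r: "{Upper x, Lower y} \<in> removed \<alpha>"
    then obtain x' where x': "x' \<in> ends Upper \<alpha>" "{Upper x, Lower y} = {Upper x', Lower (lower_end \<alpha> x')}"
      "{Upper x, Lower y} \<in> \<alpha>" "is_paired (ends Upper \<alpha>) x'"
      by (rule removed_block[OF assms])
    have "x = x'" using x'(2) by (simp add: doubleton_eq_iff)
    then show "{Upper x, Lower y} \<in> \<alpha> \<and> is_paired (ends Upper \<alpha>) x" using x'(3,4) by simp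
  next
    assume "{Upper x, Lower y} \<in> \<alpha> \<and> is_paired (ends Upper \<alpha>) x"
    then show "{Upper x, Lower y} \<in> removed \<alpha>"
      unfolding removed_def by blast
  qed
  ultimately show ?thesis unfolding hat_eq[OF assms] by blast
qed

lemma hat_block_card:
  assumes "motzkin_diagram n \<alpha>" "B \<in> hat \<alpha>"
  shows "B \<in> \<alpha> \<or> card B = 2"
proof -
  have "card B = 2" if "B \<in> new_arcs \<alpha>"
  proof -
    obtain c x y where B: "side c" "paired (ends c \<alpha>) x y" "B = {c x, c y}"
      using \<open>B \<in> new_arcs \<alpha>\<close> unfolding new_arcs_def by blast
    then have "c x \<noteq> c y" using side_eq_iff[OF B(1)] by (auto simp: paired_def)
    then show ?thesis using B(3) by simp
  qed
  then show ?thesis using assms(2) unfolding hat_eq[OF assms(1)] by blast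
qed

lemma ends_hat_subset:
  assumes \<alpha>: "motzkin_diagram n \<alpha>" and c: "side c" and x: "x \<in> ends c (hat \<alpha>)"
  shows "x \<in> ends c \<alpha>" "\<not> is_paired (ends c \<alpha>) x"
proof -
  obtain B where B: "B \<in> hat \<alpha>" "transversal B" "c x \<in> B" using x unfolding ends_def by blast
  then have "B \<in> \<alpha>" unfolding hat_eq[OF \<alpha>] using new_arcs_not_transversal by blast
  then obtain y z where yz: "B = {Upper y, Lower z}" using motzkin_transversal[OF \<alpha> _ B(2)] by blast
  have t: "{Upper y, Lower z} \<in> \<alpha>" "\<not> is_paired (ends Upper \<alpha>) y"
    using B(1) hat_transversal_iff[OF \<alpha>, of y z] unfolding yz by blast+
  have y: "y \<in> ends Upper \<alpha>" "lower_end \<alpha> y = z"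
    using t(1) ends_Upper[OF \<alpha>] lower_end_eq[OF motzkin_disjoint[OF \<alpha>]] by blast+
  show "x \<in> ends c \<alpha>" using \<open>B \<in> \<alpha>\<close> B unfolding ends_def by blast
  from c show "\<not> is_paired (ends c \<alpha>) x"
  proof (elim insertE emptyE)
    assume "c = Upper"
    then have "x = y" using B(3) yz by auto
    then show ?thesis using t(2) \<open>c = Upper\<close> by blast
  next
    assume "c = Lower"
    then have "x = z" using B(3) yz by auto
    then show ?thesis using is_paired_lower_end[OF \<alpha> y(1)] t(2) y(2) \<open>c = Lower\<close> by blast
  qed
qed

lemma unpaired_last:
  assumes "motzkin_diagram n \<alpha>" "side c" "x \<in> ends c (hat \<alpha>)" "y \<in> ends c \<alpha>"
  shows "y \<le> x"
  using ends_hat_subset[OF assms(1-3)] unpaired_greatest[OF finite_ends[OF assms(1,2)]] assms(4) by blast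

text \<open>If an old arc interleaved with a new one, an end of the new arc, which is an end of an
  old transversal, would lie beneath the old arc. Beneath a new arc there is no end of an old
  transversal, since it joins consecutive ones; this excludes crossings of new arcs with each other
  and with the surviving transversal.\<close>

lemma hat_motzkin:
  assumes \<alpha>: "motzkin_diagram n \<alpha>"
  shows "motzkin_diagram n (hat \<alpha>)"
proof -
  have part: "partition_on (vertices n) \<alpha>" and nc: "noncrossing \<alpha>"
    and sz: "\<And>B. B \<in> \<alpha> \<Longrightarrow> card B = 1 \<or> card B = 2"
    using \<alpha> by (auto simp: motzkin_diagram_def)
  have "partition_on (vertices n) (hat \<alpha>)"
    unfolding hat_eq[OF \<alpha>] by (rule partition_on_replace[OF part removed_subset new_arcs_partition[OF \<alpha>]])
  moreover have "\<forall>B\<in>hat \<alpha>. card B = 1 \<or> card B = 2"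
    using hat_block_card[OF \<alpha>] sz by blast
  moreover have "noncrossing (hat \<alpha>)"
    unfolding noncrossing_def
  proof (intro conjI ballI allI impI)
    fix c a b d e assume c: "side c" and ab: "{c a, c b} \<in> hat \<alpha>" and de: "{c d, c e} \<in> hat \<alpha>"
      and lt: "a < d" "d < b"
    note fin = finite_ends[OF \<alpha> c]
    show "\<not> b < e"
    proof
      assume be: "b < e"
      consider "{c a, c b} \<in> \<alpha>" | "paired (ends c \<alpha>) a b"
        using ab[unfolded hat_arc_iff[OF \<alpha> c]] lt by (auto simp: paired_def)
      then show False
      proof cases
        case 1
        consider "{c d, c e} \<in> \<alpha>" | "paired (ends c \<alpha>) d e"
          using de[unfolded hat_arc_iff[OF \<alpha> c]] lt be by (auto simp: paired_def)
        then show False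
        proof cases
          case 1
          then show False using noncrossing_arcs[OF nc c \<open>{c a, c b} \<in> \<alpha>\<close> 1 lt] be by blast
        next
          case 2
          then have "d \<in> ends c \<alpha>" by (simp add: paired_def)
          then show False using noncrossing_ends[OF nc c 1] lt by blast
        qed
      next
        case 2
        consider "{c d, c e} \<in> \<alpha>" | "paired (ends c \<alpha>) d e"
          using de[unfolded hat_arc_iff[OF \<alpha> c]] lt be by (auto simp: paired_def)
        then show False
        proof cases
          case 1
          have "b \<in> ends c \<alpha>" using 2 by (simp add: paired_def)
          then show False using noncrossing_ends[OF nc c 1] lt be by blast
        next
          case d: 2
          then have "d \<in> ends c \<alpha>" by (simp add: paired_def)
          then show False using paired_consecutive[OF fin 2] lt by fastforce
        qed
      qed
    qed
  next
    fix c a b x assume c: "side c" and ab: "{c a, c b} \<in> hat \<alpha>" and x: "x \<in> ends c (hat \<alpha>)" and "a < x"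
    have xe: "x \<in> ends c \<alpha>" using ends_hat_subset[OF \<alpha> c x] by blast
    show "\<not> x < b"
    proof
      assume "x < b"
      consider "{c a, c b} \<in> \<alpha>" | "paired (ends c \<alpha>) a b"
        using ab[unfolded hat_arc_iff[OF \<alpha> c]] \<open>a < x\<close> \<open>x < b\<close> by (auto simp: paired_def)
      then show False
      proof cases
        case 1
        then show False using noncrossing_ends[OF nc c 1 xe] \<open>a < x\<close> \<open>x < b\<close> by blast
      next
        case 2
        then show False using paired_consecutive[OF finite_ends[OF \<alpha> c] 2 xe] \<open>a < x\<close> \<open>x < b\<close> by fastforce
      qed
    qed
  next
    fix x y x' y' assume "{Upper x, Lower y} \<in> hat \<alpha>" "{Upper x', Lower y'} \<in> hat \<alpha>" "x < x'"
    then show "y < y'"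
      using noncrossing_transversals[OF nc] hat_transversal_iff[OF \<alpha>] by blast
  qed
  ultimately show ?thesis by (simp add: motzkin_diagram_def)
qed

lemma conn_mono:
  assumes "interface_edges \<alpha> \<subseteq> interface_edges \<beta>"
  shows "conn \<alpha> \<subseteq> conn \<beta>"
  unfolding conn_def using assms by (intro rtrancl_mono UN_mono) auto

lemma interface_edges_hat:
  assumes "motzkin_diagram n \<alpha>"
  shows "interface_edges \<alpha> \<subseteq> interface_edges (hat \<alpha>)"
proof
  fix e assume "e \<in> interface_edges \<alpha>"
  then obtain c a b where c: "side c" "a \<noteq> b" "e = {c a, c b}" "e \<in> \<alpha>" by (elim interface_edgesE)
  then have "{c a, c b} \<in> hat \<alpha>" using hat_arc_iff[OF assms c(1), of a b] by simp
  then show "e \<in> interface_edges (hat \<alpha>)"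
    unfolding c(3) by (rule interface_edgesI[OF _ c(2,1)])
qed

lemma card_ends_hat:
  assumes "motzkin_diagram n \<alpha>" "side c"
  shows "card (ends c (hat \<alpha>)) \<le> 1"
proof -
  have "x = y" if "x \<in> ends c (hat \<alpha>)" "y \<in> ends c (hat \<alpha>)" for x y
    using unpaired_last[OF assms that(1)] unpaired_last[OF assms that(2)] that ends_hat_subset(1)[OF assms]
    by (meson le_antisym)
  then show ?thesis
    by (metis One_nat_def card_le_Suc0_iff_eq finite_ends[OF hat_motzkin[OF assms(1)] assms(2)])
qed

section \<open>Return edges, admissible cuts and the cut diagram\<close>

definition return_edge :: "(nat \<Rightarrow> vertex) \<Rightarrow> diagram \<Rightarrow> vertex set \<Rightarrow> bool" where
  "return_edge c \<delta> e \<longleftrightarrow> e \<in> \<delta> \<and> (\<exists>a b. a < b \<and> e = {c a, c b} \<and>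
     \<not> (\<exists>p q. {c p, c q} \<in> \<delta> \<and> p < a \<and> b < q) \<and> \<not> (\<exists>x\<in>ends c \<delta>. x < a))"

lemma upper_return_iff: "upper_return \<delta> e \<longleftrightarrow> return_edge Upper \<delta> e"
proof -
  have "(\<exists>x B. x < a \<and> B \<in> \<delta> \<and> transversal B \<and> Upper x \<in> B) \<longleftrightarrow> (\<exists>x\<in>ends Upper \<delta>. x < a)" for a
    unfolding ends_def by blast
  then show ?thesis unfolding upper_return_def return_edge_def by simp
qed

lemma lower_return_iff: "lower_return \<delta> e \<longleftrightarrow> return_edge Lower \<delta> e"
proof -
  have "(\<exists>x B. x < a \<and> B \<in> \<delta> \<and> transversal B \<and> Lower x \<in> B) \<longleftrightarrow> (\<exists>x\<in>ends Lower \<delta>. x < a)" for a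
    unfolding ends_def by blast
  then show ?thesis unfolding lower_return_def return_edge_def by simp
qed

definition cut_choices :: "diagram \<Rightarrow> nat set \<Rightarrow> diagram set" where
  "cut_choices \<delta> \<theta> = insert {} {{e, f} | e f. e \<in> edges_in \<delta> \<theta> \<and> upper_return \<delta> e \<and>
     f \<in> edges_in \<delta> \<theta> \<and> lower_return \<delta> f}"

text \<open>A single set of edges instead of a family of choices indexed by cycles, so that it can
  be subtracted from a diagram. Nothing outside the cycles may be cut.\<close>

definition cut_sets :: "nat \<Rightarrow> diagram \<Rightarrow> diagram set" where
  "cut_sets n \<delta> = {X. X \<subseteq> (\<Union>\<theta>\<in>cycle_components n \<delta>. edges_in \<delta> \<theta>) \<and>
     (\<forall>\<theta>\<in>cycle_components n \<delta>. X \<inter> edges_in \<delta> \<theta> \<in> cut_choices \<delta> \<theta>)}"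

definition cut_ends :: "(nat \<Rightarrow> vertex) \<Rightarrow> diagram \<Rightarrow> diagram \<Rightarrow> nat set" where
  "cut_ends c \<delta> X = ends c \<delta> \<union> {x. \<exists>e\<in>X. c x \<in> e}"

text \<open>The ends to be joined are those lying on a common path of what is left after the cut. In
  the locale \<open>cutting\<close> the transversal of \<delta> also has this form, because no cut
  edge lies on its component; so the second set lists all transversals of the result.\<close>

definition cut :: "diagram \<Rightarrow> diagram \<Rightarrow> diagram" where
  "cut \<delta> X = (\<delta> - X) \<union> {{Upper x, Lower y} | x y.
     x \<in> cut_ends Upper \<delta> X \<and> y \<in> cut_ends Lower \<delta> X \<and> (x, y) \<in> conn (\<delta> - X)}"

section \<open>From an idempotent to its cuts\<close>

lemma mate_hat_paired:
  assumes "motzkin_diagram n \<alpha>" "side c" "paired (ends c \<alpha>) x y"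
  shows "mate c (hat \<alpha>) x = y" "mate c (hat \<alpha>) y = x"
  using mate_eq[OF motzkin_disjoint[OF hat_motzkin[OF assms(1)]] assms(2)]
    hat_arc_iff[OF assms(1,2)] assms(3) by blast+

lemma mate_hat_old:
  assumes "motzkin_diagram n \<alpha>" "side c" "mate c \<alpha> x \<noteq> x"
  shows "mate c (hat \<alpha>) x = mate c \<alpha> x"
proof (rule mate_eq[OF motzkin_disjoint[OF hat_motzkin[OF assms(1)]] assms(2)])
  show "{c x, c (mate c \<alpha> x)} \<in> hat \<alpha>"
    using mate_block[OF motzkin_disjoint[OF assms(1)] assms(2,3)] hat_arc_iff[OF assms(1,2)] by blast
qed

lemma conn_class_eq: "(x, y) \<in> conn \<alpha> \<Longrightarrow> conn \<alpha> `` {x} = conn \<alpha> `` {y}"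
  using conn_sym conn_trans by blast

text \<open>To be used for the upper ends \<open>x\<close> and \<open>y\<close> of two paired
  transversals: the vertices of their two paths. The hat map joins the two upper ends of these paths
  to each other, and likewise the two lower ends.\<close>

definition path_pair :: "diagram \<Rightarrow> nat \<Rightarrow> nat \<Rightarrow> nat set" where
  "path_pair \<alpha> x y = conn \<alpha> `` {x} \<union> conn \<alpha> `` {y}"

lemma path_pair_ends:
  assumes \<alpha>: "motzkin_diagram n \<alpha>" and idem: "ends_connected \<alpha>"
    and xy: "paired (ends Upper \<alpha>) x y" and c: "side c"
  obtains p q where "paired (ends c \<alpha>) p q"
    "free_ends c \<alpha> x = {p}" "free_ends c \<alpha> y = {q}"
proof -
  have x: "x \<in> ends Upper \<alpha>" and y: "y \<in> ends Upper \<alpha>" using xy by (auto simp: paired_def)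
  note bx = lower_end_block[OF \<alpha> x] and by' = lower_end_block[OF \<alpha> y]
  note ex = idempotent_component[OF \<alpha> bx idem[rule_format, OF bx]]
      and ey = idempotent_component[OF \<alpha> by' idem[rule_format, OF by']]
  have xy': "paired (ends Lower \<alpha>) (lower_end \<alpha> x) (lower_end \<alpha> y)"
    using paired_lower_end[OF \<alpha> x y] xy by blast
  from c show ?thesis
  proof (elim insertE emptyE)
    assume "c = Upper"
    from that[unfolded this, OF xy ex(1) ey(1)] show ?thesis .
  next
    assume "c = Lower"
    from that[unfolded this, OF xy' ex(2) ey(2)] show ?thesis .
  qed
qed

text \<open>Each path has just one free end on side \<open>c\<close>, and the new arc on that side
  joins these two. All other vertices keep their old arcs, so no vertex remains without one and none
  has its mate outside.\<close>

lemma path_pair_mate: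
  assumes \<alpha>: "motzkin_diagram n \<alpha>" and idem: "ends_connected \<alpha>"
    and xy: "paired (ends Upper \<alpha>) x y" and c: "side c" and z: "z \<in> path_pair \<alpha> x y"
  shows "mate c (hat \<alpha>) z \<noteq> z" "mate c (hat \<alpha>) z \<in> path_pair \<alpha> x y"
proof -
  obtain p q where pq: "paired (ends c \<alpha>) p q"
    "free_ends c \<alpha> x = {p}" "free_ends c \<alpha> y = {q}"
    by (rule path_pair_ends[OF \<alpha> idem xy c])
  have lt: "p < q" using pq(1) by (simp add: paired_def)
  have mem: "p \<in> path_pair \<alpha> x y" "q \<in> path_pair \<alpha> x y"
    using pq(2,3) unfolding path_pair_def by blast+
  have "mate c (hat \<alpha>) z \<noteq> z \<and> mate c (hat \<alpha>) z \<in> path_pair \<alpha> x y"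
  proof (cases "mate c \<alpha> z = z")
    case True
    then consider "z = p" | "z = q" using z pq(2,3) unfolding path_pair_def by blast
    then show ?thesis using mate_hat_paired[OF \<alpha> c pq(1)] lt mem by cases auto
  next
    case False
    have "mate c \<alpha> z \<in> path_pair \<alpha> x y"
      using z conn_mate[OF motzkin_disjoint[OF \<alpha>] c, of z] conn_trans unfolding path_pair_def by blast
    then show ?thesis using mate_hat_old[OF \<alpha> c False] False by simp
  qed
  then show "mate c (hat \<alpha>) z \<noteq> z" "mate c (hat \<alpha>) z \<in> path_pair \<alpha> x y" by auto
qed

text \<open>Closure under the new mates bounds the component from above. It is all of the pair
  because the new upper arc from \<open>x\<close> to \<open>y\<close> connects the two
  paths.\<close>

lemma path_pair_component:
  assumes \<alpha>: "motzkin_diagram n \<alpha>" and idem: "ends_connected \<alpha>"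
    and xy: "paired (ends Upper \<alpha>) x y" and z: "z \<in> path_pair \<alpha> x y"
  shows "conn (hat \<alpha>) `` {z} = path_pair \<alpha> x y"
proof -
  note dj = motzkin_disjoint[OF hat_motzkin[OF \<alpha>]]
  have sub: "conn \<alpha> \<subseteq> conn (hat \<alpha>)" using conn_mono[OF interface_edges_hat[OF \<alpha>]] .
  have cl: "closed_under_mates (hat \<alpha>) (path_pair \<alpha> x y)"
    unfolding mate_closed_def using path_pair_mate(2)[OF \<alpha> idem xy] by blast
  have "(x, y) \<in> conn (hat \<alpha>)"
    using conn_mate[OF dj, of Upper x] mate_hat_paired[OF \<alpha> _ xy] by simp
  then have all: "w \<in> path_pair \<alpha> x y \<Longrightarrow> (x, w) \<in> conn (hat \<alpha>)" for w
    using sub conn_trans[of x y "hat \<alpha>" w] unfolding path_pair_def by blast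
  show ?thesis
  proof (intro equalityI subsetI)
    fix w assume "w \<in> conn (hat \<alpha>) `` {z}"
    then show "w \<in> path_pair \<alpha> x y" using conn_least[OF dj _ cl z] by blast
  next
    fix w assume "w \<in> path_pair \<alpha> x y"
    then have "(z, w) \<in> conn (hat \<alpha>)" using all[OF z] all[of w] conn_sym conn_trans by blast
    then show "w \<in> conn (hat \<alpha>) `` {z}" by simp
  qed
qed

lemma path_pair_cycle:
  assumes \<alpha>: "motzkin_diagram n \<alpha>" and idem: "ends_connected \<alpha>"
    and xy: "paired (ends Upper \<alpha>) x y"
  shows "path_pair \<alpha> x y \<in> cycle_components n (hat \<alpha>)"
proof -
  note \<delta> = hat_motzkin[OF \<alpha>]
  have x: "x \<in> path_pair \<alpha> x y" unfolding path_pair_def using conn_refl by blast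
  have "x \<in> ends Upper \<alpha>" using xy by (simp add: paired_def)
  then have xn: "x \<in> {1..n}" using ends_in[OF \<alpha>] by blast
  note eq = path_pair_component[OF \<alpha> idem xy x]
  have "is_cycle (hat \<alpha>) (conn (hat \<alpha>) `` {x})"
  proof (rule is_cycleI[OF motzkin_disjoint[OF \<delta>] equalityD1[OF motzkin_Union[OF \<delta>]] xn])
    fix z c assume "z \<in> conn (hat \<alpha>) `` {x}" and c: "side c"
    then have "z \<in> path_pair \<alpha> x y" unfolding eq by simp
    then show "mate c (hat \<alpha>) z \<noteq> z" by (rule path_pair_mate(1)[OF \<alpha> idem xy c])
  qed
  moreover have "conn (hat \<alpha>) `` {x} \<in> interface_components n (hat \<alpha>)"
    unfolding interface_components_def conn_def[symmetric] using xn by (rule quotientI)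
  ultimately show ?thesis unfolding cycle_components_def eq by blast
qed

lemma cycle_component_eq:
  assumes "\<theta> \<in> cycle_components n \<delta>" "x \<in> \<theta>"
  shows "\<theta> = conn \<delta> `` {x}"
proof -
  obtain a where "\<theta> = conn \<delta> `` {a}"
    using assms(1) unfolding cycle_components_def interface_components_def conn_def[symmetric]
    by (auto elim: quotientE)
  then show ?thesis using conn_class_eq assms(2) by blast
qed

text \<open>An old arc over \<open>{c a, c b}\<close> would cover a transversal end, and a new arc
  over it would skip \<open>a\<close> between two consecutive ends. A transversal that survives is
  unpaired, hence rightmost, and so not to the left of \<open>a\<close>.\<close>

lemma new_arc_return:
  assumes \<alpha>: "motzkin_diagram n \<alpha>" and c: "side c" and ab: "paired (ends c \<alpha>) a b"
  shows "return_edge c (hat \<alpha>) {c a, c b}"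
proof -
  have nc: "noncrossing \<alpha>" using \<alpha> by (simp add: motzkin_diagram_def)
  have a: "a \<in> ends c \<alpha>" "b \<in> ends c \<alpha>" "a < b" using ab by (auto simp: paired_def)
  have "\<not> (p < a \<and> b < q)" if pq: "{c p, c q} \<in> hat \<alpha>" for p q
  proof
    assume lt: "p < a \<and> b < q"
    consider "{c p, c q} \<in> \<alpha>" | "paired (ends c \<alpha>) p q"
      using pq[unfolded hat_arc_iff[OF \<alpha> c]] lt a(3) by (auto simp: paired_def)
    then show False
    proof cases
      case 1
      then show False using noncrossing_ends[OF nc c 1 a(1)] lt a(3) by linarith
    next
      case 2
      then show False using paired_consecutive[OF finite_ends[OF \<alpha> c] 2 a(1)] lt a(3) by linarith
    qed
  qed
  moreover have "\<not> x < a" if "x \<in> ends c (hat \<alpha>)" for x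
    using unpaired_last[OF \<alpha> c that a(1)] by simp
  moreover have "{c a, c b} \<in> hat \<alpha>" using hat_arc_iff[OF \<alpha> c] ab by blast
  ultimately show ?thesis unfolding return_edge_def using a(3) by blast
qed

lemma new_arc_path_pair:
  assumes \<alpha>: "motzkin_diagram n \<alpha>" and idem: "ends_connected \<alpha>"
    and e: "e \<in> new_arcs \<alpha>"
  obtains x y where "paired (ends Upper \<alpha>) x y"
    "endpoints e \<subseteq> path_pair \<alpha> x y"
proof -
  obtain c a b where c: "side c" "paired (ends c \<alpha>) a b" "e = {c a, c b}"
    using e unfolding new_arcs_def by blast
  obtain x y where xy: "paired (ends Upper \<alpha>) x y"
    "a = x \<and> b = y \<or> a = lower_end \<alpha> x \<and> b = lower_end \<alpha> y"
    using c(1)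
  proof (elim insertE emptyE)
    assume "c = Upper"
    then show ?thesis using that[of a b] c by blast
  next
    assume "c = Lower"
    then show ?thesis using that paired_LowerE[OF \<alpha>] c(2) by blast
  qed
  have x: "x \<in> ends Upper \<alpha>" and y: "y \<in> ends Upper \<alpha>" using xy(1) by (auto simp: paired_def)
  have "(x, lower_end \<alpha> x) \<in> conn \<alpha>" "(y, lower_end \<alpha> y) \<in> conn \<alpha>"
    using idem lower_end_block[OF \<alpha>] x y by blast+
  then have "a \<in> path_pair \<alpha> x y" "b \<in> path_pair \<alpha> x y"
    using xy(2) conn_refl unfolding path_pair_def by blast+
  moreover have "endpoints e = {a, b}" using c by auto
  ultimately have "endpoints e \<subseteq> path_pair \<alpha> x y" by simp
  then show ?thesis by (rule that[OF xy(1)])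
qed

lemma new_arcs_interface:
  assumes "motzkin_diagram n \<alpha>"
  shows "new_arcs \<alpha> \<subseteq> interface_edges (hat \<alpha>)"
proof
  fix e assume "e \<in> new_arcs \<alpha>"
  then obtain c a b where c: "side c" "paired (ends c \<alpha>) a b" "e = {c a, c b}"
    unfolding new_arcs_def by blast
  show "e \<in> interface_edges (hat \<alpha>)"
    unfolding c(3)
  proof (rule interface_edgesI)
    show "{c a, c b} \<in> hat \<alpha>" using hat_arc_iff[OF assms c(1)] c(2) by blast
    show "a \<noteq> b" using c(2) by (auto simp: paired_def)
  qed (fact c(1))
qed

text \<open>A new arc inside the cycle starts at a free end of one of the two paths. On each side
  there are only two such ends, and they are paired with each other; so there is exactly one new arc
  on each side.\<close>

lemma new_arcs_in_path_pair:
  assumes \<alpha>: "motzkin_diagram n \<alpha>" and idem: "ends_connected \<alpha>"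
    and xy: "paired (ends Upper \<alpha>) x y"
  shows "\<exists>e f. new_arcs \<alpha> \<inter> edges_in (hat \<alpha>) (path_pair \<alpha> x y) = {e, f} \<and>
    return_edge Upper (hat \<alpha>) e \<and> return_edge Lower (hat \<alpha>) f"
proof -
  let ?\<theta> = "path_pair \<alpha> x y"
  have side: "\<exists>p q. paired (ends c \<alpha>) p q \<and> p \<in> ?\<theta> \<and> q \<in> ?\<theta> \<and>
      (\<forall>a b. paired (ends c \<alpha>) a b \<longrightarrow> a \<in> ?\<theta> \<longrightarrow> a = p \<and> b = q)" if c: "side c" for c
  proof -
    obtain p q where pq: "paired (ends c \<alpha>) p q"
      "free_ends c \<alpha> x = {p}" "free_ends c \<alpha> y = {q}"
      by (rule path_pair_ends[OF \<alpha> idem xy c])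
    have "a = p \<and> b = q" if ab: "paired (ends c \<alpha>) a b" "a \<in> ?\<theta>" for a b
    proof -
      have "a \<in> ends c \<alpha>" using ab by (simp add: paired_def)
      then have "mate c \<alpha> a = a" by (rule ends_mate[OF motzkin_disjoint[OF \<alpha>] _ c])
      then have "a \<in> {p, q}" using ab(2) pq(2,3) unfolding path_pair_def by blast
      then have "p = a \<and> q = b" by (intro paired_share[OF finite_ends[OF \<alpha> c] pq(1) ab(1), of a]) auto
      then show ?thesis by simp
    qed
    moreover have "p \<in> ?\<theta>" "q \<in> ?\<theta>" using pq(2,3) unfolding path_pair_def by blast+
    ultimately show ?thesis using pq(1) by blast
  qed
  obtain p q where U: "paired (ends Upper \<alpha>) p q" "p \<in> ?\<theta>" "q \<in> ?\<theta>"
      "\<And>a b. paired (ends Upper \<alpha>) a b \<Longrightarrow> a \<in> ?\<theta> \<Longrightarrow> a = p \<and> b = q"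
    using side[of Upper] by blast
  obtain r s where L: "paired (ends Lower \<alpha>) r s" "r \<in> ?\<theta>" "s \<in> ?\<theta>"
      "\<And>a b. paired (ends Lower \<alpha>) a b \<Longrightarrow> a \<in> ?\<theta> \<Longrightarrow> a = r \<and> b = s"
    using side[of Lower] by blast
  have "new_arcs \<alpha> \<inter> edges_in (hat \<alpha>) ?\<theta> = {{Upper p, Upper q}, {Lower r, Lower s}}"
  proof (intro equalityI subsetI)
    fix e assume "e \<in> new_arcs \<alpha> \<inter> edges_in (hat \<alpha>) ?\<theta>"
    then have e: "e \<in> new_arcs \<alpha>" "endpoints e \<subseteq> ?\<theta>" unfolding edges_in_def by blast+
    obtain c a b where c: "side c" "paired (ends c \<alpha>) a b" "e = {c a, c b}"
      using e(1) unfolding new_arcs_def by blast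
    have "a \<in> ?\<theta>" using e(2) c by auto
    then show "e \<in> {{Upper p, Upper q}, {Lower r, Lower s}}"
      using c U(4)[of a b] L(4)[of a b] by auto
  next
    fix e assume "e \<in> {{Upper p, Upper q}, {Lower r, Lower s}}"
    then have e: "e = {Upper p, Upper q} \<or> e = {Lower r, Lower s}" by blast
    then have "e \<in> new_arcs \<alpha>" unfolding new_arcs_def using U(1) L(1) by blast
    moreover from this have "e \<in> interface_edges (hat \<alpha>)" using new_arcs_interface[OF \<alpha>] by blast
    moreover have "endpoints e \<subseteq> ?\<theta>" using e U(2,3) L(2,3) by auto
    ultimately show "e \<in> new_arcs \<alpha> \<inter> edges_in (hat \<alpha>) ?\<theta>" unfolding edges_in_def by blast
  qed
  moreover have "return_edge Upper (hat \<alpha>) {Upper p, Upper q}"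
      "return_edge Lower (hat \<alpha>) {Lower r, Lower s}"
    using new_arc_return[OF \<alpha>] U(1) L(1) by blast+
  ultimately show ?thesis by blast
qed

text \<open>A cycle that contains a new arc is a path pair and so contains one new arc of each side,
  both returns. For every other cycle the choice is empty.\<close>

lemma new_arcs_cut_set:
  assumes \<alpha>: "motzkin_diagram n \<alpha>" and idem: "ends_connected \<alpha>"
  shows "new_arcs \<alpha> \<in> cut_sets n (hat \<alpha>)"
proof -
  have sub: "e \<in> edges_in (hat \<alpha>) (path_pair \<alpha> x y)"
    if "e \<in> new_arcs \<alpha>" "endpoints e \<subseteq> path_pair \<alpha> x y" for e x y
    using that new_arcs_interface[OF \<alpha>] unfolding edges_in_def by blast
  have "e \<in> (\<Union>\<theta>\<in>cycle_components n (hat \<alpha>). edges_in (hat \<alpha>) \<theta>)" if e: "e \<in> new_arcs \<alpha>" for e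
  proof -
    obtain x y where xy: "paired (ends Upper \<alpha>) x y" "endpoints e \<subseteq> path_pair \<alpha> x y"
      by (rule new_arc_path_pair[OF \<alpha> idem e])
    then show ?thesis using sub[OF e xy(2)] path_pair_cycle[OF \<alpha> idem xy(1)] by blast
  qed
  moreover have "new_arcs \<alpha> \<inter> edges_in (hat \<alpha>) \<theta> \<in> cut_choices (hat \<alpha>) \<theta>"
    if \<theta>: "\<theta> \<in> cycle_components n (hat \<alpha>)" for \<theta>
  proof (cases "new_arcs \<alpha> \<inter> edges_in (hat \<alpha>) \<theta> = {}")
    case True
    then show ?thesis by (simp add: cut_choices_def)
  next
    case False
    then obtain e where e: "e \<in> new_arcs \<alpha>" "e \<in> interface_edges (hat \<alpha>)" "endpoints e \<subseteq> \<theta>"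
      unfolding edges_in_def by blast
    obtain x y where xy: "paired (ends Upper \<alpha>) x y" "endpoints e \<subseteq> path_pair \<alpha> x y"
      by (rule new_arc_path_pair[OF \<alpha> idem e(1)])
    obtain z where z: "z \<in> endpoints e" using e(2) by (elim interface_edgesE) auto
    have "\<theta> = conn (hat \<alpha>) `` {z}" using cycle_component_eq[OF \<theta>] z e(3) by blast
    also have "\<dots> = path_pair \<alpha> x y" using path_pair_component[OF \<alpha> idem xy(1)] z xy(2) by blast
    finally have \<theta>_eq: "\<theta> = path_pair \<alpha> x y" .
    obtain e' f' where ef: "new_arcs \<alpha> \<inter> edges_in (hat \<alpha>) \<theta> = {e', f'}"
      "upper_return (hat \<alpha>) e'" "lower_return (hat \<alpha>) f'"
      using new_arcs_in_path_pair[OF \<alpha> idem xy(1)] unfolding \<theta>_eq upper_return_iff lower_return_iff by blast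
    then have "e' \<in> edges_in (hat \<alpha>) \<theta>" "f' \<in> edges_in (hat \<alpha>) \<theta>" by blast+
    then show ?thesis unfolding ef(1) cut_choices_def using ef(2,3) by blast
  qed
  ultimately show ?thesis unfolding cut_sets_def by blast
qed

lemma new_arcs_disjoint:
  assumes \<alpha>: "motzkin_diagram n \<alpha>"
  shows "new_arcs \<alpha> \<inter> \<alpha> = {}"
proof -
  note dj = motzkin_disjoint[OF \<alpha>]
  have False if e: "e \<in> new_arcs \<alpha>" "e \<in> \<alpha>" for e
  proof -
    obtain c a b where c: "side c" "paired (ends c \<alpha>) a b" "e = {c a, c b}"
      using e(1) unfolding new_arcs_def by blast
    have "a \<in> ends c \<alpha>" "a \<noteq> b" using c(2) by (auto simp: paired_def)
    then have "mate c \<alpha> a = a" using ends_mate[OF dj _ c(1)] by blast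
    moreover have "mate c \<alpha> a = b" using mate_eq[OF dj c(1)] e(2) c(3) by blast
    ultimately show False using \<open>a \<noteq> b\<close> by simp
  qed
  then show ?thesis by blast
qed

lemma hat_minus:
  assumes "motzkin_diagram n \<alpha>"
  shows "hat \<alpha> - \<alpha> = new_arcs \<alpha>" "hat \<alpha> - new_arcs \<alpha> = \<alpha> - removed \<alpha>"
  using new_arcs_disjoint[OF assms] removed_subset[of \<alpha>] unfolding hat_eq[OF assms] by blast+

lemma interface_edges_cong:
  assumes "\<And>c a b. side c \<Longrightarrow> {c a, c b} \<in> \<alpha> \<longleftrightarrow> {c a, c b} \<in> \<beta>"
  shows "interface_edges \<alpha> = interface_edges \<beta>"
proof -
  have "{Upper a, Upper b} \<in> \<alpha> \<longleftrightarrow> {Upper a, Upper b} \<in> \<beta>"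
      "{Lower a, Lower b} \<in> \<alpha> \<longleftrightarrow> {Lower a, Lower b} \<in> \<beta>" for a b
    using assms by blast+
  then show ?thesis unfolding interface_edges_def by auto
qed

lemma conn_cong:
  assumes "\<And>c a b. side c \<Longrightarrow> {c a, c b} \<in> \<alpha> \<longleftrightarrow> {c a, c b} \<in> \<beta>"
  shows "conn \<alpha> = conn \<beta>"
  unfolding conn_def using interface_edges_cong[OF assms] by simp

lemma cut_ends_hat:
  assumes \<alpha>: "motzkin_diagram n \<alpha>" and c: "side c"
  shows "cut_ends c (hat \<alpha>) (new_arcs \<alpha>) = ends c \<alpha>"
proof (intro equalityI subsetI)
  fix x assume "x \<in> cut_ends c (hat \<alpha>) (new_arcs \<alpha>)"
  then consider "x \<in> ends c (hat \<alpha>)" | e where "e \<in> new_arcs \<alpha>" "c x \<in> e"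
    unfolding cut_ends_def by blast
  then show "x \<in> ends c \<alpha>"
  proof cases
    case 1
    then show ?thesis using ends_hat_subset[OF \<alpha> c] by blast
  next
    case 2
    then obtain d a b where d: "side d" "paired (ends d \<alpha>) a b" "e = {d a, d b}"
      unfolding new_arcs_def by blast
    then have "c x = d a \<or> c x = d b" using 2 by blast
    then show ?thesis using d(2) side_eq_side[OF c d(1)] by (auto simp: paired_def)
  qed
next
  fix x assume x: "x \<in> ends c \<alpha>"
  then obtain B where B: "B \<in> \<alpha>" "transversal B" "c x \<in> B" unfolding ends_def by blast
  show "x \<in> cut_ends c (hat \<alpha>) (new_arcs \<alpha>)"
  proof (cases "B \<in> removed \<alpha>")
    case False
    then have "B \<in> hat \<alpha>" using B unfolding hat_eq[OF \<alpha>] by blast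
    then show ?thesis unfolding cut_ends_def ends_def using B by blast
  next
    case True
    then have "c x \<in> \<Union>(new_arcs \<alpha>)" using B partition_onD1[OF new_arcs_partition[OF \<alpha>]] by blast
    then show ?thesis unfolding cut_ends_def by blast
  qed
qed

text \<open>Deleting the new arcs from \<open>hat \<alpha>\<close> leaves \<alpha> without its
  paired transversals. Transversals are not edges of the interface graph, so connectivity is that of
  \<alpha>; by idempotency it joins each upper end to the lower end of its own transversal and to no
  other lower end.\<close>

lemma cut_hat:
  assumes \<alpha>: "motzkin_diagram n \<alpha>" and idem: "ends_connected \<alpha>"
  shows "cut (hat \<alpha>) (hat \<alpha> - \<alpha>) = \<alpha>"
proof -
  have "conn (\<alpha> - removed \<alpha>) = conn \<alpha>"
    using removed_transversal side_not_transversal by (intro conn_cong) blast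
  moreover have "{Upper x, Lower y} \<in> \<alpha>" if "x \<in> ends Upper \<alpha>" "y \<in> ends Lower \<alpha>" "(x, y) \<in> conn \<alpha>" for x y
  proof -
    note bx = lower_end_block[OF \<alpha> that(1)]
    have "mate Lower \<alpha> y = y" using ends_mate[OF motzkin_disjoint[OF \<alpha>] that(2)] by blast
    then have "y = lower_end \<alpha> x"
      using idempotent_component(2)[OF \<alpha> bx idem[rule_format, OF bx]] that(3) by blast
    then show ?thesis using bx by simp
  qed
  then have "{{Upper x, Lower y} | x y. x \<in> ends Upper \<alpha> \<and> y \<in> ends Lower \<alpha> \<and> (x, y) \<in> conn \<alpha>} \<subseteq> \<alpha>" by blast
  moreover have "removed \<alpha> \<subseteq> {{Upper x, Lower y} | x y. x \<in> ends Upper \<alpha> \<and> y \<in> ends Lower \<alpha>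
      \<and> (x, y) \<in> conn \<alpha>}"
  proof
    fix B assume "B \<in> removed \<alpha>"
    then obtain x where x: "x \<in> ends Upper \<alpha>" "B = {Upper x, Lower (lower_end \<alpha> x)}" "B \<in> \<alpha>"
      by (rule removed_block[OF \<alpha>])
    then have "lower_end \<alpha> x \<in> ends Lower \<alpha>" "(x, lower_end \<alpha> x) \<in> conn \<alpha>"
      using ends_Lower_image[OF \<alpha>] idem by blast+
    then show "B \<in> {{Upper x, Lower y} | x y. x \<in> ends Upper \<alpha> \<and> y \<in> ends Lower \<alpha> \<and> (x, y) \<in> conn \<alpha>}"
      using x by blast
  qed
  ultimately show ?thesis
    using cut_ends_hat[OF \<alpha>, of Upper] cut_ends_hat[OF \<alpha>, of Lower]
    unfolding cut_def hat_minus[OF \<alpha>] by auto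
qed

section \<open>Cutting cycles at return edges\<close>

text \<open>This covers both kinds of elements of \<open>D_set\<close>: \<open>idem\<close> is
  vacuous in rank 0 and expresses idempotency in rank 1.\<close>

locale cutting =
  fixes n :: nat and \<delta> X :: diagram
  assumes mot: "motzkin_diagram n \<delta>"
    and idem: "ends_connected \<delta>"
    and rank: "card (ends Upper \<delta>) \<le> 1"
    and cut_set: "X \<in> cut_sets n \<delta>"
begin

lemma dj: "disjoint \<delta>"
  using motzkin_disjoint[OF mot] .

lemma nc: "noncrossing \<delta>"
  using mot by (simp add: motzkin_diagram_def)

lemma dj_cut: "disjoint (\<delta> - X)"
  using dj unfolding disjoint_def by blast

lemma sub_cut: "\<Union>(\<delta> - X) \<subseteq> vertices n"
  using motzkin_Union[OF mot] by blast

text \<open>A choice is all or nothing: a single cut edge implies that its cycle is cut in exactly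
  one upper and one lower return edge.\<close>

lemma cut_edgeE:
  assumes "e \<in> X"
  obtains \<theta> a b p q where "\<theta> \<in> cycle_components n \<delta>" "a < b" "p < q" "a \<in> \<theta>" "b \<in> \<theta>" "p \<in> \<theta>" "q \<in> \<theta>"
    "X \<inter> edges_in \<delta> \<theta> = {{Upper a, Upper b}, {Lower p, Lower q}}"
    "return_edge Upper \<delta> {Upper a, Upper b}" "return_edge Lower \<delta> {Lower p, Lower q}"
    "e = {Upper a, Upper b} \<or> e = {Lower p, Lower q}" "e \<in> interface_edges \<delta>"
proof -
  have "X \<subseteq> (\<Union>\<theta>\<in>cycle_components n \<delta>. edges_in \<delta> \<theta>)"
    and choice: "\<And>\<theta>. \<theta> \<in> cycle_components n \<delta> \<Longrightarrow> X \<inter> edges_in \<delta> \<theta> \<in> cut_choices \<delta> \<theta>"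
    using cut_set unfolding cut_sets_def by blast+
  then obtain \<theta> where \<theta>: "\<theta> \<in> cycle_components n \<delta>" "e \<in> edges_in \<delta> \<theta>" using assms by blast
  then have ne: "X \<inter> edges_in \<delta> \<theta> \<noteq> {}" using assms by blast
  obtain e' f' where ef: "X \<inter> edges_in \<delta> \<theta> = {e', f'}" "e' \<in> edges_in \<delta> \<theta>" "f' \<in> edges_in \<delta> \<theta>"
    "return_edge Upper \<delta> e'" "return_edge Lower \<delta> f'"
    using choice[OF \<theta>(1)] ne unfolding cut_choices_def upper_return_iff lower_return_iff by blast
  obtain a b where ab: "a < b" "e' = {Upper a, Upper b}" using ef(4) unfolding return_edge_def by blast
  obtain p q where pq: "p < q" "f' = {Lower p, Lower q}" using ef(5) unfolding return_edge_def by blast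
  have "endpoints e' \<subseteq> \<theta>" "endpoints f' \<subseteq> \<theta>" using ef(2,3) unfolding edges_in_def by blast+
  then have in\<theta>: "a \<in> \<theta>" "b \<in> \<theta>" "p \<in> \<theta>" "q \<in> \<theta>" using ab(2) pq(2) by auto
  have "e = e' \<or> e = f'" using ef(1) \<theta>(2) assms by blast
  moreover have "e \<in> interface_edges \<delta>" using \<theta>(2) unfolding edges_in_def by blast
  ultimately show ?thesis
    using ef(1,4,5) unfolding ab(2) pq(2) by (intro that[OF \<theta>(1) ab(1) pq(1) in\<theta>])
qed

lemma cut_subset: "X \<subseteq> interface_edges \<delta>"
  by (rule subsetI) (erule cut_edgeE)

lemma cut_in: "e \<in> X \<Longrightarrow> e \<in> \<delta>"
  using cut_subset unfolding interface_edges_def by blast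

lemma cut_edge_mate:
  assumes "e \<in> X" "c x \<in> e" "side c"
  shows "e = {c x, c (mate c \<delta> x)}" "mate c \<delta> x \<noteq> x"
proof -
  have e: "e \<in> interface_edges \<delta>" using cut_subset assms(1) by blast
  have "x \<in> endpoints e" using assms(2,3) by (auto simp: endpoints_def)
  then obtain d where d: "side d" "e = {d x, d (mate d \<delta> x)}" "mate d \<delta> x \<noteq> x"
    using edge_at[OF dj e] by blast
  have "c = d" using assms(2) d(2) side_eq_side[OF assms(3) d(1)] by blast
  then show "e = {c x, c (mate c \<delta> x)}" "mate c \<delta> x \<noteq> x" using d by auto
qed

lemma mate_cut_edge:
  assumes "e \<in> X" "c x \<in> e" "side c"
  shows "mate c (\<delta> - X) x = x"
proof (rule ccontr)
  assume "mate c (\<delta> - X) x \<noteq> x"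
  then have B: "{c x, c (mate c (\<delta> - X) x)} \<in> \<delta> - X" by (rule mate_block[OF dj_cut assms(3)])
  then have "e = {c x, c (mate c (\<delta> - X) x)}"
    using disjoint_block_eq[OF dj cut_in[OF assms(1)] _ assms(2)] by blast
  then show False using B assms(1) by blast
qed

lemma mate_cut_other:
  assumes "\<not> (\<exists>e\<in>X. c x \<in> e)" "side c"
  shows "mate c (\<delta> - X) x = mate c \<delta> x"
proof (cases "mate c \<delta> x = x")
  case True
  have "\<not> (\<exists>y. y \<noteq> x \<and> {c x, c y} \<in> \<delta> - X)"
    using True mate_fixed_iff[OF dj assms(2), of x] by blast
  then have "mate c (\<delta> - X) x = x" using mate_fixed_iff[OF dj_cut assms(2), of x] by blast
  then show ?thesis using True by simp
next
  case False
  then have "{c x, c (mate c \<delta> x)} \<in> \<delta> - X" using mate_block[OF dj assms(2) False] assms(1) by blast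
  then show ?thesis by (rule mate_eq[OF dj_cut assms(2)])
qed

lemma mate_cut_cases:
  assumes "side c"
  shows "mate c (\<delta> - X) x = x \<or> mate c (\<delta> - X) x = mate c \<delta> x"
  using mate_cut_edge[OF _ _ assms] mate_cut_other[OF _ assms] by blast

lemma cut_endsE:
  assumes "x \<in> cut_ends c \<delta> X"
  obtains "x \<in> ends c \<delta>" | e where "e \<in> X" "c x \<in> e"
  using assms unfolding cut_ends_def by blast

lemma mate_cut_ends:
  assumes "x \<in> cut_ends c \<delta> X" "side c"
  shows "mate c (\<delta> - X) x = x"
  using assms(1)
proof (cases rule: cut_endsE)
  case 1
  then show ?thesis using ends_mate[OF dj 1 assms(2)] mate_cut_cases[OF assms(2), of x] by simp
next
  case (2 e)
  then show ?thesis by (rule mate_cut_edge[OF _ _ assms(2)])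
qed

lemma ends_not_cut:
  assumes "x \<in> ends c \<delta>" "side c" "e \<in> X"
  shows "c x \<notin> e"
  using ends_mate[OF dj assms(1,2)] cut_edge_mate(2)[OF assms(3) _ assms(2)] by blast

lemma cut_edge_return:
  assumes c: "side c" and xy: "{c x, c y} \<in> X" "x < y"
  shows "\<And>p q. {c p, c q} \<in> \<delta> \<Longrightarrow> p < x \<Longrightarrow> \<not> y < q" "\<And>z. z \<in> ends c \<delta> \<Longrightarrow> \<not> z < x"
proof -
  have *: "return_edge c \<delta> {c x, c y}"
  proof (rule cut_edgeE[OF xy(1)])
    fix a b p q
    assume r: "return_edge Upper \<delta> {Upper a, Upper b}" "return_edge Lower \<delta> {Lower p, Lower q}"
      and e: "{c x, c y} = {Upper a, Upper b} \<or> {c x, c y} = {Lower p, Lower q}"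
    have UL: "side Upper" "side Lower" by auto
    from e show ?thesis
    proof
      assume e: "{c x, c y} = {Upper a, Upper b}"
      then have "c = Upper" using side_doubleton_eq_iff[OF c UL(1)] by blast
      then show ?thesis using r(1) e by simp
    next
      assume e: "{c x, c y} = {Lower p, Lower q}"
      then have "c = Lower" using side_doubleton_eq_iff[OF c UL(2)] by blast
      then show ?thesis using r(2) e by simp
    qed
  qed
  then obtain a b where ab: "a < b" "{c x, c y} = {c a, c b}"
    and 1: "\<not> (\<exists>p q. {c p, c q} \<in> \<delta> \<and> p < a \<and> b < q)" and 2: "\<not> (\<exists>x\<in>ends c \<delta>. x < a)"
    unfolding return_edge_def by blast
  have "x = a" "y = b" using ab xy(2) side_doubleton_eq_iff[OF c c, of x y a b] by auto
  then show "\<And>p q. {c p, c q} \<in> \<delta> \<Longrightarrow> p < x \<Longrightarrow> \<not> y < q" "\<And>z. z \<in> ends c \<delta> \<Longrightarrow> \<not> z < x"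
    using 1 2 by blast+
qed

lemma cut_edge_partner:
  assumes c: "side c" and e: "e \<in> X" "c x \<in> e"
  shows "{c x, c (mate c \<delta> x)} \<in> X" "mate c \<delta> x \<noteq> x" "mate c \<delta> x \<in> cut_ends c \<delta> X" "x \<in> cut_ends c \<delta> X"
proof -
  show 1: "{c x, c (mate c \<delta> x)} \<in> X" "mate c \<delta> x \<noteq> x" using cut_edge_mate[OF e c] e(1) by auto
  then show "mate c \<delta> x \<in> cut_ends c \<delta> X" "x \<in> cut_ends c \<delta> X" unfolding cut_ends_def by blast+
qed

lemma nested_cut:
  assumes c: "side c"
  shows "nested (mate c (\<delta> - X))"
  unfolding nested_def
proof (intro allI impI)
  fix x z assume xz: "x < z" "z < mate c (\<delta> - X) x"
  then have eq: "mate c (\<delta> - X) x = mate c \<delta> x" using mate_cut_cases[OF c, of x] by auto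
  have "x < mate c \<delta> z \<and> mate c \<delta> z < mate c \<delta> x"
    using nested_mate[OF dj nc c] xz eq unfolding nested_def by simp
  then show "x < mate c (\<delta> - X) z \<and> mate c (\<delta> - X) z < mate c (\<delta> - X) x"
    using mate_cut_cases[OF c, of z] xz eq by auto
qed

text \<open>Were an arc to pass over one end of a cut edge, then by nesting it would pass over the
  other end too, which a return edge does not allow.\<close>

lemma cut_edge_exposed:
  assumes c: "side c" and x: "x \<in> cut_ends c \<delta> X"
  shows "exposed (mate c \<delta>) x"
  using x
proof (cases rule: cut_endsE)
  case 1
  then show ?thesis by (rule exposed_ends[OF dj nc c])
next
  case (2 e)
  let ?y = "mate c \<delta> x"
  note p = cut_edge_partner[OF c 2]
  have "mate c \<delta> ?y = x" by (rule mate_mate[OF dj c])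
  show ?thesis
    unfolding exposed_def
  proof
    assume "\<exists>z<x. x < mate c \<delta> z"
    then obtain z where z: "z < x" "x < mate c \<delta> z" by blast
    then have y: "z < ?y" "?y < mate c \<delta> z"
      using nested_mate[OF dj nc c] unfolding nested_def by blast+
    have B: "{c z, c (mate c \<delta> z)} \<in> \<delta>" using mate_block[OF dj c, of z] z by auto
    show False
    proof (cases "x < ?y")
      case True
      then show False using cut_edge_return(1)[OF c p(1) True B] z y by blast
    next
      case False
      then have lt: "?y < x" using p(2) by simp
      have "{c ?y, c x} \<in> X" using p(1) by (simp add: insert_commute)
      then show False using cut_edge_return(1)[OF c _ lt B] z y by blast
    qed
  qed
qed

lemma exposed_cut:
  assumes c: "side c" and x: "x \<in> cut_ends c \<delta> X"
  shows "exposed (mate c (\<delta> - X)) x"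
proof -
  have "\<not> (z < x \<and> x < mate c (\<delta> - X) z)" for z
    using cut_edge_exposed[OF c x] mate_cut_cases[OF c, of z] unfolding exposed_def by auto
  then show ?thesis unfolding exposed_def by blast
qed

text \<open>The component of \<open>s\<close> contains a vertex without an upper arc, so it is not a
  cycle and no cut touches it: the components before and after the cut coincide.\<close>

lemma cut_path_end:
  assumes st: "{Upper s, Lower t} \<in> \<delta>"
  shows "free_ends Upper (\<delta> - X) s = {s}"
    "free_ends Lower (\<delta> - X) s = {t}"
proof -
  let ?P = "conn \<delta> `` {s}" and ?Q = "conn (\<delta> - X) `` {s}"
  have s: "s \<in> ends Upper \<delta>" using st ends_Upper[OF mot] by blast
  have same: "mate c (\<delta> - X) z = mate c \<delta> z" if z: "z \<in> ?P" and c: "side c" for z c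
  proof (rule mate_cut_other[OF _ c])
    show "\<not> (\<exists>e\<in>X. c z \<in> e)"
    proof
      assume "\<exists>e\<in>X. c z \<in> e"
      then obtain e where e: "e \<in> X" "c z \<in> e" by blast
      then obtain \<theta> where \<theta>: "\<theta> \<in> cycle_components n \<delta>" "e \<in> edges_in \<delta> \<theta>"
        using cut_set unfolding cut_sets_def by blast
      have "z \<in> endpoints e" using e(2) c by (auto simp: endpoints_def)
      then have "z \<in> \<theta>" using \<theta>(2) unfolding edges_in_def by blast
      then have "\<theta> = conn \<delta> `` {z}" by (rule cycle_component_eq[OF \<theta>(1)])
      also have "\<dots> = ?P" using conn_class_eq[of s z \<delta>] z by blast
      finally have "s \<in> \<theta>" using conn_refl by blast
      moreover have "is_cycle \<delta> \<theta>" using \<theta>(1) unfolding cycle_components_def by blast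
      ultimately have "mate Upper \<delta> s \<noteq> s" using is_cycleD[OF dj, of \<theta> s Upper] by blast
      then show False using ends_mate[OF dj s] by blast
    qed
  qed
  have "?Q \<subseteq> ?P"
  proof
    have cl: "closed_under_mates (\<delta> - X) ?P"
      unfolding mate_closed_def
    proof
      fix z assume z: "z \<in> ?P"
      have "mate Upper \<delta> z \<in> ?P" "mate Lower \<delta> z \<in> ?P"
        using conn_closed[OF dj] z unfolding mate_closed_def by blast+
      then show "mate Upper (\<delta> - X) z \<in> ?P \<and> mate Lower (\<delta> - X) z \<in> ?P"
        using same[OF z, of Upper] same[OF z, of Lower] by simp
    qed
    fix z assume "z \<in> ?Q"
    then have "(s, z) \<in> conn (\<delta> - X)" by blast
    then show "z \<in> ?P" using conn_least[OF dj_cut _ cl] conn_refl by blast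
  qed
  moreover have "?P \<subseteq> ?Q"
  proof
    have cl: "closed_under_mates \<delta> ?Q"
      unfolding mate_closed_def
    proof
      fix z assume z: "z \<in> ?Q"
      then have zP: "z \<in> ?P" using \<open>?Q \<subseteq> ?P\<close> by blast
      have "mate Upper (\<delta> - X) z \<in> ?Q" "mate Lower (\<delta> - X) z \<in> ?Q"
        using conn_closed[OF dj_cut] z unfolding mate_closed_def by blast+
      then show "mate Upper \<delta> z \<in> ?Q \<and> mate Lower \<delta> z \<in> ?Q"
        using same[OF zP, of Upper] same[OF zP, of Lower] by simp
    qed
    fix z assume "z \<in> ?P"
    then have "(s, z) \<in> conn \<delta>" by blast
    then show "z \<in> ?Q" using conn_least[OF dj _ cl] conn_refl by blast
  qed
  ultimately have PQ: "?Q = ?P" by blast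
  have "{z \<in> ?P. mate c (\<delta> - X) z = z} = {z \<in> ?P. mate c \<delta> z = z}" if "side c" for c
    using same[OF _ that] by (intro Collect_cong) auto
  then show "{z \<in> ?Q. mate Upper (\<delta> - X) z = z} = {s}" "{z \<in> ?Q. mate Lower (\<delta> - X) z = z} = {t}"
    using idempotent_component[OF mot st idem[rule_format, OF st]] unfolding PQ by blast+
qed

text \<open>If the path from \<open>s\<close> ended at the other end of the upper edge that was cut, its vertices would be
  closed under all edges of the cycle and contain the ends of the lower edge.\<close>

lemma cut_path_cycle:
  assumes \<theta>: "\<theta> \<in> cycle_components n \<delta>" and X\<theta>: "X \<inter> edges_in \<delta> \<theta> = {{Upper a, Upper b}, {Lower p,
      Lower q}}"
    and ab: "a \<in> \<theta>" "b \<in> \<theta>" "p \<in> \<theta>" "a \<noteq> b" and s: "s \<in> {a, b}"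
  obtains t where "t \<in> {p, q}" "free_ends Upper (\<delta> - X) s = {s}"
    "free_ends Lower (\<delta> - X) s = {t}"
proof -
  let ?Q = "conn (\<delta> - X) `` {s}"
  have s\<theta>: "s \<in> \<theta>" using s ab by blast
  have \<theta>_eq: "\<theta> = conn \<delta> `` {s}" by (rule cycle_component_eq[OF \<theta> s\<theta>])
  have cyc: "is_cycle \<delta> \<theta>" using \<theta> unfolding cycle_components_def by blast
  have cl\<theta>: "closed_under_mates \<delta> \<theta>" unfolding \<theta>_eq by (rule conn_closed[OF dj])
  have eX: "{Upper a, Upper b} \<in> X" "{Lower p, Lower q} \<in> X" using X\<theta> by blast+
  have touch: "e = {Upper a, Upper b} \<or> e = {Lower p, Lower q}"
    if "e \<in> X" "c z \<in> e" "side c" "z \<in> \<theta>" for e c z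
  proof -
    have e: "e = {c z, c (mate c \<delta> z)}" by (rule cut_edge_mate(1)[OF that(1-3)])
    have "mate c \<delta> z \<in> \<theta>" using cl\<theta> that(3,4) unfolding mate_closed_def by blast
    then have "endpoints e \<subseteq> \<theta>" using that(3,4) unfolding e by auto
    then have "e \<in> edges_in \<delta> \<theta>" using cut_subset that(1) unfolding edges_in_def by blast
    then show ?thesis using X\<theta> that(1) by blast
  qed
  have other: "mate Upper (\<delta> - X) z = mate Upper \<delta> z" if "z \<in> \<theta>" "z \<notin> {a, b}" for z
  proof (rule mate_cut_other)
    show "\<not> (\<exists>e\<in>X. Upper z \<in> e)" using touch[of _ Upper z] that by auto
  qed simp
  have other': "mate Lower (\<delta> - X) z = mate Lower \<delta> z" if "z \<in> \<theta>" "z \<notin> {p, q}" for z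
  proof (rule mate_cut_other)
    show "\<not> (\<exists>e\<in>X. Lower z \<in> e)" using touch[of _ Lower z] that by auto
  qed simp
  have fix_u: "z \<in> {a, b}" if "z \<in> \<theta>" "mate Upper (\<delta> - X) z = z" for z
    using other[of z] is_cycleD[OF dj cyc that(1), of Upper] that by auto
  have fix_l: "z \<in> {p, q}" if "z \<in> \<theta>" "mate Lower (\<delta> - X) z = z" for z
    using other'[of z] is_cycleD[OF dj cyc that(1), of Lower] that by auto
  have fixed: "mate Upper (\<delta> - X) a = a" "mate Upper (\<delta> - X) b = b" "mate Lower (\<delta> - X) p = p"
    "mate Lower (\<delta> - X) q = q"
    using mate_cut_edge[OF eX(1), of Upper] mate_cut_edge[OF eX(2), of Lower] by auto
  have sub: "?Q \<subseteq> \<theta>"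
  proof -
    have "interface_edges (\<delta> - X) \<subseteq> interface_edges \<delta>" unfolding interface_edges_def by blast
    then show ?thesis using conn_mono unfolding \<theta>_eq by blast
  qed
  have "s \<in> {1..n}"
    using conn_least[OF dj _ range_closed_under_mates[OF dj], of _ s n] \<theta> motzkin_Union[OF mot] s\<theta>
    unfolding cycle_components_def interface_components_def conn_def[symmetric]
    by (auto elim!: quotientE)
  moreover have "mate Upper (\<delta> - X) s = s" using fixed s by blast
  ultimately obtain z where z: "z \<in> ?Q"
    "{x \<in> ?Q. mate Upper (\<delta> - X) x = x} = {s} \<and> {x \<in> ?Q. mate Lower (\<delta> - X) x = x} = {z}
     \<or> {x \<in> ?Q. mate Upper (\<delta> - X) x = x} = {s, z} \<and> z \<noteq> s \<and> {x \<in> ?Q. mate Lower (\<delta> - X) x = x} = {}"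
    by (rule component_ends[OF dj_cut sub_cut])
  from z(2) show ?thesis
  proof (elim disjE conjE)
    assume 1: "{x \<in> ?Q. mate Upper (\<delta> - X) x = x} = {s}" "{x \<in> ?Q. mate Lower (\<delta> - X) x = x} = {z}"
    then have "mate Lower (\<delta> - X) z = z" by blast
    then have "z \<in> {p, q}" using fix_l z(1) sub by blast
    then show ?thesis using that 1 by blast
  next
    assume 2: "{x \<in> ?Q. mate Upper (\<delta> - X) x = x} = {s, z}" "z \<noteq> s"
        "{x \<in> ?Q. mate Lower (\<delta> - X) x = x} = {}"
    have "mate Upper (\<delta> - X) z = z" using 2(1) by blast
    then have "z \<in> {a, b}" using fix_u z(1) sub by blast
    then have abQ: "a \<in> ?Q" "b \<in> ?Q" using s z(1) 2(2) conn_refl by blast+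
    have mab: "mate Upper \<delta> a = b" "mate Upper \<delta> b = a"
      using mate_eq[OF dj, of Upper a b] mate_eq[OF dj, of Upper b a] cut_in[OF eX(1)]
          by (auto simp: insert_commute)
    have "closed_under_mates \<delta> ?Q"
      unfolding mate_closed_def
    proof
      fix w assume w: "w \<in> ?Q"
      then have w\<theta>: "w \<in> \<theta>" using sub by blast
      have wQ: "mate Upper (\<delta> - X) w \<in> ?Q" "mate Lower (\<delta> - X) w \<in> ?Q"
        using conn_closed[OF dj_cut] w unfolding mate_closed_def by blast+
      have "mate Upper \<delta> w \<in> ?Q"
      proof (cases "w \<in> {a, b}")
        case True
        then show ?thesis using mab abQ by auto
      next
        case False
        then show ?thesis using other[OF w\<theta>] wQ by simp
      qed
      moreover have "w \<notin> {p, q}" using 2(3) w fixed(3,4) by blast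
      then have "mate Lower \<delta> w \<in> ?Q" using other'[OF w\<theta>] wQ by simp
      ultimately show "mate Upper \<delta> w \<in> ?Q \<and> mate Lower \<delta> w \<in> ?Q" by blast
    qed
    moreover have "(s, p) \<in> conn \<delta>" using ab(3) \<theta>_eq by blast
    ultimately have "p \<in> ?Q" using conn_least[OF dj] conn_refl by blast
    then show ?thesis using fixed(3) 2(3) by blast
  qed
qed

section \<open>Matching upper and lower ends along the paths\<close>

definition matched :: "nat \<Rightarrow> nat \<Rightarrow> bool" where
  "matched s t \<longleftrightarrow> s \<in> cut_ends Upper \<delta> X \<and> t \<in> cut_ends Lower \<delta> X \<and> (s, t) \<in> conn (\<delta> - X)"

lemma cut_path:
  assumes "s \<in> cut_ends Upper \<delta> X"
  obtains t where "matched s t" "free_ends Upper (\<delta> - X) s = {s}"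
    "free_ends Lower (\<delta> - X) s = {t}"
proof -
  obtain t where t: "t \<in> cut_ends Lower \<delta> X" "free_ends Upper (\<delta> - X) s = {s}"
    "free_ends Lower (\<delta> - X) s = {t}"
    using assms
  proof (cases rule: cut_endsE)
    case 1
    then obtain t where st: "{Upper s, Lower t} \<in> \<delta>" using ends_Upper[OF mot] by blast
    then have "t \<in> cut_ends Lower \<delta> X" using ends_Lower[OF mot] unfolding cut_ends_def by blast
    then show ?thesis using that cut_path_end[OF st] by blast
  next
    case (2 e)
    from 2(1) show ?thesis
    proof (rule cut_edgeE)
      fix \<theta> a b p q
      assume \<theta>: "\<theta> \<in> cycle_components n \<delta>" "a < b" "a \<in> \<theta>" "b \<in> \<theta>" "p \<in> \<theta>"
        "X \<inter> edges_in \<delta> \<theta> = {{Upper a, Upper b}, {Lower p, Lower q}}"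
        and e: "e = {Upper a, Upper b} \<or> e = {Lower p, Lower q}"
      have s: "s \<in> {a, b}" using e 2(2) by auto
      have "a \<noteq> b" using \<theta>(2) by simp
      then obtain t where t: "t \<in> {p, q}" "free_ends Upper (\<delta> - X) s = {s}"
        "free_ends Lower (\<delta> - X) s = {t}"
        using s by (rule cut_path_cycle[OF \<theta>(1,6,3,4,5)])
      have "{Lower p, Lower q} \<in> X" "Lower t \<in> {Lower p, Lower q}" using \<theta>(6) t(1) by blast+
      then have "t \<in> cut_ends Lower \<delta> X" unfolding cut_ends_def by blast
      then show ?thesis using that t(2,3) by blast
    qed
  qed
  have "t \<in> free_ends Lower (\<delta> - X) s" using t(3) by blast
  then have "matched s t" using assms t(1) unfolding matched_def by blast
  then show ?thesis using that t(2,3) by blast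
qed

lemma matched_right_unique:
  assumes "matched s t" "matched s t'"
  shows "t = t'"
proof -
  have s: "s \<in> cut_ends Upper \<delta> X" using assms(1) unfolding matched_def by blast
  obtain t0 where t0: "free_ends Lower (\<delta> - X) s = {t0}"
    by (rule cut_path[OF s])
  have "r = t0" if "matched s r" for r
  proof -
    have r: "r \<in> cut_ends Lower \<delta> X" "(s, r) \<in> conn (\<delta> - X)" using that unfolding matched_def by blast+
    have "mate Lower (\<delta> - X) r = r" by (rule mate_cut_ends[OF r(1)]) simp
    then show ?thesis using t0 r(2) by blast
  qed
  then show ?thesis using assms by blast
qed

lemma matched_left_unique:
  assumes "matched s t" "matched s' t"
  shows "s = s'"
proof -
  have s: "s \<in> cut_ends Upper \<delta> X" "s' \<in> cut_ends Upper \<delta> X" "(s, t) \<in> conn (\<delta> - X)"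
      "(s', t) \<in> conn (\<delta> - X)"
    using assms unfolding matched_def by blast+
  have "(s, s') \<in> conn (\<delta> - X)" using conn_trans[OF s(3) conn_sym[OF s(4)]] .
  moreover have "mate Upper (\<delta> - X) s' = s'" by (rule mate_cut_ends[OF s(2)]) simp
  ultimately have "s' \<in> free_ends Upper (\<delta> - X) s" by simp
  moreover obtain t0 where P: "free_ends Upper (\<delta> - X) s = {s}"
    by (rule cut_path[OF s(1)])
  ultimately have "s' \<in> {s}" unfolding P by blast
  then show ?thesis by simp
qed

lemma matched_end: "{Upper s, Lower t} \<in> \<delta> \<Longrightarrow> matched s t"
proof -
  assume st: "{Upper s, Lower t} \<in> \<delta>"
  have "t \<in> free_ends Lower (\<delta> - X) s" using cut_path_end(2)[OF st] by blast
  then have "(s, t) \<in> conn (\<delta> - X)" by simp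
  moreover have "s \<in> ends Upper \<delta>" "t \<in> ends Lower \<delta>"
    using st ends_Upper[OF mot] ends_Lower[OF mot] by blast+
  ultimately show ?thesis unfolding matched_def cut_ends_def by simp
qed

text \<open>Within a cut cycle the two upper ends are matched to different lower ends, and there are
  only two of these, so both are reached. This spares a mirror image of
  \<open>component_ends\<close> that starts from a lower end.\<close>

lemma matched_surj:
  assumes "t \<in> cut_ends Lower \<delta> X"
  obtains s where "matched s t"
  using assms
proof (cases rule: cut_endsE)
  case 1
  then obtain s where "{Upper s, Lower t} \<in> \<delta>" using ends_Lower[OF mot] by blast
  then show ?thesis using that matched_end by blast
next
  case (2 e)
  from 2(1) show ?thesis
  proof (rule cut_edgeE)
    fix \<theta> a b p q
    assume \<theta>: "\<theta> \<in> cycle_components n \<delta>" "a < b" "a \<in> \<theta>" "b \<in> \<theta>" "p \<in> \<theta>"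
      "X \<inter> edges_in \<delta> \<theta> = {{Upper a, Upper b}, {Lower p, Lower q}}"
      and e: "e = {Upper a, Upper b} \<or> e = {Lower p, Lower q}"
    have t: "t \<in> {p, q}" using e 2(2) by auto
    have ab: "a \<noteq> b" using \<theta>(2) by simp
    have eX: "{Upper a, Upper b} \<in> X" "{Lower p, Lower q} \<in> X" using \<theta>(6) by blast+
    have ends: "a \<in> cut_ends Upper \<delta> X" "b \<in> cut_ends Upper \<delta> X" "p \<in> cut_ends Lower \<delta> X"
        "q \<in> cut_ends Lower \<delta> X"
      unfolding cut_ends_def using eX by blast+
    have m: "\<exists>r\<in>{p, q}. matched s r" if s: "s \<in> {a, b}" for s
    proof -
      obtain r where r: "r \<in> {p, q}" "free_ends Lower (\<delta> - X) s = {r}"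
        by (rule cut_path_cycle[OF \<theta>(1,6,3,4,5) ab s])
      have "r \<in> free_ends Lower (\<delta> - X) s" using r(2) by blast
      then have "matched s r" unfolding matched_def using s r(1) ends by blast
      then show ?thesis using r(1) by blast
    qed
    obtain r where r: "r \<in> {p, q}" "matched a r" using m[of a] by blast
    obtain r' where r': "r' \<in> {p, q}" "matched b r'" using m[of b] by blast
    have "r \<noteq> r'" using matched_left_unique r(2) r'(2) ab by blast
    then have "t = r \<or> t = r'" using t r(1) r'(1) by blast
    then show ?thesis using that r(2) r'(2) by blast
  qed
qed

text \<open>Both paths have exposed ends, and they are disjoint because the first one has no free
  upper end besides \<open>s\<close>. So \<open>paths_do_not_cross\<close> applies, with the path of
  \<open>s\<close> as the separating one.\<close>

lemma matched_less:
  assumes "matched s t" "matched s' t'" "s < s'"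
  shows "t < t'"
proof -
  have s: "s \<in> cut_ends Upper \<delta> X" "s' \<in> cut_ends Upper \<delta> X" "t \<in> cut_ends Lower \<delta> X"
      "t' \<in> cut_ends Lower \<delta> X"
    "(s', t') \<in> conn (\<delta> - X)"
    using assms unfolding matched_def by blast+
  let ?P = "conn (\<delta> - X) `` {s}"
  obtain t0 where "matched s t0" and P: "{z \<in> ?P. mate Upper (\<delta> - X) z = z} = {s}"
    "{z \<in> ?P. mate Lower (\<delta> - X) z = z} = {t0}"
    by (rule cut_path[OF s(1)])
  then have t0: "t0 = t" using matched_right_unique assms(1) by blast
  have UL: "side Upper" "side Lower" by auto
  have s'P: "s' \<notin> ?P"
  proof
    assume "s' \<in> ?P"
    then have "s' \<in> {z \<in> ?P. mate Upper (\<delta> - X) z = z}" using mate_cut_ends[OF s(2) UL(1)] by simp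
    then have "s' \<in> {s}" unfolding P(1) .
    then show False using assms(3) by simp
  qed
  have t'P: "t' \<notin> ?P"
  proof
    assume "t' \<in> ?P"
    then have "(s, t') \<in> conn (\<delta> - X)" by blast
    then have "(s, s') \<in> conn (\<delta> - X)" using conn_trans conn_sym[OF s(5)] by blast
    then show False using s'P by blast
  qed
  have "s \<in> {1..n}"
    using s(1)
  proof (cases rule: cut_endsE)
    case 1
    then show ?thesis by (rule ends_in[OF mot _ UL(1)])
  next
    case (2 e)
    then have "Upper s \<in> vertices n" using cut_in motzkin_Union[OF mot] by blast
    then show ?thesis by (auto simp: vertices_def)
  qed
  then have "?P \<subseteq> {1..n}"
    using conn_least[OF dj_cut _ range_closed_under_mates[OF dj_cut sub_cut]] by blast
  then have fin: "finite ?P" by (rule finite_subset) simp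
  have "s < s' \<longleftrightarrow> t < t'"
    by (rule paths_do_not_cross[OF dj_cut nested_cut fin conn_closed[OF dj_cut] P(1)
        exposed_cut[OF UL(1) s(1)]
          P(2)[unfolded t0] exposed_cut[OF UL(2) s(3)] s(5) s'P t'P exposed_cut[OF UL(1) s(2)]
              exposed_cut[OF UL(2) s(4)]])
  then show ?thesis using assms(3) by blast
qed

section \<open>The cut diagram is an idempotent of the same kind\<close>

lemma cut_eq: "cut \<delta> X = (\<delta> - X) \<union> {{Upper s, Lower t} | s t. matched s t}"
  unfolding cut_def matched_def ..

lemma cut_transversal_iff: "{Upper s, Lower t} \<in> cut \<delta> X \<longleftrightarrow> matched s t"
proof
  assume "{Upper s, Lower t} \<in> cut \<delta> X"
  then consider "{Upper s, Lower t} \<in> \<delta>" | s' t' where "{Upper s, Lower t} = {Upper s', Lower t'}"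
      "matched s' t'"
    unfolding cut_eq by blast
  then show "matched s t"
  proof cases
    case 1
    then show ?thesis by (rule matched_end)
  next
    case 2
    then show ?thesis by (auto simp: doubleton_eq_iff)
  qed
next
  assume "matched s t"
  then show "{Upper s, Lower t} \<in> cut \<delta> X" unfolding cut_eq by blast
qed

lemma cut_arc_iff:
  assumes "side c"
  shows "{c a, c b} \<in> cut \<delta> X \<longleftrightarrow> {c a, c b} \<in> \<delta> - X"
proof
  assume "{c a, c b} \<in> cut \<delta> X"
  then consider "{c a, c b} \<in> \<delta> - X" | s t where "{c a, c b} = {Upper s, Lower t}"
    unfolding cut_eq by blast
  then show "{c a, c b} \<in> \<delta> - X"
  proof cases
    case 2
    have "transversal {c a, c b}" unfolding 2 by simp
    then show ?thesis using side_not_transversal[OF assms] by blast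
  qed
next
  assume "{c a, c b} \<in> \<delta> - X"
  then show "{c a, c b} \<in> cut \<delta> X" unfolding cut_eq by blast
qed

lemma cut_edge_not_transversal: "e \<in> X \<Longrightarrow> \<not> transversal e"
proof -
  assume "e \<in> X"
  then have "e \<in> interface_edges \<delta>" using cut_subset by blast
  then show ?thesis by (elim interface_edgesE) auto
qed

lemma cut_partition: "partition_on (vertices n) (cut \<delta> X)"
proof -
  \<comment> \<open>The transversals of \<delta> are also replaced, by themselves. Then the blocks
    of \<open>A\<close> cover exactly the vertices in \<open>cut_ends\<close>, as the matched pairs
    in \<open>M\<close> do.\<close>
  define A where "A = X \<union> {B \<in> \<delta>. transversal B}"
  define M where "M = {{Upper s, Lower t} | s t. matched s t}"
  have part: "partition_on (vertices n) \<delta>" using mot by (simp add: motzkin_diagram_def)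
  have A: "A \<subseteq> \<delta>" unfolding A_def using cut_in by blast
  have in_A: "c x \<in> \<Union>A \<longleftrightarrow> x \<in> cut_ends c \<delta> X" for c x
    unfolding A_def cut_ends_def ends_def by blast
  have M_upper: "Upper x \<in> \<Union>M \<longleftrightarrow> x \<in> cut_ends Upper \<delta> X" for x
  proof
    assume "Upper x \<in> \<Union>M"
    then obtain s t where "matched s t" "Upper x \<in> {Upper s, Lower t}" unfolding M_def by blast
    then show "x \<in> cut_ends Upper \<delta> X" unfolding matched_def by auto
  next
    assume "x \<in> cut_ends Upper \<delta> X"
    then obtain t where "matched x t" by (rule cut_path)
    then show "Upper x \<in> \<Union>M" unfolding M_def by blast
  qed
  have M_lower: "Lower x \<in> \<Union>M \<longleftrightarrow> x \<in> cut_ends Lower \<delta> X" for x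
  proof
    assume "Lower x \<in> \<Union>M"
    then obtain s t where "matched s t" "Lower x \<in> {Upper s, Lower t}" unfolding M_def by blast
    then show "x \<in> cut_ends Lower \<delta> X" unfolding matched_def by auto
  next
    assume "x \<in> cut_ends Lower \<delta> X"
    then obtain s where "matched s x" by (rule matched_surj)
    then show "Lower x \<in> \<Union>M" unfolding M_def by blast
  qed
  have "partition_on (\<Union>A) M"
  proof (rule partition_onI)
    have "v \<in> \<Union>M \<longleftrightarrow> v \<in> \<Union>A" for v
    proof (cases v)
      case (Upper x)
      then show ?thesis using M_upper in_A[of Upper] by simp
    next
      case (Lower x)
      then show ?thesis using M_lower in_A[of Lower] by simp
    qed
    then show "\<Union>M = \<Union>A" by (intro set_eqI)
  next
    fix C D assume "C \<in> M" "D \<in> M" "C \<noteq> D"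
    then obtain s t s' t' where C: "C = {Upper s, Lower t}"
        "matched s t" and D: "D = {Upper s', Lower t'}" "matched s' t'"
      unfolding M_def by blast
    have "s \<noteq> s'" using matched_right_unique[OF C(2)] D C(1) \<open>C \<noteq> D\<close> by blast
    moreover have "t \<noteq> t'" using matched_left_unique[OF C(2)] D C(1) \<open>C \<noteq> D\<close> by blast
    ultimately show "disjnt C D" unfolding C(1) D(1) disjnt_def by auto
  next
    show "{} \<notin> M" unfolding M_def by blast
  qed
  then have "partition_on (vertices n) ((\<delta> - A) \<union> M)" by (rule partition_on_replace[OF part A])
  moreover have "B \<in> M" if B: "B \<in> \<delta>" "transversal B" for B
  proof -
    obtain s t where "B = {Upper s, Lower t}" by (rule motzkin_transversal[OF mot B])
    then show ?thesis unfolding M_def using matched_end B(1) by blast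
  qed
  then have "(\<delta> - A) \<union> M = (\<delta> - X) \<union> M"
    unfolding A_def using cut_edge_not_transversal by blast
  ultimately show ?thesis unfolding cut_eq M_def[symmetric] by simp
qed

lemma cut_block_card:
  assumes "B \<in> cut \<delta> X"
  shows "B \<in> \<delta> \<or> card B = 2"
proof -
  consider "B \<in> \<delta>" | s t where "B = {Upper s, Lower t}" using assms unfolding cut_eq by blast
  then show ?thesis by cases auto
qed

lemma ends_cut:
  assumes c: "side c"
  shows "ends c (cut \<delta> X) = cut_ends c \<delta> X"
proof (intro equalityI subsetI)
  fix x assume "x \<in> ends c (cut \<delta> X)"
  then obtain B where B: "B \<in> cut \<delta> X" "transversal B" "c x \<in> B" unfolding ends_def by blast
  then consider "B \<in> \<delta>" | s t where "B = {Upper s, Lower t}" "matched s t" unfolding cut_eq by blast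
  then show "x \<in> cut_ends c \<delta> X"
  proof cases
    case 1
    then show ?thesis unfolding cut_ends_def ends_def using B by blast
  next
    case 2
    have "c = Upper \<and> x = s \<or> c = Lower \<and> x = t"
      using c B(3) unfolding 2(1) by auto
    then show ?thesis using 2(2) unfolding matched_def by blast
  qed
next
  fix x assume x: "x \<in> cut_ends c \<delta> X"
  from c show "x \<in> ends c (cut \<delta> X)"
  proof (elim insertE emptyE)
    assume "c = Upper"
    then obtain t where "matched x t" using x cut_path by blast
    then have "{Upper x, Lower t} \<in> cut \<delta> X" using cut_transversal_iff by blast
    then show ?thesis unfolding ends_def \<open>c = Upper\<close> using transversal_simps(1) by blast
  next
    assume "c = Lower"
    then obtain s where "matched s x" using x matched_surj by blast
    then have "{Upper s, Lower x} \<in> cut \<delta> X" using cut_transversal_iff by blast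
    then show ?thesis unfolding ends_def \<open>c = Lower\<close> using transversal_simps(1) by blast
  qed
qed

lemma cut_motzkin: "motzkin_diagram n (cut \<delta> X)"
proof -
  have "card B = 1 \<or> card B = 2" if "B \<in> cut \<delta> X" for B
    using cut_block_card[OF that] mot by (auto simp: motzkin_diagram_def)
  moreover have "noncrossing (cut \<delta> X)"
    unfolding noncrossing_def
  proof (intro conjI ballI allI impI)
    fix c a b d e assume c: "side c" and "{c a, c b} \<in> cut \<delta> X" "{c d, c e} \<in> cut \<delta> X"
      and lt: "a < d" "d < b"
    then have "{c a, c b} \<in> \<delta>" "{c d, c e} \<in> \<delta>" using cut_arc_iff[OF c] by blast+
    then show "\<not> b < e" using noncrossing_arcs[OF nc c _ _ lt] by blast
  next
    fix c a b x assume c: "side c" and ab: "{c a, c b} \<in> cut \<delta> X" and x: "x \<in> ends c (cut \<delta> X)" and "a < x"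
    have "mate c \<delta> a = b" using ab cut_arc_iff[OF c] mate_eq[OF dj c] by blast
    moreover have "exposed (mate c \<delta>) x" using x cut_edge_exposed[OF c] unfolding ends_cut[OF c] by blast
    ultimately show "\<not> x < b" using \<open>a < x\<close> unfolding exposed_def by blast
  next
    fix x y x' y' assume "{Upper x, Lower y} \<in> cut \<delta> X" "{Upper x', Lower y'} \<in> cut \<delta> X" "x < x'"
    then show "y < y'" using matched_less unfolding cut_transversal_iff by blast
  qed
  ultimately show ?thesis using cut_partition by (simp add: motzkin_diagram_def)
qed

text \<open>The new transversals are not edges of the interface graph, so connectivity is that of
  \<open>\<delta> - X\<close>, where matched ends are connected by construction.\<close>

lemma cut_idempotent: "diagram_mult (cut \<delta> X) (cut \<delta> X) = cut \<delta> X"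
proof -
  have "conn (cut \<delta> X) = conn (\<delta> - X)" by (rule conn_cong) (rule cut_arc_iff)
  then show ?thesis
    unfolding idempotent_iff[OF cut_motzkin] cut_transversal_iff matched_def by blast
qed

lemma cut_diff: "\<delta> - cut \<delta> X = X"
proof -
  have "e \<notin> cut \<delta> X" if e: "e \<in> X" for e
  proof -
    have "e \<in> interface_edges \<delta>" using cut_subset e by blast
    then obtain c a b where "side c" "e = {c a, c b}" by (elim interface_edgesE)
    then show ?thesis using cut_arc_iff e by blast
  qed
  then show ?thesis using cut_in unfolding cut_eq by blast
qed

section \<open>The hat map undoes the cut\<close>

lemma not_inside_cut_edge:
  assumes c: "side c" and xy: "{c x, c y} \<in> X" and z: "z \<in> cut_ends c \<delta> X"
  shows "\<not> (x < z \<and> z < y)"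
proof -
  have "mate c \<delta> x = y" using mate_eq[OF dj c] cut_in[OF xy] by blast
  then show ?thesis using cut_edge_exposed[OF c z] unfolding exposed_def by blast
qed

lemma finite_cut_ends:
  assumes c: "side c"
  shows "finite (cut_ends c \<delta> X)"
  using finite_ends[OF cut_motzkin c] unfolding ends_cut[OF c] .

text \<open>To the left of a return edge there is no end of a transversal of \<delta>, and no other
  cut edge reaches across \<open>x\<close>. So \<open>mate c \<delta>\<close> permutes the ends to
  the left of \<open>x\<close> without fixed points, and their number is even. No end lies strictly
  between \<open>x\<close> and \<open>y\<close>, hence \<open>y\<close> is the next one.\<close>

lemma cut_edge_paired:
  assumes c: "side c" and xy: "{c x, c y} \<in> X" "x < y"
  shows "paired (cut_ends c \<delta> X) x y"
proof -
  let ?J = "cut_ends c \<delta> X" and ?f = "mate c \<delta>"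
  have fin: "finite ?J" by (rule finite_cut_ends[OF c])
  have mem: "x \<in> ?J" "y \<in> ?J" using xy(1) unfolding cut_ends_def by blast+
  have fx: "?f x = y" using mate_eq[OF dj c] cut_in[OF xy(1)] by blast
  have inv: "?f (?f z) = z" for z by (rule mate_mate[OF dj c])
  have A: "?f z \<in> ?J \<and> ?f z < x \<and> ?f z \<noteq> z" if z: "z \<in> ?J" "z < x" for z
    using z(1)
  proof (cases rule: cut_endsE)
    case 1
    then show ?thesis using cut_edge_return(2)[OF c xy] z(2) by blast
  next
    case (2 e)
    note p = cut_edge_partner[OF c 2]
    have "\<not> x < ?f z" using not_inside_cut_edge[OF c p(1) mem(1)] z(2) by blast
    moreover have "?f z \<noteq> x" using inv[of z] fx xy(2) z(2) by auto
    ultimately show ?thesis using p(2,3) by simp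
  qed
  have "even (card {z \<in> ?J. z < x}) \<longleftrightarrow> even (card {w \<in> {z \<in> ?J. z < x}. ?f w = w})"
    using fin A inv by (intro involution_parity) auto
  moreover have "{w \<in> {z \<in> ?J. z < x}. ?f w = w} = {}" using A by blast
  ultimately have "even (rk ?J x)" unfolding rk_def by (metis card.empty even_zero)
  moreover have "z < y \<longleftrightarrow> z = x \<or> z < x" if "z \<in> ?J" for z
    using not_inside_cut_edge[OF c xy(1) that] xy(2) by linarith
  then have "{z \<in> ?J. z < y} = insert x {z \<in> ?J. z < x}" using mem(1) by auto
  then have "rk ?J y = Suc (rk ?J x)" unfolding rk_def using fin by simp
  ultimately show ?thesis unfolding paired_def using mem xy(2) by blast
qed

lemma card_ends_le:
  assumes c: "side c"
  shows "card (ends c \<delta>) \<le> 1"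
  using c
proof (elim insertE emptyE)
  assume "c = Upper"
  then show ?thesis using rank by simp
next
  assume "c = Lower"
  then show ?thesis
    using rank card_image_le[OF finite_ends[OF mot, of Upper], of "lower_end \<delta>"]
        ends_Lower_image[OF mot] by simp
qed

text \<open>If \<open>x\<close> is an end of a cut edge, it is paired with the other end of this
  edge, and pairs do not overlap. If \<open>x\<close> is an end of the only transversal of \<delta>,
  then \<open>y > x\<close> would have to be an end of a cut edge; but this edge can neither start
  to the right of \<open>x\<close>, being a return, nor enclose \<open>x\<close>.\<close>

lemma paired_cut_edge:
  assumes c: "side c" and xy: "paired (cut_ends c \<delta> X) x y"
  shows "{c x, c y} \<in> X"
proof -
  let ?J = "cut_ends c \<delta> X"
  have fin: "finite ?J" by (rule finite_cut_ends[OF c])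
  have mem: "x \<in> ?J" "y \<in> ?J" "x < y" using xy by (auto simp: paired_def)
  from mem(1) show ?thesis
  proof (cases rule: cut_endsE)
    case x: 1
    from mem(2) show ?thesis
    proof (cases rule: cut_endsE)
      case 1
      then have "x = y"
        using x card_ends_le[OF c] finite_ends[OF mot c] by (metis One_nat_def card_le_Suc0_iff_eq)
      then show ?thesis using mem(3) by simp
    next
      case (2 e)
      let ?w = "mate c \<delta> y"
      note p = cut_edge_partner[OF c 2]
      have wy: "{c ?w, c y} \<in> X" using p(1) by (simp add: insert_commute)
      have "?w \<noteq> x" using ends_not_cut[OF x c p(1)] by blast
      then have False
        using cut_edge_return(2)[OF c p(1) _ x] cut_edge_return(2)[OF c wy _ x]
            not_inside_cut_edge[OF c wy mem(1)]
          p(2) mem(3) by (metis linorder_neqE_nat)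
      then show ?thesis ..
    qed
  next
    case (2 e)
    let ?w = "mate c \<delta> x"
    note p = cut_edge_partner[OF c 2]
    show ?thesis
    proof (cases "x < ?w")
      case True
      then have "paired ?J x ?w" by (rule cut_edge_paired[OF c p(1)])
      then have "?w = y" using paired_right_unique[OF fin _ xy] by blast
      then show ?thesis using p(1) by simp
    next
      case False
      then have "?w < x" using p(2) by simp
      moreover have "{c ?w, c x} \<in> X" using p(1) by (simp add: insert_commute)
      ultimately have "paired ?J ?w x" using cut_edge_paired[OF c] by blast
      then show ?thesis using paired_not_both xy by blast
    qed
  qed
qed

text \<open>By the two preceding lemmas the pairs of ends formed by the hat map are exactly the cut
  edges, so its new arcs restore \<open>X\<close>. A matched transversal is removed iff its upper
  end belongs to a cut edge, which leaves just the transversals of \<delta>.\<close>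

lemma hat_cut: "hat (cut \<delta> X) = \<delta>"
proof -
  have UL: "side Upper" "side Lower" by auto
  have new: "new_arcs (cut \<delta> X) = X"
  proof (intro equalityI subsetI)
    fix e assume "e \<in> new_arcs (cut \<delta> X)"
    then obtain c x y where c: "side c" "paired (ends c (cut \<delta> X)) x y" "e = {c x, c y}"
      unfolding new_arcs_def by blast
    then show "e \<in> X" using paired_cut_edge[OF c(1)] unfolding ends_cut[OF c(1)] by blast
  next
    fix e assume e: "e \<in> X"
    then have "e \<in> interface_edges \<delta>" using cut_subset by blast
    then obtain c a b where c: "side c" "a \<noteq> b" "e = {c a, c b}" by (elim interface_edgesE)
    have e': "{c a, c b} \<in> X" "{c b, c a} \<in> X" using e c(3) by (auto simp: insert_commute)
    have "paired (ends c (cut \<delta> X)) a b \<or> paired (ends c (cut \<delta> X)) b a"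
      unfolding ends_cut[OF c(1)] using cut_edge_paired[OF c(1)] e' c(2) by (metis linorder_neqE_nat)
    moreover have "e = {c b, c a}" using c(3) by (simp add: insert_commute)
    ultimately show "e \<in> new_arcs (cut \<delta> X)" unfolding new_arcs_def using c(1,3) by blast
  qed
  have removed_iff: "{Upper s, Lower t} \<in> removed (cut \<delta> X) \<longleftrightarrow> matched s t \<and> s \<notin> ends Upper \<delta>" for s t
  proof -
    have "{Upper s, Lower t} \<in> removed (cut \<delta> X) \<longleftrightarrow> {Upper s, Lower t} \<in> cut \<delta> X
        \<and> {Upper s, Lower t} \<notin> hat (cut \<delta> X)"
      using removed_subset new_arcs_not_transversal[of "{Upper s, Lower t}"
          "cut \<delta> X"] transversal_simps(1)[of s t]
      unfolding hat_eq[OF cut_motzkin] by blast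
    also have "\<dots> \<longleftrightarrow> matched s t \<and> is_paired (cut_ends Upper \<delta> X) s"
      unfolding hat_transversal_iff[OF cut_motzkin] cut_transversal_iff ends_cut[OF UL(1)] by blast
    also have "\<dots> \<longleftrightarrow> matched s t \<and> s \<notin> ends Upper \<delta>"
    proof (intro conj_cong refl)
      assume "matched s t"
      then have s: "s \<in> cut_ends Upper \<delta> X" unfolding matched_def by blast
      show "is_paired (cut_ends Upper \<delta> X) s \<longleftrightarrow> s \<notin> ends Upper \<delta>"
      proof
        assume "is_paired (cut_ends Upper \<delta> X) s"
        then obtain z where "paired (cut_ends Upper \<delta> X) s z \<or> paired (cut_ends Upper \<delta> X) z s" by blast
        then have "\<exists>e\<in>X. Upper s \<in> e" using paired_cut_edge[OF UL(1)] by blast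
        then show "s \<notin> ends Upper \<delta>" using ends_not_cut[OF _ UL(1)] by blast
      next
        assume "s \<notin> ends Upper \<delta>"
        then obtain e where e: "e \<in> X" "Upper s \<in> e" using s unfolding cut_ends_def by blast
        note p = cut_edge_partner[OF UL(1) e]
        have p': "{Upper (mate Upper \<delta> s), Upper s} \<in> X" using p(1) by (simp add: insert_commute)
        show "is_paired (cut_ends Upper \<delta> X) s"
          using cut_edge_paired[OF UL(1) p(1)] cut_edge_paired[OF UL(1) p'] p(2)
              by (metis linorder_neqE_nat)
      qed
    qed
    finally show ?thesis .
  qed
  have old: "B \<in> cut \<delta> X - removed (cut \<delta> X) \<longleftrightarrow> B \<in> \<delta> - X" for B
  proof (cases "transversal B")
    case False
    then have "B \<notin> removed (cut \<delta> X)" using removed_transversal by blast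
    moreover have "B \<in> cut \<delta> X \<longleftrightarrow> B \<in> \<delta> - X" using False unfolding cut_eq by auto
    ultimately show ?thesis by blast
  next
    case True
    show ?thesis
    proof
      assume B: "B \<in> cut \<delta> X - removed (cut \<delta> X)"
      then obtain s t where st: "B = {Upper s, Lower t}"
          using motzkin_transversal[OF cut_motzkin _ True] by blast
      then have m: "matched s t" "s \<in> ends Upper \<delta>" using B removed_iff cut_transversal_iff by blast+
      then obtain t' where t': "{Upper s, Lower t'} \<in> \<delta>" using ends_Upper[OF mot] by blast
      then have "t' = t" using matched_end matched_right_unique m(1) by blast
      then show "B \<in> \<delta> - X" using t' st True cut_edge_not_transversal by blast
    next
      assume B: "B \<in> \<delta> - X"
      then obtain s t where st: "B = {Upper s, Lower t}" using motzkin_transversal[OF mot _ True] by blast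
      then have "s \<in> ends Upper \<delta>" using B ends_Upper[OF mot] by blast
      then have "B \<notin> removed (cut \<delta> X)" using removed_iff st by blast
      then show "B \<in> cut \<delta> X - removed (cut \<delta> X)" using B unfolding cut_eq by blast
    qed
  qed
  have "cut \<delta> X - removed (cut \<delta> X) = \<delta> - X" using old by (rule set_eqI)
  then show ?thesis unfolding hat_eq[OF cut_motzkin] new using cut_in by blast
qed

end

section \<open>Counting\<close>

lemma edges_in_disjoint:
  assumes "\<theta> \<in> cycle_components n \<delta>" "\<theta>' \<in> cycle_components n \<delta>" "e \<in> edges_in \<delta> \<theta>" "e \<in> edges_in \<delta> \<theta>'"
  shows "\<theta> = \<theta>'"
proof -
  have e: "e \<in> interface_edges \<delta>" "endpoints e \<subseteq> \<theta>" "endpoints e \<subseteq> \<theta>'"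
    using assms(3,4) unfolding edges_in_def by blast+
  obtain x where "x \<in> endpoints e" using e(1) by (elim interface_edgesE) auto
  then have "x \<in> \<theta>" "x \<in> \<theta>'" using e(2,3) by blast+
  then show ?thesis using cycle_component_eq[OF assms(1)] cycle_component_eq[OF assms(2)] by metis
qed

lemma cut_choices_subset: "Y \<in> cut_choices \<delta> \<theta> \<Longrightarrow> Y \<subseteq> edges_in \<delta> \<theta>"
  unfolding cut_choices_def by blast

text \<open>Different cycles share no edges, so the choices in the cycles are independent and can be
  read off from their union.\<close>

lemma cut_sets_bij:
  "bij_betw (\<lambda>X. restrict (\<lambda>\<theta>. X \<inter> edges_in \<delta> \<theta>) (cycle_components n \<delta>)) (cut_sets n \<delta>)
     (Pi\<^sub>E (cycle_components n \<delta>) (cut_choices \<delta>))"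
proof (rule bij_betwI[where g = "\<lambda>g. \<Union>\<theta>\<in>cycle_components n \<delta>. g \<theta>"])
  let ?C = "cycle_components n \<delta>"
  have rest: "(\<Union>\<theta>\<in>?C. g \<theta>) \<inter> edges_in \<delta> \<theta> = g \<theta>" if g: "g \<in> Pi\<^sub>E ?C (cut_choices \<delta>)" and \<theta>: "\<theta> \<in> ?C" for g \<theta>
  proof -
    have sub: "g \<theta>' \<subseteq> edges_in \<delta> \<theta>'" if "\<theta>' \<in> ?C" for \<theta>'
      using g that cut_choices_subset by (meson PiE_mem)
    show ?thesis
    proof (intro equalityI subsetI)
      fix e assume "e \<in> (\<Union>\<theta>\<in>?C. g \<theta>) \<inter> edges_in \<delta> \<theta>"
      then obtain \<theta>' where \<theta>': "\<theta>' \<in> ?C" "e \<in> g \<theta>'" "e \<in> edges_in \<delta> \<theta>" by blast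
      then have "\<theta>' = \<theta>" using edges_in_disjoint[OF \<theta>'(1) \<theta>] sub by blast
      then show "e \<in> g \<theta>" using \<theta>' by blast
    next
      fix e assume "e \<in> g \<theta>"
      then show "e \<in> (\<Union>\<theta>\<in>?C. g \<theta>) \<inter> edges_in \<delta> \<theta>" using sub[OF \<theta>] \<theta> by blast
    qed
  qed
  show "(\<lambda>X. restrict (\<lambda>\<theta>. X \<inter> edges_in \<delta> \<theta>) ?C) \<in> cut_sets n \<delta> \<rightarrow> Pi\<^sub>E ?C (cut_choices \<delta>)"
    unfolding cut_sets_def by auto
  show "(\<lambda>g. \<Union>\<theta>\<in>?C. g \<theta>) \<in> Pi\<^sub>E ?C (cut_choices \<delta>) \<rightarrow> cut_sets n \<delta>"
  proof
    fix g assume g: "g \<in> Pi\<^sub>E ?C (cut_choices \<delta>)"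
    have "(\<Union>\<theta>\<in>?C. g \<theta>) \<subseteq> (\<Union>\<theta>\<in>?C. edges_in \<delta> \<theta>)"
      using rest[OF g] by blast
    moreover have "(\<Union>\<theta>\<in>?C. g \<theta>) \<inter> edges_in \<delta> \<theta> \<in> cut_choices \<delta> \<theta>" if "\<theta> \<in> ?C" for \<theta>
      unfolding rest[OF g that] using g that by (rule PiE_mem)
    ultimately show "(\<Union>\<theta>\<in>?C. g \<theta>) \<in> cut_sets n \<delta>" unfolding cut_sets_def by blast
  qed
  show "(\<Union>\<theta>\<in>?C. restrict (\<lambda>\<theta>. X \<inter> edges_in \<delta> \<theta>) ?C \<theta>) = X" if "X \<in> cut_sets n \<delta>" for X
  proof -
    have "(\<Union>\<theta>\<in>?C. restrict (\<lambda>\<theta>. X \<inter> edges_in \<delta> \<theta>) ?C \<theta>) = X \<inter> (\<Union>\<theta>\<in>?C. edges_in \<delta> \<theta>)" by auto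
    also have "\<dots> = X" using that unfolding cut_sets_def by blast
    finally show ?thesis .
  qed
  show "restrict (\<lambda>\<theta>. (\<Union>\<theta>\<in>?C. g \<theta>) \<inter> edges_in \<delta> \<theta>) ?C = g" if g: "g \<in> Pi\<^sub>E ?C (cut_choices \<delta>)" for g
  proof
    fix \<theta>
    show "restrict (\<lambda>\<theta>. (\<Union>\<theta>\<in>?C. g \<theta>) \<inter> edges_in \<delta> \<theta>) ?C \<theta> = g \<theta>"
      using rest[OF g] PiE_arb[OF g] by (cases "\<theta> \<in> ?C") (simp_all add: restrict_def)
  qed
qed

lemma finite_vertices: "finite (vertices n)"
  by (simp add: vertices_def)

lemma motzkin_finite:
  assumes "motzkin_diagram n \<alpha>"
  shows "finite \<alpha>"
  using finite_UnionD motzkin_Union[OF assms] finite_vertices by metis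

lemma card_cut_choices:
  assumes "finite \<delta>"
  shows "card (cut_choices \<delta> \<theta>) = 1 + u_num \<delta> \<theta> * l_num \<delta> \<theta>"
proof -
  define U where "U = {e \<in> edges_in \<delta> \<theta>. upper_return \<delta> e}"
  define L where "L = {e \<in> edges_in \<delta> \<theta>. lower_return \<delta> e}"
  have fin: "finite U" "finite L"
    using assms unfolding U_def L_def edges_in_def interface_edges_def by auto
  have eq: "cut_choices \<delta> \<theta> = insert {} ((\<lambda>(e, f). {e, f}) ` (U \<times> L))"
    unfolding cut_choices_def U_def L_def by auto
  have up: "\<exists>x. Upper x \<in> e" "Lower x \<notin> e" if "e \<in> U" for e x
    using that unfolding U_def upper_return_def by auto
  have lo: "Upper x \<notin> e" if "e \<in> L" for e x
    using that unfolding L_def lower_return_def by auto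
  \<comment> \<open>The unordered pair determines its members: \<open>e\<close> consists of upper
    vertices, while \<open>f\<close> contains none.\<close>
  have "inj_on (\<lambda>(e, f). {e, f}) (U \<times> L)"
  proof (rule inj_onI, clarify)
    fix e f e' f' assume "e \<in> U" "f \<in> L" "e' \<in> U" "f' \<in> L" "{e, f} = {e', f'}"
    moreover have "e \<noteq> f'" using up(1)[OF \<open>e \<in> U\<close>] lo[OF \<open>f' \<in> L\<close>] by blast
    ultimately show "e = e' \<and> f = f'" by (auto simp: doubleton_eq_iff)
  qed
  then have "card ((\<lambda>(e, f). {e, f}) ` (U \<times> L)) = card U * card L"
    by (simp add: card_image card_cartesian_product)
  moreover have "{} \<notin> (\<lambda>(e, f). {e, f}) ` (U \<times> L)" by auto
  ultimately have "card (cut_choices \<delta> \<theta>) = 1 + card U * card L"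
    unfolding eq using fin by simp
  then show ?thesis unfolding u_num_def l_num_def U_def L_def .
qed

lemma card_cut_sets:
  assumes "motzkin_diagram n \<delta>"
  shows "card (cut_sets n \<delta>) = f_num n \<delta>"
proof -
  have "finite (interface_components n \<delta>)"
    unfolding interface_components_def quotient_def by simp
  then have fin: "finite (cycle_components n \<delta>)" unfolding cycle_components_def by simp
  have "card (cut_sets n \<delta>) = card (Pi\<^sub>E (cycle_components n \<delta>) (cut_choices \<delta>))"
    using cut_sets_bij by (rule bij_betw_same_card)
  also have "\<dots> = f_num n \<delta>"
    unfolding f_num_def card_PiE[OF fin] using card_cut_choices[OF motzkin_finite[OF assms]] by simp
  finally show ?thesis .
qed

text \<open>Blocks of size at least 1 give the Motzkin monoid, blocks of size at least 2 the Jones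
  monoid.\<close>

definition planar_monoid :: "nat \<Rightarrow> nat \<Rightarrow> diagram set" where
  "planar_monoid k n = {\<alpha>. motzkin_diagram n \<alpha> \<and> (\<forall>B\<in>\<alpha>. k \<le> card B)}"

lemma motzkin_monoid_eq_planar: "motzkin_monoid n = planar_monoid 1 n"
proof -
  have "1 \<le> card B" if "motzkin_diagram n \<alpha>" "B \<in> \<alpha>" for \<alpha> B
  proof -
    have "card B = 1 \<or> card B = 2" using that unfolding motzkin_diagram_def by blast
    then show ?thesis by linarith
  qed
  then show ?thesis unfolding motzkin_monoid_eq planar_monoid_def by blast
qed

lemma jones_monoid_eq_planar: "jones_monoid n = planar_monoid 2 n"
proof -
  have "(\<forall>B\<in>\<alpha>. card B = 2) \<longleftrightarrow> (\<forall>B\<in>\<alpha>. 2 \<le> card B)" if "motzkin_diagram n \<alpha>" for \<alpha>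
  proof -
    have "card B = 2 \<longleftrightarrow> 2 \<le> card B" if "B \<in> \<alpha>" for B
    proof -
      have "card B = 1 \<or> card B = 2" using that \<open>motzkin_diagram n \<alpha>\<close> unfolding motzkin_diagram_def by blast
      then show ?thesis by linarith
    qed
    then show ?thesis by blast
  qed
  then show ?thesis unfolding jones_monoid_eq planar_monoid_def by auto
qed

lemma finite_planar_monoid: "finite (planar_monoid k n)"
proof (rule finite_subset)
  show "planar_monoid k n \<subseteq> Pow (Pow (vertices n))"
    using motzkin_Union unfolding planar_monoid_def by blast
qed (simp add: finite_vertices)

lemma planar_monoid_idempotents_iff:
  "\<alpha> \<in> idempotents (planar_monoid k n) \<longleftrightarrow> \<alpha> \<in> planar_monoid k n \<and>
     (\<forall>x y. {Upper x, Lower y} \<in> \<alpha> \<longrightarrow> (x, y) \<in> conn \<alpha>)"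
  unfolding idempotents_def planar_monoid_def using idempotent_iff[of n \<alpha>] by auto

text \<open>The arcs added by the hat map have size 2, hence the bound on \<open>k\<close>. They
  only enlarge the interface graph, so the ends of a surviving transversal remain connected; and at
  most one transversal survives.\<close>

lemma hat_in_D_set:
  assumes k: "k \<le> 2" and \<alpha>: "\<alpha> \<in> idempotents (planar_monoid k n)"
  shows "hat \<alpha> \<in> D_set (planar_monoid k n)"
proof -
  have mot: "motzkin_diagram n \<alpha>" and card: "\<And>B. B \<in> \<alpha> \<Longrightarrow> k \<le> card B"
    and idem: "ends_connected \<alpha>"
    using \<alpha>[unfolded planar_monoid_idempotents_iff] unfolding planar_monoid_def by blast+
  have S: "hat \<alpha> \<in> planar_monoid k n"
    unfolding planar_monoid_def using hat_motzkin[OF mot] hat_block_card[OF mot] card k by fastforce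
  moreover have "(x, y) \<in> conn (hat \<alpha>)" if "{Upper x, Lower y} \<in> hat \<alpha>" for x y
    using that idem conn_mono[OF interface_edges_hat[OF mot]] hat_transversal_iff[OF mot] by blast
  ultimately have "hat \<alpha> \<in> idempotents (planar_monoid k n)"
    unfolding planar_monoid_idempotents_iff by blast
  moreover have "diagram_rank (hat \<alpha>) \<le> 1"
    unfolding diagram_rank_eq[OF hat_motzkin[OF mot]] by (rule card_ends_hat[OF mot]) simp
  then have "diagram_rank (hat \<alpha>) = 0 \<or> diagram_rank (hat \<alpha>) = 1" by linarith
  ultimately show ?thesis unfolding D_set_def using S by blast
qed

lemma D_set_cutting:
  assumes "\<delta> \<in> D_set (planar_monoid k n)" "X \<in> cut_sets n \<delta>"
  shows "cutting n \<delta> X"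
proof
  have S: "\<delta> \<in> planar_monoid k n" using assms(1) unfolding D_set_def idempotents_def by blast
  then show mot: "motzkin_diagram n \<delta>" unfolding planar_monoid_def by blast
  have "diagram_rank \<delta> \<le> 1" using assms(1) unfolding D_set_def by auto
  then show "card (ends Upper \<delta>) \<le> 1" unfolding diagram_rank_eq[OF mot] .
  show "\<forall>x y. {Upper x, Lower y} \<in> \<delta> \<longrightarrow> (x, y) \<in> conn \<delta>"
  proof (cases "diagram_rank \<delta> = 0")
    case True
    then have "ends Upper \<delta> = {}" unfolding diagram_rank_eq[OF mot]
        using finite_ends[OF mot, of Upper] by simp
    then show ?thesis using ends_Upper[OF mot] by blast
  next
    case False
    then have "\<delta> \<in> idempotents (planar_monoid k n)" using assms(1) unfolding D_set_def by simp
    then show ?thesis unfolding planar_monoid_idempotents_iff by blast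
  qed
qed (fact assms(2))

text \<open>For an idempotent \<alpha> over \<delta>, the set \<open>\<delta> - \<alpha>\<close>
  consists of the arcs that the hat map has added, and these are the edges to be cut again in order
  to recover \<alpha>.\<close>

lemma F_set_bij:
  assumes k: "k \<le> 2" and \<delta>: "\<delta> \<in> D_set (planar_monoid k n)"
  shows "bij_betw (\<lambda>\<alpha>. \<delta> - \<alpha>) (F_set (planar_monoid k n) \<delta>) (cut_sets n \<delta>)"
proof (rule bij_betwI[where g = "cut \<delta>"])
  have F: "motzkin_diagram n \<alpha>" "\<forall>x y. {Upper x, Lower y} \<in> \<alpha> \<longrightarrow> (x, y) \<in> conn \<alpha>" "hat \<alpha> = \<delta>"
    if "\<alpha> \<in> F_set (planar_monoid k n) \<delta>" for \<alpha>
  proof -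
    have "\<alpha> \<in> idempotents (planar_monoid k n)" and eq: "hat \<alpha> = \<delta>" using that unfolding F_set_def by blast+
    then show "motzkin_diagram n \<alpha>" "\<forall>x y. {Upper x, Lower y} \<in> \<alpha> \<longrightarrow> (x, y) \<in> conn \<alpha>" "hat \<alpha> = \<delta>"
      using planar_monoid_idempotents_iff[of \<alpha> k n] unfolding planar_monoid_def by blast+
  qed
  show "(\<lambda>\<alpha>. \<delta> - \<alpha>) \<in> F_set (planar_monoid k n) \<delta> \<rightarrow> cut_sets n \<delta>"
  proof
    fix \<alpha> assume "\<alpha> \<in> F_set (planar_monoid k n) \<delta>"
    note \<alpha> = F[OF this]
    show "\<delta> - \<alpha> \<in> cut_sets n \<delta>"
      using new_arcs_cut_set[OF \<alpha>(1,2)] hat_minus(1)[OF \<alpha>(1)] unfolding \<alpha>(3) by simp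
  qed
  show "cut \<delta> (\<delta> - \<alpha>) = \<alpha>" if "\<alpha> \<in> F_set (planar_monoid k n) \<delta>" for \<alpha>
    using cut_hat[OF F(1,2)[OF that]] unfolding F(3)[OF that] .
  show "\<delta> - cut \<delta> X = X" if "X \<in> cut_sets n \<delta>" for X
    by (rule cutting.cut_diff[OF D_set_cutting[OF \<delta> that]])
  show "cut \<delta> \<in> cut_sets n \<delta> \<rightarrow> F_set (planar_monoid k n) \<delta>"
  proof
    fix X assume "X \<in> cut_sets n \<delta>"
    then interpret cutting n \<delta> X by (rule D_set_cutting[OF \<delta>])
    have "\<forall>B\<in>\<delta>. k \<le> card B" using \<delta> unfolding D_set_def idempotents_def planar_monoid_def by blast
    then have "\<forall>B\<in>cut \<delta> X. k \<le> card B" using cut_block_card k by fastforce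
    then show "cut \<delta> X \<in> F_set (planar_monoid k n) \<delta>"
      unfolding F_set_def idempotents_def planar_monoid_def
      using cut_motzkin cut_idempotent hat_cut by blast
  qed
qed

lemma planar_monoid_idempotents:
  assumes k: "k \<le> 2" and S_def: "S = planar_monoid k n"
  shows "idempotents S = (\<Union>\<delta>\<in>D_set S. F_set S \<delta>)"
    and "disjoint_family_on (F_set S) (D_set S)"
    and "card (idempotents S) = (\<Sum>\<delta>\<in>D_set S. f_num n \<delta>)"
proof -
  show union: "idempotents S = (\<Union>\<delta>\<in>D_set S. F_set S \<delta>)"
    unfolding F_set_def S_def using hat_in_D_set[OF k] by blast
  show disj: "disjoint_family_on (F_set S) (D_set S)"
    unfolding disjoint_family_on_def F_set_def by blast
  have fin: "finite S" unfolding S_def by (rule finite_planar_monoid)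
  have finF: "finite (F_set S \<delta>)" for \<delta>
    unfolding F_set_def idempotents_def using fin by simp
  have finD: "finite (D_set S)" unfolding D_set_def idempotents_def using fin by simp
  have "card (idempotents S) = (\<Sum>\<delta>\<in>D_set S. card (F_set S \<delta>))"
    unfolding union using finD finF disj
    by (intro card_UN_disjoint) (auto simp: disjoint_family_on_def)
  also have "\<dots> = (\<Sum>\<delta>\<in>D_set S. f_num n \<delta>)"
  proof (rule sum.cong)
    fix \<delta> assume \<delta>: "\<delta> \<in> D_set S"
    then have "motzkin_diagram n \<delta>" unfolding D_set_def idempotents_def S_def planar_monoid_def by blast
    moreover have "card (F_set S \<delta>) = card (cut_sets n \<delta>)"
      using F_set_bij[OF k \<delta>[unfolded S_def]] unfolding S_def by (rule bij_betw_same_card)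
    ultimately show "card (F_set S \<delta>) = f_num n \<delta>" using card_cut_sets by simp
  qed simp
  finally show "card (idempotents S) = (\<Sum>\<delta>\<in>D_set S. f_num n \<delta>)" .
qed

theorem theorem3p6:
  fixes n :: nat and S :: "diagram set"
  assumes "n \<ge> 1"
    and "S = motzkin_monoid n \<or> S = jones_monoid n"
  shows "idempotents S = (\<Union>\<delta>\<in>D_set S. F_set S \<delta>) \<and>
         disjoint_family_on (F_set S) (D_set S) \<and>
         card (idempotents S) = (\<Sum>\<delta>\<in>D_set S. f_num n \<delta>)"
proof -
  have "S = planar_monoid 1 n \<or> S = planar_monoid 2 n"
    using assms(2) unfolding motzkin_monoid_eq_planar jones_monoid_eq_planar .
  then obtain k where k: "k \<le> 2" "S = planar_monoid k n"
    using that[of 1] that[of 2] by auto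
  show ?thesis
    by (intro conjI planar_monoid_idempotents[OF k])
qed

end
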